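(* Let $T:V_{\mathcal P}\to[V_{\mathcal P}]'$ be the mapping defined by $$[Tv_h,w_h]=a(v_h^+,w_h)+s(v_h^-,w_h)\qquad\forall\, v_h,w_h\in V_{\mathcal P}.$$ Then $T$ is continuous and, if the parameter $\alpha$ in $s$ is chosen such that $\alpha\ge C_{\rm equiv}$, it is also strongly monotone: there exists $\beta>0$, independent of $h$, such that $$[Tv_h-Tw_h,v_h-w_h]\ge\beta\,\|v_h-w_h\|_a^2\qquad\forall\, v_h,w_h\in V_{\mathcal P}.$$ As a consequence (when $\alpha\ge C_{\rm equiv}$), the problem of finding $u_h\in V_{\mathcal P}$ such that $$a(u_h^+,v_h)+s(u_h^-,v_h)=\langle f,v_h\rangle_\Omega\qquad\forall\, v_h\in V_{\mathcal P}$$ has a unique solution.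
   Context: Setting. $\Omega\subset\mathbb R^d$, $d\in\{1,2,3\}$, is an open bounded domain with polyhedral Lipschitz boundary; $f\in H^{-1}(\Omega)$, and $\langle\cdot,\cdot\rangle_\Omega$ is the duality pairing of $H^{-1}(\Omega)$ and $H^1_0(\Omega)$ (extending the $L^2$ inner product $(\cdot,\cdot)_\Omega$). The diffusion tensor $\mathcal D\in L^\infty(\Omega)^{d\times d}$ is symmetric and there is $d_0>0$ with $y^T\mathcal D(x)y\ge d_0|y|^2$ for all $y\in\mathbb R^d$ and a.e. $x\in\Omega$. The reaction coefficient $\mu\in L^\infty(\Omega)$ satisfies $\mu\ge\mu_0\ge0$ a.e. Set $$a(v,w)=(\mathcal D\nabla v,\nabla w)_\Omega+(\mu v,w)_\Omega,\qquad \|v\|_a=\sqrt{a(v,v)}.$$ Finite elements. $\mathcal P$ is a conforming, shape-regular partition of $\Omega$ into simplices (or affine quadrilaterals/hexahedra) $K$ with diameters $h_K$; $h=\max_K h_K$; $k\ge1$; $V_{\mathcal P}$ is the space of functions in $C^0(\Omega)\cap H^1_0(\Omega)$ whose restriction to each $K$ is in $\mathbb P_k(K)$ (simplices) or $\mathbb Q_k(K)$ (affinely mapped polynomials of degree $\le k$ in each variable, for quadrilaterals/hexahedra). $[V_{\mathcal P}]'$ is its dual and $[\cdot,\cdot]$ the duality pairing. $x_1,\dots,x_N$ are the internal Lagrange nodes and $\phi_1,\dots,\phi_N$ the associated Lagrange basis of $V_{\mathcal P}$. For a node $x$, $K_x$ is the set of elements containing $x$ (also identified with their union). The mesh function $\mathfrak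 h$ is the continuous, element-wise linear (degree $k=1$) function whose value at each vertex $x$ of $\mathcal P$ is $\frac{1}{\#K_x}\sum_{K\in K_x}h_K$. $\omega_i$ is the union of all $K\in\mathcal P$ with $K\cap K_{x_i}\ne\emptyset$. Constrained and complementary parts. $\mathfrak a>0$ is a given constant. For $v_h\in V_{\mathcal P}$, $v_h^+=\sum_{i=1}^N\max\{0,\min\{v_h(x_i),\mathfrak a\}\}\phi_i$ and $v_h^-=v_h-v_h^+$. Stabilisation. For a constant $\alpha>0$, $$s(v,w)=\alpha\sum_{i=1}^N\big(\|\mathcal D\|_{0,\infty,\omega_i}\mathfrak h(x_i)^{d-2}+\|\mu\|_{0,\infty,\omega_i}\mathfrak h(x_i)^d\big)v(x_i)w(x_i),$$ where $\|\cdot\|_{0,\infty,\omega_i}$ is the $L^\infty(\omega_i)$-norm (with a fixed matrix norm for $\mathcal D$), and $\|v\|_s=\sqrt{s(v,v)}$. $C_{\rm equiv}>0$ is a constant depending only on the shape-regularity constant (in particular not on $\alpha$) such that $\|v_h\|_a^2\le\frac{C_{\rm equiv}}{\alpha}\|v_h\|_s^2$ for all $v_h\in V_{\mathcal P}$. *)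

theory Defs
  imports "HOL-Analysis.Analysis" "HOL-Probability.Essential_Supremum"
begin

section \<open>Domains\<close>

text \<open>Near every boundary point the set is the strict hypograph, in some direction \<open>e\<close>, of a
  Lipschitz function on the hyperplane orthogonal to \<open>e\<close>.\<close>

definition lipschitz_boundary :: "(real^'n) set \<Rightarrow> bool" where
  "lipschitz_boundary \<Omega> \<longleftrightarrow>
     (\<forall>x \<in> frontier \<Omega>. \<exists>e \<gamma> L r. norm e = 1 \<and> r > 0 \<and> L-lipschitz_on {z. z \<bullet> e = 0} \<gamma> \<and>
        (\<forall>y \<in> ball x r. y \<in> \<Omega> \<longleftrightarrow> y \<bullet> e < \<gamma> (y - (y \<bullet> e) *\<^sub>R e)))"

definition polyhedral_boundary :: "(real^'n) set \<Rightarrow> bool" where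
  "polyhedral_boundary \<Omega> \<longleftrightarrow>
     (\<exists>\<F>. finite \<F> \<and> frontier \<Omega> = \<Union>\<F> \<and>
        (\<forall>S \<in> \<F>. polytope S \<and> aff_dim S = int CARD('n) - 1))"

definition polyhedral_lipschitz_domain :: "(real^'n) set \<Rightarrow> bool" where
  "polyhedral_lipschitz_domain \<Omega> \<longleftrightarrow>
     open \<Omega> \<and> bounded \<Omega> \<and> connected \<Omega> \<and> \<Omega> \<noteq> {} \<and>
     lipschitz_boundary \<Omega> \<and> polyhedral_boundary \<Omega>"

section \<open>Lebesgue and Sobolev spaces\<close>

text \<open>Members of the function spaces below are total functions of which only the values on
  \<open>\<Omega>\<close> matter.\<close>

definition in_L2 :: "(real^'n) set \<Rightarrow> (real^'n \<Rightarrow> 'b::euclidean_space) \<Rightarrow> bool" where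
  "in_L2 \<Omega> f \<longleftrightarrow> f \<in> borel_measurable (lebesgue_on \<Omega>) \<and>
     integrable (lebesgue_on \<Omega>) (\<lambda>x. (norm (f x))\<^sup>2)"

definition in_Linf :: "(real^'n) set \<Rightarrow> (real^'n \<Rightarrow> 'b::euclidean_space) \<Rightarrow> bool" where
  "in_Linf \<Omega> f \<longleftrightarrow> f \<in> borel_measurable (lebesgue_on \<Omega>) \<and>
     (\<exists>C. AE x in lebesgue_on \<Omega>. norm (f x) \<le> C)"

text \<open>The \<open>L\<^sup>\<infinity>\<close>-norm on \<open>A\<close> of a function whose pointwise norm is \<open>g\<close>.\<close>

definition Linf_norm :: "(real^'n) set \<Rightarrow> (real^'n \<Rightarrow> real) \<Rightarrow> real" where
  "Linf_norm A g = real_of_ereal (esssup (lebesgue_on A) (\<lambda>x. ereal (g x)))"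

definition is_norm :: "('a::real_vector \<Rightarrow> real) \<Rightarrow> bool" where
  "is_norm N \<longleftrightarrow> (\<forall>x. 0 \<le> N x) \<and> (\<forall>x. N x = 0 \<longleftrightarrow> x = 0) \<and>
     (\<forall>c x. N (c *\<^sub>R x) = \<bar>c\<bar> * N x) \<and> (\<forall>x y. N (x + y) \<le> N x + N y)"

definition partial_deriv :: "'n \<Rightarrow> (real^'n \<Rightarrow> real) \<Rightarrow> real^'n \<Rightarrow> real" where
  "partial_deriv i f x = frechet_derivative f (at x) (axis i 1)"

primrec C_k :: "nat \<Rightarrow> (real^'n \<Rightarrow> real) \<Rightarrow> bool" where
  "C_k 0 f \<longleftrightarrow> continuous_on UNIV f"
| "C_k (Suc m) f \<longleftrightarrow> (\<forall>x. f differentiable (at x)) \<and> (\<forall>i. C_k m (partial_deriv i f))"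

definition test_functions :: "(real^'n) set \<Rightarrow> (real^'n \<Rightarrow> real) set" where
  "test_functions \<Omega> = {\<psi>. (\<forall>m. C_k m \<psi>) \<and>
     compact (closure {x. \<psi> x \<noteq> 0}) \<and> closure {x. \<psi> x \<noteq> 0} \<subseteq> \<Omega>}"

definition weak_gradient ::
  "(real^'n) set \<Rightarrow> (real^'n \<Rightarrow> real) \<Rightarrow> (real^'n \<Rightarrow> real^'n) \<Rightarrow> bool" where
  "weak_gradient \<Omega> v g \<longleftrightarrow>
     (\<forall>\<psi> \<in> test_functions \<Omega>. \<forall>i.
        (LINT x|lebesgue_on \<Omega>. v x * partial_deriv i \<psi> x)
          = - (LINT x|lebesgue_on \<Omega>. g x $ i * \<psi> x))"

definition H1 :: "(real^'n) set \<Rightarrow> (real^'n \<Rightarrow> real) set" where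
  "H1 \<Omega> = {v. in_L2 \<Omega> v \<and> (\<exists>g. in_L2 \<Omega> g \<and> weak_gradient \<Omega> v g)}"

text \<open>The weak gradient is unique up to null sets, so the choice is immaterial under integrals.\<close>

definition wgrad :: "(real^'n) set \<Rightarrow> (real^'n \<Rightarrow> real) \<Rightarrow> real^'n \<Rightarrow> real^'n" where
  "wgrad \<Omega> v = (SOME g. in_L2 \<Omega> g \<and> weak_gradient \<Omega> v g)"

definition H1_norm :: "(real^'n) set \<Rightarrow> (real^'n \<Rightarrow> real) \<Rightarrow> real" where
  "H1_norm \<Omega> v = sqrt ((LINT x|lebesgue_on \<Omega>. (v x)\<^sup>2)
     + (LINT x|lebesgue_on \<Omega>. (norm (wgrad \<Omega> v x))\<^sup>2))"

definition H10 :: "(real^'n) set \<Rightarrow> (real^'n \<Rightarrow> real) set" where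
  "H10 \<Omega> = {v \<in> H1 \<Omega>. \<exists>\<psi>. (\<forall>m::nat. \<psi> m \<in> test_functions \<Omega>) \<and>
     (\<lambda>m. H1_norm \<Omega> (\<lambda>x. v x - \<psi> m x)) \<longlonglongrightarrow> 0}"

text \<open>For a subspace \<open>V\<close> of \<open>H1 \<Omega>\<close> with the \<open>H1\<close>-norm: its dual, the dual norm, and continuity
  of an operator from \<open>V\<close> into the dual.  Functionals are only meaningful on \<open>V\<close>.
  \<open>dual_space \<Omega> (H10 \<Omega>)\<close> is \<open>H\<^sup>-\<^sup>1(\<Omega>)\<close>, the duality pairing being function application.\<close>

definition dual_space ::
  "(real^'n) set \<Rightarrow> (real^'n \<Rightarrow> real) set \<Rightarrow> ((real^'n \<Rightarrow> real) \<Rightarrow> real) set" where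
  "dual_space \<Omega> V = {l.
     (\<forall>v \<in> V. \<forall>w \<in> V. l (\<lambda>x. v x + w x) = l v + l w) \<and>
     (\<forall>c. \<forall>v \<in> V. l (\<lambda>x. c * v x) = c * l v) \<and>
     (\<exists>C. \<forall>v \<in> V. \<bar>l v\<bar> \<le> C * H1_norm \<Omega> v)}"

definition dual_norm ::
  "(real^'n) set \<Rightarrow> (real^'n \<Rightarrow> real) set \<Rightarrow> ((real^'n \<Rightarrow> real) \<Rightarrow> real) \<Rightarrow> real" where
  "dual_norm \<Omega> V l = (SUP w \<in> {w \<in> V. H1_norm \<Omega> w \<le> 1}. \<bar>l w\<bar>)"

definition continuous_into_dual ::
  "(real^'n) set \<Rightarrow> (real^'n \<Rightarrow> real) set
     \<Rightarrow> ((real^'n \<Rightarrow> real) \<Rightarrow> (real^'n \<Rightarrow> real) \<Rightarrow> real) \<Rightarrow> bool" where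
  "continuous_into_dual \<Omega> V T \<longleftrightarrow>
     (\<forall>v \<in> V. T v \<in> dual_space \<Omega> V) \<and>
     (\<forall>v \<in> V. \<forall>\<epsilon>>0. \<exists>\<delta>>0. \<forall>w \<in> V.
        H1_norm \<Omega> (\<lambda>x. w x - v x) < \<delta> \<longrightarrow> dual_norm \<Omega> V (\<lambda>z. T w z - T v z) < \<epsilon>)"

section \<open>Meshes\<close>

datatype element_kind = Simplicial | Tensorial

definition affine_param :: "(real^'n) set \<Rightarrow> (real^'n \<Rightarrow> real^'n) \<Rightarrow> bool" where
  "affine_param K F \<longleftrightarrow>
     (\<exists>A b. invertible A \<and> F = (\<lambda>x. b + A *v x) \<and> K = F ` cbox 0 (\<chi> i. 1))"

fun is_element :: "element_kind \<Rightarrow> (real^'n) set \<Rightarrow> bool" where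
  "is_element Simplicial K \<longleftrightarrow> (int CARD('n)) simplex K"
| "is_element Tensorial K \<longleftrightarrow> (\<exists>F. affine_param K F)"

definition conforming_mesh ::
  "element_kind \<Rightarrow> (real^'n) set \<Rightarrow> (real^'n) set set \<Rightarrow> bool" where
  "conforming_mesh kd \<Omega> P \<longleftrightarrow>
     finite P \<and> \<Union>P = closure \<Omega> \<and> (\<forall>K \<in> P. is_element kd K) \<and>
     (\<forall>K \<in> P. \<forall>K' \<in> P. K \<inter> K' face_of K \<and> K \<inter> K' face_of K')"

definition inball_diameter :: "(real^'n) set \<Rightarrow> real" where
  "inball_diameter K = Sup {2 * r | r. r \<ge> 0 \<and> (\<exists>x. cball x r \<subseteq> K)}"

definition shape_regular :: "real \<Rightarrow> (real^'n) set set \<Rightarrow> bool" where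
  "shape_regular \<sigma> P \<longleftrightarrow> (\<forall>K \<in> P. diameter K \<le> \<sigma> * inball_diameter K)"

definition element_vertices :: "(real^'n) set \<Rightarrow> (real^'n) set" where
  "element_vertices K = {x. x extreme_point_of K}"

definition elements_at :: "(real^'n) set set \<Rightarrow> real^'n \<Rightarrow> (real^'n) set set" where
  "elements_at P x = {K \<in> P. x \<in> K}"

definition patch :: "(real^'n) set set \<Rightarrow> real^'n \<Rightarrow> (real^'n) set" where
  "patch P x = \<Union>{K \<in> P. K \<inter> \<Union>(elements_at P x) \<noteq> {}}"

section \<open>Finite elements\<close>

definition monomials_P :: "nat \<Rightarrow> ('n::finite \<Rightarrow> nat) set" where
  "monomials_P k = {m. (\<Sum>i\<in>UNIV. m i) \<le> k}"

definition monomials_Q :: "nat \<Rightarrow> ('n::finite \<Rightarrow> nat) set" where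
  "monomials_Q k = {m. \<forall>i. m i \<le> k}"

definition polynomials :: "('n::finite \<Rightarrow> nat) set \<Rightarrow> (real^'n \<Rightarrow> real) set" where
  "polynomials M = {p. \<exists>c. p = (\<lambda>x. \<Sum>m\<in>M. c m * (\<Prod>i\<in>UNIV. (x $ i) ^ m i))}"

text \<open>In the tensorial case neither the polynomial space nor the nodes depend on the parametrisation
  of \<open>K\<close>: two parametrisations differ by a symmetry of the unit cube.\<close>

fun local_space :: "element_kind \<Rightarrow> nat \<Rightarrow> (real^'n) set \<Rightarrow> (real^'n \<Rightarrow> real) set" where
  "local_space Simplicial k K = polynomials (monomials_P k)"
| "local_space Tensorial k K =
     {p. \<exists>F. affine_param K F \<and> p \<circ> F \<in> polynomials (monomials_Q k)}"

fun local_nodes :: "element_kind \<Rightarrow> nat \<Rightarrow> (real^'n) set \<Rightarrow> (real^'n) set" where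
  "local_nodes Simplicial k K =
     {\<Sum>z\<in>element_vertices K. (real (m z) / real k) *\<^sub>R z | m. (\<Sum>z\<in>element_vertices K. m z) = k}"
| "local_nodes Tensorial k K =
     {F y | F y. affine_param K F \<and> (\<forall>i. \<exists>j\<le>k. y $ i = real j / real k)}"

definition internal_nodes ::
  "element_kind \<Rightarrow> nat \<Rightarrow> (real^'n) set \<Rightarrow> (real^'n) set set \<Rightarrow> (real^'n) set" where
  "internal_nodes kd k \<Omega> P = (\<Union>K\<in>P. local_nodes kd k K) \<inter> \<Omega>"

text \<open>Functions on \<open>\<Omega>\<close> are represented by their extension by zero, so that two members of the
  finite element space are equal iff they agree on \<open>\<Omega>\<close>.\<close>

definition fe_space ::
  "element_kind \<Rightarrow> nat \<Rightarrow> (real^'n) set \<Rightarrow> (real^'n) set set \<Rightarrow> (real^'n \<Rightarrow> real) set" where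
  "fe_space kd k \<Omega> P = {v. continuous_on \<Omega> v \<and> v \<in> H10 \<Omega> \<and> (\<forall>x. x \<notin> \<Omega> \<longrightarrow> v x = 0) \<and>
     (\<forall>K\<in>P. \<exists>p \<in> local_space kd k K. \<forall>x \<in> K \<inter> \<Omega>. v x = p x)}"

text \<open>The Lagrange basis, indexed by the internal nodes.  Linear independence is implied by the
  second condition.\<close>

definition lagrange_basis ::
  "element_kind \<Rightarrow> nat \<Rightarrow> (real^'n) set \<Rightarrow> (real^'n) set set
     \<Rightarrow> (real^'n \<Rightarrow> real^'n \<Rightarrow> real) \<Rightarrow> bool" where
  "lagrange_basis kd k \<Omega> P \<phi> \<longleftrightarrow>
     (\<forall>y \<in> internal_nodes kd k \<Omega> P. \<phi> y \<in> fe_space kd k \<Omega> P) \<and>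
     (\<forall>y \<in> internal_nodes kd k \<Omega> P. \<forall>z \<in> internal_nodes kd k \<Omega> P.
        \<phi> y z = (if y = z then 1 else 0)) \<and>
     (\<forall>v \<in> fe_space kd k \<Omega> P. \<exists>c. v = (\<lambda>x. \<Sum>y\<in>internal_nodes kd k \<Omega> P. c y * \<phi> y x))"

text \<open>The mesh function; these conditions determine it uniquely on \<open>\<Union>P\<close>.\<close>

definition mesh_function ::
  "element_kind \<Rightarrow> (real^'n) set set \<Rightarrow> (real^'n \<Rightarrow> real) \<Rightarrow> bool" where
  "mesh_function kd P hf \<longleftrightarrow>
     continuous_on (\<Union>P) hf \<and>
     (\<forall>K\<in>P. \<exists>p \<in> local_space kd 1 K. \<forall>x\<in>K. hf x = p x) \<and>
     (\<forall>x \<in> (\<Union>K\<in>P. element_vertices K).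
        hf x = (\<Sum>K\<in>elements_at P x. diameter K) / real (card (elements_at P x)))"

section \<open>The nonlinear scheme\<close>

definition a_form ::
  "(real^'n) set \<Rightarrow> (real^'n \<Rightarrow> real^'n^'n) \<Rightarrow> (real^'n \<Rightarrow> real)
     \<Rightarrow> (real^'n \<Rightarrow> real) \<Rightarrow> (real^'n \<Rightarrow> real) \<Rightarrow> real" where
  "a_form \<Omega> \<D> \<mu> v w =
     (LINT x|lebesgue_on \<Omega>. (\<D> x *v wgrad \<Omega> v x) \<bullet> wgrad \<Omega> w x)
     + (LINT x|lebesgue_on \<Omega>. \<mu> x * v x * w x)"

definition a_norm ::
  "(real^'n) set \<Rightarrow> (real^'n \<Rightarrow> real^'n^'n) \<Rightarrow> (real^'n \<Rightarrow> real) \<Rightarrow> (real^'n \<Rightarrow> real) \<Rightarrow> real" where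
  "a_norm \<Omega> \<D> \<mu> v = sqrt (a_form \<Omega> \<D> \<mu> v v)"

text \<open>\<open>N\<close> is the matrix norm, \<open>hf\<close> the mesh function, \<open>X\<close> the set of internal nodes.  The elements
  are closed, hence the intersection of the patches with \<open>\<Omega>\<close>, where the coefficients live.\<close>

definition s_form ::
  "(real^'n) set \<Rightarrow> (real^'n^'n \<Rightarrow> real) \<Rightarrow> (real^'n \<Rightarrow> real^'n^'n) \<Rightarrow> (real^'n \<Rightarrow> real)
     \<Rightarrow> (real^'n) set set \<Rightarrow> (real^'n) set \<Rightarrow> (real^'n \<Rightarrow> real)
     \<Rightarrow> real \<Rightarrow> (real^'n \<Rightarrow> real) \<Rightarrow> (real^'n \<Rightarrow> real) \<Rightarrow> real" where
  "s_form \<Omega> N \<D> \<mu> P X hf \<alpha> v w =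
     \<alpha> * (\<Sum>x\<in>X.
       (Linf_norm (patch P x \<inter> \<Omega>) (\<lambda>y. N (\<D> y)) * hf x powi (int CARD('n) - 2)
        + Linf_norm (patch P x \<inter> \<Omega>) (\<lambda>y. \<bar>\<mu> y\<bar>) * hf x ^ CARD('n)) * v x * w x)"

definition s_norm ::
  "(real^'n) set \<Rightarrow> (real^'n^'n \<Rightarrow> real) \<Rightarrow> (real^'n \<Rightarrow> real^'n^'n) \<Rightarrow> (real^'n \<Rightarrow> real)
     \<Rightarrow> (real^'n) set set \<Rightarrow> (real^'n) set \<Rightarrow> (real^'n \<Rightarrow> real)
     \<Rightarrow> real \<Rightarrow> (real^'n \<Rightarrow> real) \<Rightarrow> real" where
  "s_norm \<Omega> N \<D> \<mu> P X hf \<alpha> v = sqrt (s_form \<Omega> N \<D> \<mu> P X hf \<alpha> v v)"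

definition plus_part ::
  "real \<Rightarrow> (real^'n) set \<Rightarrow> (real^'n \<Rightarrow> real^'n \<Rightarrow> real)
     \<Rightarrow> (real^'n \<Rightarrow> real) \<Rightarrow> real^'n \<Rightarrow> real" where
  "plus_part \<aa> X \<phi> v = (\<lambda>x. \<Sum>y\<in>X. max 0 (min (v y) \<aa>) * \<phi> y x)"

definition minus_part ::
  "real \<Rightarrow> (real^'n) set \<Rightarrow> (real^'n \<Rightarrow> real^'n \<Rightarrow> real)
     \<Rightarrow> (real^'n \<Rightarrow> real) \<Rightarrow> real^'n \<Rightarrow> real" where
  "minus_part \<aa> X \<phi> v = (\<lambda>x. v x - plus_part \<aa> X \<phi> v x)"

definition T_op ::
  "(real^'n) set \<Rightarrow> (real^'n^'n \<Rightarrow> real) \<Rightarrow> (real^'n \<Rightarrow> real^'n^'n) \<Rightarrow> (real^'n \<Rightarrow> real)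
     \<Rightarrow> (real^'n) set set \<Rightarrow> (real^'n) set \<Rightarrow> (real^'n \<Rightarrow> real) \<Rightarrow> (real^'n \<Rightarrow> real^'n \<Rightarrow> real)
     \<Rightarrow> real \<Rightarrow> real \<Rightarrow> (real^'n \<Rightarrow> real) \<Rightarrow> (real^'n \<Rightarrow> real) \<Rightarrow> real" where
  "T_op \<Omega> N \<D> \<mu> P X hf \<phi> \<aa> \<alpha> v w =
     a_form \<Omega> \<D> \<mu> (plus_part \<aa> X \<phi> v) w + s_form \<Omega> N \<D> \<mu> P X hf \<alpha> (minus_part \<aa> X \<phi> v) w"

end

theory Submission
  imports Defs
begin

text \<open>On nodal values the map \<open>v \<mapsto> v\<^sup>+\<close> is the componentwise projection onto \<open>[0, \<aa>]\<close>, so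
  both it and its complement are monotone and nonexpansive.  Writing \<open>v - w = A + B\<close> with
  \<open>A = v\<^sup>+ - w\<^sup>+\<close> and \<open>B = v\<^sup>- - w\<^sup>-\<close>, the cross term \<open>s(B, A)\<close> is nonnegative because the weights
  of \<open>s\<close> are, and \<open>\<alpha> \<ge> C_equiv\<close> gives \<open>s(B, B) \<ge> a(B, B)\<close>; hence
  \<open>[Tv - Tw, v - w] \<ge> a(A, A) + a(A, B) + a(B, B) \<ge> a(v - w, v - w) / 4\<close>.  In nodal coordinates \<open>T\<close>
  is therefore Lipschitz and strongly monotone with respect to the Euclidean norm, and the damped
  fixed-point iteration \<open>c \<mapsto> c - t (T c - f)\<close> is a contraction.  The bilinearity and definiteness of
  \<open>a\<close> rest on the uniqueness of weak gradients and on the fact that a function in \<open>H\<^sup>1\<^sub>0\<close> with zero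
  gradient vanishes.\<close>

section \<open>Finite-dimensional tools\<close>

text \<open>The truncation acts on nodal values, not pointwise, and the Gram matrix of
  \<open>a_form\<close> may have entries of either sign, so a(A, B) has no sign of its own. It is
  absorbed by a(A, A) and a(B, B), and the only cross term that needs a sign is one of the diagonal
  form s. Two kinds of constants have to be kept apart. The monotonicity constant is a pure number
  and serves every mesh. The Lipschitz constant and the comparison of norms with nodal values come
  from finite sums and compactness and depend on the mesh; this does no harm, because continuity and
  solvability are claimed for one mesh at a time. Further obstacles lie in the objects themselves:
  \<open>wgrad\<close> is a choice, hence linear only up to null sets; a tensorial
  \<open>local_space\<close> quantifies over parametrisations, so that closure under addition rests
  on the symmetries of the cube; and the weights are evaluated at Lagrange nodes, while the mesh
  function is prescribed only at vertices.\<close>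

text \<open>Both sides are homogeneous of degree 2, so it suffices to look at the Euclidean unit
  sphere, where a continuous positive function attains a positive minimum.\<close>

lemma posdef_form_coercive:
  fixes G :: "'a \<Rightarrow> 'a \<Rightarrow> real"
  assumes I: "finite I"
    and pos: "\<And>c. \<exists>i\<in>I. c i \<noteq> 0 \<Longrightarrow> 0 < (\<Sum>i\<in>I. \<Sum>j\<in>I. c i * c j * G i j)"
  shows "\<exists>l>0. \<forall>c. l * (\<Sum>i\<in>I. (c i)\<^sup>2) \<le> (\<Sum>i\<in>I. \<Sum>j\<in>I. c i * c j * G i j)"
proof (cases "I = {}")
  case True
  then show ?thesis by (auto intro: exI[of _ 1])
next
  case False
  define Q where "Q c = (\<Sum>i\<in>I. \<Sum>j\<in>I. c i * c j * G i j)" for c :: "'a \<Rightarrow> real"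
  define n2 where "n2 c = (\<Sum>i\<in>I. (c i)\<^sup>2)" for c :: "'a \<Rightarrow> real"
  \<comment> \<open>Coordinates outside \<open>I\<close> are pinned to 0: a product of compact
    factors is compact by Tychonoff, even over an infinite index type.\<close>
  define B :: "('a \<Rightarrow> real) set" where "B = PiE UNIV (\<lambda>i. if i \<in> I then {-1..1} else {0})"
  define S where "S = B \<inter> {c. n2 c = 1}"
  have cont_coord: "continuous_on UNIV (\<lambda>c::'a \<Rightarrow> real. c i)" for i
    by (rule continuous_on_product_coordinates)
  have cont_Q: "continuous_on UNIV Q" and cont_n: "continuous_on UNIV n2"
    unfolding Q_def n2_def by (intro continuous_intros cont_coord)+
  have "compact B"
    unfolding B_def
    using compactin_PiE[of "\<lambda>_. euclidean" UNIV "\<lambda>i. if i \<in> I then {-1..1} else {0::real}"]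
    by (auto simp: euclidean_product_topology)
  moreover have "closed {c. n2 c = 1}"
    by (rule closed_Collect_eq[OF cont_n]) (auto intro: continuous_intros)
  ultimately have "compact S"
    unfolding S_def by (rule compact_Int_closed)
  moreover obtain i0 where i0: "i0 \<in> I" using False by auto
  have "(\<lambda>i. if i = i0 then 1 else 0) \<in> S"
    using i0 I by (auto simp: S_def B_def n2_def if_distrib[of "\<lambda>x. x\<^sup>2"] sum.delta cong: if_cong)
  hence "S \<noteq> {}" by auto
  ultimately obtain m where m: "m \<in> S" "\<And>c. c \<in> S \<Longrightarrow> Q m \<le> Q c"
    using continuous_attains_inf[of S Q] continuous_on_subset[OF cont_Q] by auto
  have "\<exists>i\<in>I. m i \<noteq> 0"
  proof (rule ccontr)
    assume "\<not> ?thesis"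
    hence "n2 m = 0" by (auto simp: n2_def)
    thus False using m(1) by (auto simp: S_def)
  qed
  hence Qm: "Q m > 0" unfolding Q_def by (rule pos)
  have "Q m * n2 c \<le> Q c" for c
  proof (cases "n2 c = 0")
    case True
    hence "\<forall>i\<in>I. c i = 0" using I by (auto simp: n2_def sum_nonneg_eq_0_iff)
    hence "Q c = 0" by (auto simp: Q_def)
    with True show ?thesis by simp
  next
    case False
    have n0: "n2 c > 0" using False sum_nonneg[of I "\<lambda>i. (c i)\<^sup>2"] by (auto simp: n2_def)
    define s where "s = sqrt (n2 c)"
    have s: "s > 0" "s\<^sup>2 = n2 c" using n0 by (auto simp: s_def)
    define d where "d i = (if i \<in> I then c i / s else 0)" for i
    have nd: "n2 d = 1"
      using s n0 by (simp add: n2_def d_def power_divide flip: sum_divide_distrib)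
    have "d i \<in> {-1..1}" if "i \<in> I" for i
    proof -
      have "(d i)\<^sup>2 \<le> 1" using member_le_sum[OF that, of "\<lambda>i. (d i)\<^sup>2"] I nd by (auto simp: n2_def)
      thus ?thesis using abs_square_le_1[of "d i"] by auto
    qed
    hence "d \<in> S" using nd by (auto simp: S_def B_def d_def)
    hence "Q m \<le> Q d" by (rule m(2))
    also have "Q d = Q c / s\<^sup>2"
      by (simp add: Q_def d_def sum_divide_distrib power2_eq_square)
    finally show ?thesis using n0 s by (simp add: field_simps)
  qed
  thus ?thesis using Qm unfolding Q_def n2_def by blast
qed

text \<open>Zarantonello's theorem in finite dimension, by Banach's fixed-point argument.
  \<open>L\<close> compares squared norms, hence is the square of a Lipschitz constant.\<close>

lemma strongly_monotone_lipschitz_surj: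
  fixes T :: "('a \<Rightarrow> real) \<Rightarrow> 'a \<Rightarrow> real"
  assumes I: "finite I" and m: "m > 0" and L: "L > 0"
    and mono: "\<And>c d. m * (\<Sum>i\<in>I. (c i - d i)\<^sup>2) \<le> (\<Sum>i\<in>I. (T c i - T d i) * (c i - d i))"
    and lip: "\<And>c d. (\<Sum>i\<in>I. (T c i - T d i)\<^sup>2) \<le> L * (\<Sum>i\<in>I. (c i - d i)\<^sup>2)"
  shows "\<exists>c. \<forall>i\<in>I. T c i = F i"
proof -
  define n2 where "n2 c = (\<Sum>i\<in>I. (c i)\<^sup>2)" for c :: "'a \<Rightarrow> real"
  \<comment> \<open>The squared contraction factor \<open>1 - 2 * t * m + t\<^sup>2 * L\<close> is
    smallest at \<open>t = m / L\<close>, with value \<open>1 - m\<^sup>2 / L\<close>.\<close>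
  define t where "t = m / L"
  define S where "S c i = c i - t * (T c i - F i)" for c i
  \<comment> \<open>For nonempty \<open>I\<close> the hypotheses force
    \<open>m\<^sup>2 \<le> L\<close>; the cut-off at 0 also covers an empty \<open>I\<close>, where
    \<open>m\<close> and \<open>L\<close> are unrelated.\<close>
  define q where "q = max 0 (1 - m\<^sup>2 / L)"
  have t: "t > 0" using m L by (simp add: t_def)
  have q: "0 \<le> q" "q < 1" using m L by (auto simp: q_def)
  have n2_nonneg: "n2 c \<ge> 0" for c by (auto simp: n2_def intro: sum_nonneg)
  have contr: "n2 (\<lambda>i. S c i - S d i) \<le> q * n2 (\<lambda>i. c i - d i)" for c d
  proof -
    have "n2 (\<lambda>i. S c i - S d i) =
        (\<Sum>i\<in>I. (c i - d i)\<^sup>2 - 2 * t * ((T c i - T d i) * (c i - d i)) + t\<^sup>2 * (T c i - T d i)\<^sup>2)"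
      unfolding n2_def S_def by (intro sum.cong) (auto simp: power2_eq_square algebra_simps)
    also have "\<dots> = n2 (\<lambda>i. c i - d i) - 2 * t * (\<Sum>i\<in>I. (T c i - T d i) * (c i - d i))
        + t\<^sup>2 * (\<Sum>i\<in>I. (T c i - T d i)\<^sup>2)"
      by (simp add: n2_def sum.distrib sum_subtractf sum_distrib_left)
    also have "\<dots> \<le> n2 (\<lambda>i. c i - d i) - 2 * t * (m * n2 (\<lambda>i. c i - d i))
        + t\<^sup>2 * (L * n2 (\<lambda>i. c i - d i))"
      using mono[of c d] lip[of c d] t unfolding n2_def
      by (intro add_mono diff_mono mult_left_mono) auto
    also have "\<dots> = (1 - m\<^sup>2 / L) * n2 (\<lambda>i. c i - d i)"
      using L by (simp add: t_def field_simps power2_eq_square)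
    also have "\<dots> \<le> q * n2 (\<lambda>i. c i - d i)"
      by (intro mult_right_mono n2_nonneg) (auto simp: q_def)
    finally show ?thesis .
  qed
  define x where "x n = (S ^^ n) (\<lambda>_. 0)" for n
  have x_Suc: "x (Suc n) = S (x n)" for n by (simp add: x_def)
  define A where "A = n2 (\<lambda>i. x 1 i - x 0 i)"
  have step: "n2 (\<lambda>i. x (Suc n) i - x n i) \<le> q ^ n * A" for n
  proof (induction n)
    case (Suc n)
    have "n2 (\<lambda>i. x (Suc (Suc n)) i - x (Suc n) i) \<le> q * n2 (\<lambda>i. x (Suc n) i - x n i)"
      unfolding x_Suc[of "Suc n"] x_Suc[of n] by (rule contr)
    also have "\<dots> \<le> q * (q ^ n * A)" using Suc q by (intro mult_left_mono) auto
    finally show ?case by (simp add: mult_ac)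
  qed (simp add: A_def)
  \<comment> \<open>The increments of each coordinate decay like the powers of
    \<open>sqrt q\<close>, so the telescoping series converges.\<close>
  have conv: "convergent (\<lambda>n. x n i)" if "i \<in> I" for i
  proof -
    have le: "\<bar>x (Suc n) i - x n i\<bar> \<le> sqrt A * sqrt q ^ n" for n
    proof -
      have "(x (Suc n) i - x n i)\<^sup>2 \<le> n2 (\<lambda>i. x (Suc n) i - x n i)"
        unfolding n2_def using that I by (intro member_le_sum[of i I "\<lambda>i. (x (Suc n) i - x n i)\<^sup>2"]) auto
      also have "\<dots> \<le> q ^ n * A" by (rule step)
      finally have "sqrt ((x (Suc n) i - x n i)\<^sup>2) \<le> sqrt (q ^ n * A)" by (rule real_sqrt_le_mono)
      thus ?thesis unfolding real_sqrt_abs by (simp add: real_sqrt_mult real_sqrt_power mult.commute)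
    qed
    have "summable (\<lambda>n. sqrt A * sqrt q ^ n)"
      using q by (intro summable_mult summable_geometric) (auto simp: real_sqrt_lt_1_iff)
    hence "summable (\<lambda>n. x (Suc n) i - x n i)"
      by (rule summable_comparison_test'[where N=0]) (use le in auto)
    hence "convergent (\<lambda>n. x n i - x 0 i)"
      by (simp only: summable_iff_convergent sum_lessThan_telescope[of "\<lambda>n. x n i"])
    from convergent_add[OF this convergent_const[of "x 0 i"]] show ?thesis by simp
  qed
  define c where "c i = lim (\<lambda>n. x n i)" for i
  have lim: "(\<lambda>n. x n i) \<longlonglongrightarrow> c i" if "i \<in> I" for i
    unfolding c_def using conv[OF that] by (simp add: convergent_LIMSEQ_iff)
  have "(\<lambda>n. n2 (\<lambda>i. x n i - c i)) \<longlonglongrightarrow> (\<Sum>i\<in>I. (c i - c i)\<^sup>2)"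
    unfolding n2_def by (intro tendsto_intros lim)
  hence n0: "(\<lambda>n. n2 (\<lambda>i. x n i - c i)) \<longlonglongrightarrow> 0" by simp
  have "(\<lambda>n. q * n2 (\<lambda>i. x n i - c i)) \<longlonglongrightarrow> 0" using tendsto_mult_left[OF n0, of q] by simp
  \<comment> \<open>By the contraction estimate against \<open>c\<close>, the shifted iterates also
    approach \<open>S c\<close>, so \<open>c\<close> is a fixed point on \<open>I\<close>. The
    values of \<open>c\<close> outside \<open>I\<close> are invisible to \<open>n2\<close>.\<close>
  hence n1: "(\<lambda>n. n2 (\<lambda>i. x (Suc n) i - S c i)) \<longlonglongrightarrow> 0"
    by (rule Lim_null_comparison[rotated])
      (use contr[of "x _" c] n2_nonneg in \<open>auto simp: x_Suc\<close>)
  have "T c i = F i" if "i \<in> I" for i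
  proof -
    have "(\<lambda>n. (x (Suc n) i - S c i)\<^sup>2) \<longlonglongrightarrow> 0"
    proof (rule Lim_null_comparison[OF always_eventually n1], intro allI)
      show "norm ((x (Suc n) i - S c i)\<^sup>2) \<le> n2 (\<lambda>i. x (Suc n) i - S c i)" for n
        using that I member_le_sum[of i I "\<lambda>i. (x (Suc n) i - S c i)\<^sup>2"] by (simp add: n2_def)
    qed
    moreover have "(\<lambda>n. (x (Suc n) i - S c i)\<^sup>2) \<longlonglongrightarrow> (c i - S c i)\<^sup>2"
      by (intro tendsto_intros LIMSEQ_Suc[OF lim[OF that]])
    ultimately have "(c i - S c i)\<^sup>2 = 0" by (rule LIMSEQ_unique[rotated])
    thus ?thesis using t by (simp add: S_def)
  qed
  thus ?thesis by blast
qed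

section \<open>Test functions\<close>

lemma partial_deriv_eq:
  assumes "(f has_derivative f') (at x)"
  shows "partial_deriv i f x = f' (axis i 1)"
  using frechet_derivative_at[OF assms] by (simp add: partial_deriv_def)

lemma C_k_Suc_imp: "C_k (Suc m) f \<Longrightarrow> C_k m f"
proof (induction m arbitrary: f)
  case 0
  thus ?case
    by (auto simp: continuous_on_eq_continuous_at intro: differentiable_imp_continuous_within)
next
  case (Suc m)
  from Suc.prems have d: "\<forall>x. f differentiable at x"
    and c: "\<And>i. C_k (Suc m) (partial_deriv i f)" by simp_all
  show ?case using d Suc.IH[OF c] by simp
qed

lemma C_k_add: "C_k m f \<Longrightarrow> C_k m g \<Longrightarrow> C_k m (\<lambda>x. f x + g x)"
proof (induction m arbitrary: f g)
  case 0
  thus ?case by (auto intro: continuous_on_add)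
next
  case (Suc m)
  have "partial_deriv i (\<lambda>x. f x + g x) = (\<lambda>x. partial_deriv i f x + partial_deriv i g x)" for i
  proof
    fix x
    have "(f has_derivative frechet_derivative f (at x)) (at x)"
      "(g has_derivative frechet_derivative g (at x)) (at x)"
      using Suc.prems by (auto simp: frechet_derivative_works[symmetric])
    from partial_deriv_eq[OF has_derivative_add[OF this]]
    show "partial_deriv i (\<lambda>x. f x + g x) x = partial_deriv i f x + partial_deriv i g x"
      by (simp add: partial_deriv_def)
  qed
  thus ?case using Suc by auto
qed

lemma partial_deriv_mult:
  assumes "f differentiable (at x)" "g differentiable (at x)"
  shows "partial_deriv i (\<lambda>x. f x * g x) x = f x * partial_deriv i g x + partial_deriv i f x * g x"
  using partial_deriv_eq[OF has_derivative_mult[OF assms[unfolded frechet_derivative_works]]]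
  by (simp add: partial_deriv_def)

lemma C_k_mult: "C_k m f \<Longrightarrow> C_k m g \<Longrightarrow> C_k m (\<lambda>x. f x * g x)"
proof (induction m arbitrary: f g)
  case 0
  thus ?case by (auto intro: continuous_on_mult)
next
  case (Suc m)
  have "partial_deriv i (\<lambda>x. f x * g x)
      = (\<lambda>x. f x * partial_deriv i g x + partial_deriv i f x * g x)" for i
    using Suc.prems by (auto intro!: ext partial_deriv_mult)
  moreover have "C_k m f" "C_k m g" using Suc.prems C_k_Suc_imp by blast+
  ultimately show ?case using Suc by (auto intro!: C_k_add)
qed

lemma C_k_const: "C_k m (\<lambda>_. c)"
proof (induction m arbitrary: c)
  case (Suc m)
  have "partial_deriv i (\<lambda>_. c) = (\<lambda>_. 0)" for i :: 'a
    by (auto intro!: ext partial_deriv_eq)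
  thus ?case using Suc by auto
qed auto

lemma C_k_prod:
  "finite I \<Longrightarrow> (\<And>i. i \<in> I \<Longrightarrow> C_k m (f i)) \<Longrightarrow> C_k m (\<lambda>x. \<Prod>i\<in>I. f i x)"
  by (induction I rule: finite_induct) (auto intro: C_k_const C_k_mult)

lemma C_k_component: "C_k m (\<lambda>x::real^'n. x $ j)"
proof (cases m)
  case 0
  thus ?thesis by (auto intro: continuous_intros)
next
  case (Suc m')
  have d: "((\<lambda>x::real^'n. x $ j) has_derivative (\<lambda>x. x $ j)) (at x)" for x
    by (rule bounded_linear_imp_has_derivative[OF bounded_linear_vec_nth])
  have "partial_deriv i (\<lambda>x. x $ j) = (\<lambda>_. axis i 1 $ j)" for i
    by (auto intro!: ext partial_deriv_eq d)
  thus ?thesis using d by (auto simp: Suc differentiable_def intro: C_k_const)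
qed

section \<open>Smooth cut-off functions built from exp (-1/t)\<close>

definition flat :: "real poly \<Rightarrow> real \<Rightarrow> real" where
  "flat p t = (if t > 0 then poly p (1 / t) * exp (- (1 / t)) else 0)"

lemma poly_times_exp_minus_tendsto_0: "((\<lambda>s. poly p s * exp (- s)) \<longlongrightarrow> 0) at_top" for p :: "real poly"
proof -
  have "((\<lambda>s. \<Sum>i\<le>degree p. coeff p i * (s ^ i / exp s)) \<longlongrightarrow> (\<Sum>i\<le>degree p. coeff p i * 0)) at_top"
    by (intro tendsto_intros tendsto_power_div_exp_0)
  thus ?thesis by (simp add: poly_altdef sum_distrib_right exp_minus divide_inverse mult.assoc)
qed

text \<open>Differentiating \<open>p (1/t) exp (-1/t)\<close> gives a function of the same form, so that smoothness
  follows by induction.\<close>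

lemma flat_has_real_derivative:
  "(flat p has_real_derivative flat ([:0, 0, 1:] * (p - pderiv p)) t) (at t)"
proof -
  consider "t > 0" | "t < 0" | "t = 0" by linarith
  thus ?thesis
  proof cases
    case 1
    have "((\<lambda>t. poly p (1 / t) * exp (- (1 / t))) has_real_derivative
        flat ([:0, 0, 1:] * (p - pderiv p)) t) (at t)"
      using 1 by (auto intro!: derivative_eq_intros DERIV_chain'[OF _ poly_DERIV]
          simp: flat_def field_simps power2_eq_square)
    moreover have "eventually (\<lambda>s. flat p s = poly p (1 / s) * exp (- (1 / s))) (nhds t)"
      using eventually_nhds_in_open[of "{0<..}" t] 1 by (auto elim!: eventually_mono simp: flat_def)
    ultimately show ?thesis by (subst DERIV_cong_ev[OF refl _ refl]) auto
  next
    case 2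
    have "eventually (\<lambda>s. flat p s = 0) (nhds t)"
      using eventually_nhds_in_open[of "{..<0}" t] 2 by (auto elim!: eventually_mono simp: flat_def)
    thus ?thesis using 2 by (subst DERIV_cong_ev[OF refl _ refl, of _ "\<lambda>_. 0"]) (auto simp: flat_def)
  next
    case 3
    \<comment> \<open>The difference quotient at 0 carries an extra factor 1/s, which
      \<open>[:0, 1:]\<close> absorbs into the polynomial; what remains is decay at infinity in the
      variable 1/s.\<close>
    have "((\<lambda>s. poly ([:0, 1:] * p) (inverse s) * exp (- inverse s)) \<longlongrightarrow> 0) (at_right 0)"
      by (rule filterlim_compose[OF poly_times_exp_minus_tendsto_0 filterlim_inverse_at_top_right])
    moreover have "eventually (\<lambda>s. poly ([:0, 1:] * p) (inverse s) * exp (- inverse s)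
        = (flat p s - flat p 0) / (s - 0)) (at_right 0)"
      by (auto simp: eventually_at_filter flat_def divide_inverse)
    ultimately have "((\<lambda>s. (flat p s - flat p 0) / (s - 0)) \<longlongrightarrow> 0) (at_right 0)"
      by (rule Lim_transform_eventually)
    moreover have "((\<lambda>s. (flat p s - flat p 0) / (s - 0)) \<longlongrightarrow> 0) (at_left 0)"
      by (rule tendsto_eventually) (auto simp: eventually_at_filter flat_def)
    ultimately have "((\<lambda>s. (flat p s - flat p 0) / (s - 0)) \<longlongrightarrow> 0) (at 0)"
      by (simp add: filterlim_split_at)
    thus ?thesis using 3 by (simp add: has_field_derivative_iff flat_def)
  qed
qed

text \<open>The affine argument provides cut-offs at both ends of an interval and with any
  steepness. The induction keeps \<open>p\<close> arbitrary because differentiation changes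
  it.\<close>

lemma C_k_flat: "C_k m (\<lambda>x::real^'n. flat p (c * x $ j + d))"
proof (induction m arbitrary: p)
  case 0
  have "continuous_on UNIV (flat p)"
    using flat_has_real_derivative by (auto simp: continuous_on_eq_continuous_at intro: DERIV_isCont)
  moreover have "continuous_on UNIV (\<lambda>x::real^'n. c * x $ j + d)"
    by (intro continuous_intros)
  ultimately show ?case using continuous_on_compose2[of UNIV "flat p"] by auto
next
  case (Suc m)
  let ?q = "[:0, 0, 1:] * (p - pderiv p)"
  have d: "((\<lambda>x::real^'n. flat p (c * x $ j + d)) has_derivative
      (\<lambda>h. flat ?q (c * x $ j + d) * (c * h $ j))) (at x)" for x
  proof -
    have "((\<lambda>x::real^'n. c * x $ j + d) has_derivative (\<lambda>h. c * h $ j)) (at x)"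
      by (auto intro!: derivative_eq_intros bounded_linear_imp_has_derivative bounded_linear_vec_nth)
    from has_derivative_compose[OF this flat_has_real_derivative[unfolded has_field_derivative_def]]
    show ?thesis .
  qed
  have "partial_deriv i (\<lambda>x. flat p (c * x $ j + d))
      = (\<lambda>x. flat ?q (c * x $ j + d) * (c * axis i 1 $ j))" for i
    by (intro ext partial_deriv_eq d)
  thus ?case using Suc[of ?q] d
    by (auto simp only: C_k.simps differentiable_def intro!: C_k_mult C_k_const)
qed

text \<open>The smooth factor may have unbounded support; this admits the products of a coordinate
  function with a test function in \<open>H10_zero_gradient\<close>.\<close>

lemma test_functions_mult:
  assumes "\<psi> \<in> test_functions \<Omega>" "\<And>m. C_k m g"
  shows "(\<lambda>x. g x * \<psi> x) \<in> test_functions \<Omega>"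
proof -
  have "closure {x. g x * \<psi> x \<noteq> 0} \<subseteq> closure {x. \<psi> x \<noteq> 0}" by (rule closure_mono) auto
  moreover from this have "compact (closure {x. g x * \<psi> x \<noteq> 0})"
    using assms(1) compact_Int_closed[of "closure {x. \<psi> x \<noteq> 0}" "closure {x. g x * \<psi> x \<noteq> 0}"]
    by (auto simp: test_functions_def Int_absorb1)
  ultimately show ?thesis using assms by (auto simp: test_functions_def intro: C_k_mult)
qed

lemma test_functions_add:
  assumes "\<psi> \<in> test_functions \<Omega>" "\<eta> \<in> test_functions \<Omega>"
  shows "(\<lambda>x. \<psi> x + \<eta> x) \<in> test_functions \<Omega>"
proof -
  let ?S = "closure {x. \<psi> x \<noteq> 0} \<union> closure {x. \<eta> x \<noteq> 0}"
  have "closure {x. \<psi> x + \<eta> x \<noteq> 0} \<subseteq> closure ({x. \<psi> x \<noteq> 0} \<union> {x. \<eta> x \<noteq> 0})"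
    by (rule closure_mono) auto
  hence sub: "closure {x. \<psi> x + \<eta> x \<noteq> 0} \<subseteq> ?S" by simp
  moreover have "compact ?S" using assms by (auto simp: test_functions_def)
  hence "compact (closure {x. \<psi> x + \<eta> x \<noteq> 0})"
    using compact_Int_closed[of ?S "closure {x. \<psi> x + \<eta> x \<noteq> 0}"] sub
    by (simp add: Int_absorb1)
  ultimately show ?thesis using assms by (auto simp: test_functions_def intro: C_k_add)
qed

text \<open>Off its closed support the function vanishes in a neighbourhood, so differentiation does
  not enlarge the support.\<close>

lemma test_functions_partial_deriv:
  assumes "\<psi> \<in> test_functions \<Omega>"
  shows "partial_deriv i \<psi> \<in> test_functions \<Omega>"
proof -
  have "partial_deriv i \<psi> x = 0" if "x \<notin> closure {x. \<psi> x \<noteq> 0}" for x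
  proof -
    have "(\<psi> has_derivative (\<lambda>_. 0)) (at x)"
      by (rule has_derivative_transform_within_open[of "\<lambda>_. 0" _ x UNIV "- closure {x. \<psi> x \<noteq> 0}"])
        (use that closure_subset[of "{x. \<psi> x \<noteq> 0}"] in auto)
    from partial_deriv_eq[OF this] show ?thesis .
  qed
  hence "{x. partial_deriv i \<psi> x \<noteq> 0} \<subseteq> closure {x. \<psi> x \<noteq> 0}" by blast
  hence sub: "closure {x. partial_deriv i \<psi> x \<noteq> 0} \<subseteq> closure {x. \<psi> x \<noteq> 0}"
    by (rule closure_minimal) auto
  moreover from this have "compact (closure {x. partial_deriv i \<psi> x \<noteq> 0})"
    using assms compact_Int_closed[of "closure {x. \<psi> x \<noteq> 0}" "closure {x. partial_deriv i \<psi> x \<noteq> 0}"]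
    by (auto simp: test_functions_def Int_absorb1)
  moreover have "C_k m (partial_deriv i \<psi>)" for m
    using assms by (auto simp: test_functions_def dest: spec[of _ "Suc m"])
  ultimately show ?thesis using assms by (auto simp: test_functions_def)
qed

lemma test_functions_continuous: "\<psi> \<in> test_functions \<Omega> \<Longrightarrow> continuous_on UNIV \<psi>"
  by (auto simp: test_functions_def dest: spec[of _ 0])

lemma test_functions_differentiable: "\<psi> \<in> test_functions \<Omega> \<Longrightarrow> \<psi> differentiable at x"
  by (auto simp: test_functions_def dest: spec[of _ "Suc 0"])

lemma test_functions_zero_outside: "\<psi> \<in> test_functions \<Omega> \<Longrightarrow> x \<notin> \<Omega> \<Longrightarrow> \<psi> x = 0"
  using closure_subset[of "{x. \<psi> x \<noteq> 0}"] by (auto simp: test_functions_def)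

section \<open>Supports, bounds and integrals of test functions\<close>

lemma test_functions_support:
  assumes "\<psi> \<in> test_functions \<Omega>"
  obtains R where "R > 0" "\<And>x. \<psi> x \<noteq> 0 \<Longrightarrow> norm x \<le> R"
proof -
  have "bounded (closure {x. \<psi> x \<noteq> 0})" using assms by (auto simp: test_functions_def compact_imp_bounded)
  then obtain R where "R > 0" "\<forall>x\<in>closure {x. \<psi> x \<noteq> 0}. norm x \<le> R" using bounded_pos by blast
  thus ?thesis using that closure_subset[of "{x. \<psi> x \<noteq> 0}"] by blast
qed

lemma test_functions_bounded:
  assumes "\<psi> \<in> test_functions \<Omega>"
  obtains B where "B > 0" "\<And>x. \<bar>\<psi> x\<bar> \<le> B"
proof -
  have "compact (closure {x. \<psi> x \<noteq> 0})" using assms by (simp add: test_functions_def)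
  hence "compact (\<psi> ` closure {x. \<psi> x \<noteq> 0})"
    using test_functions_continuous[OF assms]
    by (intro compact_continuous_image) (auto intro: continuous_on_subset)
  then obtain B where "B > 0" "\<forall>x\<in>closure {x. \<psi> x \<noteq> 0}. \<bar>\<psi> x\<bar> \<le> B"
    using bounded_pos[of "\<psi> ` closure {x. \<psi> x \<noteq> 0}"] compact_imp_bounded by auto
  hence "\<bar>\<psi> x\<bar> \<le> B" for x
    using closure_subset[of "{x. \<psi> x \<noteq> 0}"] by (cases "\<psi> x = 0") auto
  thus ?thesis using that \<open>B > 0\<close> by blast
qed

lemma integrable_test_function:
  assumes "\<psi> \<in> test_functions \<Omega>"
  shows "integrable lborel \<psi>"
proof -
  obtain R where R: "R > 0" "\<And>x. \<psi> x \<noteq> 0 \<Longrightarrow> norm x \<le> R" using test_functions_support[OF assms] by metis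
  have "integrable lborel (\<lambda>x. indicator (cball 0 R) x *\<^sub>R \<psi> x)"
    by (rule borel_integrable_compact)
      (auto intro: continuous_on_subset[OF test_functions_continuous[OF assms]])
  moreover have "(\<lambda>x. indicator (cball 0 R) x *\<^sub>R \<psi> x) = \<psi>"
    using R by (intro ext) (auto simp: indicator_def)
  ultimately show ?thesis by simp
qed

text \<open>The integral of a difference quotient vanishes by translation invariance.\<close>

lemma integral_partial_deriv_eq_0:
  fixes \<psi> :: "real^'n \<Rightarrow> real"
  assumes "\<psi> \<in> test_functions \<Omega>"
  shows "(LINT x|lborel. partial_deriv i \<psi> x) = 0"
proof -
  define e :: "real^'n" where "e = axis i 1"
  define D where "D = partial_deriv i \<psi>"
  define q where "q n x = (\<psi> (inverse (real (Suc n)) *\<^sub>R e + x) - \<psi> x) / inverse (real (Suc n))" for n x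
  have e: "norm e = 1" by (simp add: e_def)
  have D: "D \<in> test_functions \<Omega>" unfolding D_def by (rule test_functions_partial_deriv[OF assms])
  \<comment> \<open>This derivative along lines in direction \<open>e\<close> gives both the limit
    of the difference quotients and, by the mean value theorem, their uniform bound.\<close>
  have der: "((\<lambda>s. \<psi> (s *\<^sub>R e + x)) has_real_derivative D (s *\<^sub>R e + x)) (at s)" for x s
  proof -
    let ?F = "frechet_derivative \<psi> (at (s *\<^sub>R e + x))"
    have F: "(\<psi> has_derivative ?F) (at (s *\<^sub>R e + x))"
      using test_functions_differentiable[OF assms] by (simp add: frechet_derivative_works)
    have "((\<lambda>s. \<psi> (s *\<^sub>R e + x)) has_derivative (\<lambda>h. ?F (h *\<^sub>R e))) (at s)"
      by (rule has_derivative_compose[where f="\<lambda>s. s *\<^sub>R e + x" and g=\<psi>, OF _ F]) (auto intro!: derivative_eq_intros)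
    moreover have "?F (h *\<^sub>R e) = D (s *\<^sub>R e + x) * h" for h
      using linear_scale[OF has_derivative_linear[OF F]] by (simp add: D_def partial_deriv_def e_def)
    ultimately show ?thesis by (simp add: has_field_derivative_def)
  qed
  obtain R where R: "R > 0" "\<And>x. \<psi> x \<noteq> 0 \<Longrightarrow> norm x \<le> R" using test_functions_support[OF assms] by metis
  obtain B where B: "B > 0" "\<And>x. \<bar>D x\<bar> \<le> B" using test_functions_bounded[OF D] by metis
  have m\<psi>: "\<psi> \<in> borel_measurable borel" "D \<in> borel_measurable borel"
    using test_functions_continuous assms D by (auto intro: borel_measurable_continuous_onI)
  have trans: "integrable lborel (\<lambda>x. \<psi> (c + x)) \<and> (LINT x|lborel. \<psi> (c + x)) = (LINT x|lborel. \<psi> x)" for c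
  proof -
    have "integrable (distr lborel borel ((+) c)) \<psi>"
      using integrable_test_function[OF assms] by (simp only: lborel_distr_plus)
    moreover have "(LINT x|distr lborel borel ((+) c). \<psi> x) = (LINT x|lborel. \<psi> x)"
      by (simp only: lborel_distr_plus)
    ultimately show ?thesis using m\<psi> by (simp add: integrable_distr_eq integral_distr)
  qed
  have q0: "(LINT x|lborel. q n x) = 0" for n
    unfolding q_def using trans integrable_test_function[OF assms]
    by (simp add: Bochner_Integration.integral_diff)
  \<comment> \<open>The step lengths are at most 1 and \<open>e\<close> is a unit vector, so all
    difference quotients vanish outside the ball of radius \<open>R + 1\<close>.\<close>
  have "(\<lambda>n. LINT x|lborel. q n x) \<longlonglongrightarrow> (LINT x|lborel. D x)"
  proof (rule integral_dominated_convergence[where w="\<lambda>x. B * indicator (cball (0::real^'n) (R + 1)) x"])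
    show "D \<in> borel_measurable lborel" "q n \<in> borel_measurable lborel" for n
      unfolding q_def using m\<psi> by auto
    show "integrable lborel (\<lambda>x. B * indicator (cball (0::real^'n) (R + 1)) x)"
      by (intro integrable_mult_right integrable_real_indicator)
        (use emeasure_lborel_cball_finite[of "0::real^'n" "R + 1"] in \<open>auto simp: less_top\<close>)
    show "AE x in lborel. (\<lambda>n. q n x) \<longlonglongrightarrow> D x"
    proof (rule AE_I2)
      fix x
      have "((\<lambda>h. (\<psi> (h *\<^sub>R e + x) - \<psi> x) / h) \<longlongrightarrow> D x) (at 0)"
        using der[of x 0] by (simp add: has_field_derivative_iff)
      moreover have "filterlim (\<lambda>n. inverse (real (Suc n))) (at 0) sequentially"
        using LIMSEQ_inverse_real_of_nat by (auto simp: filterlim_at)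
      ultimately show "(\<lambda>n. q n x) \<longlonglongrightarrow> D x"
        unfolding q_def by (rule filterlim_compose)
    qed
    show "AE x in lborel. norm (q n x) \<le> B * indicator (cball 0 (R + 1)) x" for n
    proof (rule AE_I2)
      fix x
      define h where "h = inverse (real (Suc n))"
      have h: "0 < h" "h \<le> 1" by (auto simp: h_def field_simps)
      have qh: "q n x = (\<psi> (h *\<^sub>R e + x) - \<psi> x) / h" by (simp only: q_def h_def)
      show "norm (q n x) \<le> B * indicator (cball 0 (R + 1)) x"
      proof (cases "norm x \<le> R + 1")
        case True
        obtain z where z: "\<psi> (h *\<^sub>R e + x) - \<psi> (0 *\<^sub>R e + x) = (h - 0) * D (z *\<^sub>R e + x)"
          using MVT2[of 0 h "\<lambda>s. \<psi> (s *\<^sub>R e + x)" "\<lambda>s. D (s *\<^sub>R e + x)"] der h by blast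
        hence "q n x = D (z *\<^sub>R e + x)" using h by (simp add: qh)
        thus ?thesis using B True by (auto simp: indicator_def)
      next
        case False
        have "norm x \<le> norm (h *\<^sub>R e + x) + norm (h *\<^sub>R e)"
          using norm_triangle_ineq4[of "h *\<^sub>R e + x" "h *\<^sub>R e"] by simp
        hence "norm (h *\<^sub>R e + x) > R" using False h e by simp
        hence "\<psi> (h *\<^sub>R e + x) = 0" "\<psi> x = 0" using R(2) False by force+
        thus ?thesis using B by (simp add: qh)
      qed
    qed
  qed
  thus ?thesis unfolding q0 D_def using LIMSEQ_unique tendsto_const by blast
qed

section \<open>The fundamental lemma of the calculus of variations\<close>

lemma integral_lebesgue_on_eq:
  fixes F :: "real^'n \<Rightarrow> real"
  assumes "open \<Omega>" "F \<in> borel_measurable borel" "\<And>x. x \<notin> \<Omega> \<Longrightarrow> F x = 0"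
  shows "(LINT x|lebesgue_on \<Omega>. F x) = (LINT x|lborel. F x)"
proof -
  have "(LINT x|lebesgue_on \<Omega>. F x) = (LINT x|lebesgue. indicator \<Omega> x *\<^sub>R F x)"
    using assms(1) by (subst integral_restrict_space) (auto intro: borel_open)
  also have "(\<lambda>x. indicator \<Omega> x *\<^sub>R F x) = F" using assms(3) by (intro ext) (auto simp: indicator_def)
  finally show ?thesis using assms(2) by (simp add: integral_completion)
qed

text \<open>Smooth approximations of the indicator of the open box: exp (-1/(n s)) tends to 1 for
  every s > 0, while the support stays in the closed box for all \<open>n\<close>.\<close>

definition box_bump :: "real^'n \<Rightarrow> real^'n \<Rightarrow> nat \<Rightarrow> real^'n \<Rightarrow> real" where
  "box_bump a b n x = (\<Prod>i\<in>UNIV. flat 1 (real (Suc n) * (x $ i - a $ i)) * flat 1 (real (Suc n) * (b $ i - x $ i)))"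

lemma flat_1_bounds: "0 \<le> flat 1 t" "flat 1 t \<le> 1" "flat 1 t \<noteq> 0 \<longleftrightarrow> t > 0"
  by (auto simp: flat_def)

lemma box_bump_bounds: "0 \<le> box_bump a b n x" "box_bump a b n x \<le> 1"
  unfolding box_bump_def by (auto intro!: prod_nonneg prod_le_1 mult_le_one flat_1_bounds mult_nonneg_nonneg)

lemma box_bump_test_function:
  assumes "cbox a b \<subseteq> \<Omega>"
  shows "box_bump a b n \<in> test_functions \<Omega>"
proof -
  have "C_k m (box_bump a b n)" for m
  proof -
    have "C_k m (\<lambda>x. flat 1 (real (Suc n) * (x $ i - a $ i)))"
      "C_k m (\<lambda>x. flat 1 (real (Suc n) * (b $ i - x $ i)))" for i
      using C_k_flat[of m 1 "real (Suc n)" i "- real (Suc n) * a $ i"]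
        C_k_flat[of m 1 "- real (Suc n)" i "real (Suc n) * b $ i"]
      by (simp_all add: algebra_simps)
    thus ?thesis unfolding box_bump_def[abs_def] by (intro C_k_prod C_k_mult) auto
  qed
  moreover have "{x. box_bump a b n x \<noteq> 0} \<subseteq> cbox a b"
    by (auto simp: box_bump_def mem_box_cart flat_1_bounds(3) zero_less_mult_iff less_eq_real_def)
  hence sub: "closure {x. box_bump a b n x \<noteq> 0} \<subseteq> cbox a b" by (rule closure_minimal) auto
  moreover from this have "compact (closure {x. box_bump a b n x \<noteq> 0})"
    using compact_Int_closed[of "cbox a b" "closure {x. box_bump a b n x \<noteq> 0}"]
    by (auto simp: Int_absorb1)
  ultimately show ?thesis using assms by (auto simp: test_functions_def)
qed

lemma box_bump_tendsto: "(\<lambda>n. box_bump a b n x) \<longlonglongrightarrow> indicator (box a b) x"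
proof -
  have l: "(\<lambda>n. flat 1 (real (Suc n) * s)) \<longlonglongrightarrow> (if s > 0 then 1 else 0)" for s :: real
  proof (cases "s > 0")
    case True
    have "(\<lambda>n. exp (- (inverse (real (Suc n)) * inverse s))) \<longlonglongrightarrow> exp (- (0 * inverse s))"
      by (intro tendsto_intros LIMSEQ_inverse_real_of_nat)
    moreover have "flat 1 (real (Suc n) * s) = exp (- (inverse (real (Suc n)) * inverse s))" for n
      using True zero_less_mult_iff[of "real (Suc n)" s] by (simp add: flat_def divide_inverse)
    ultimately show ?thesis using True by simp
  next
    case False
    thus ?thesis by (auto simp: flat_def zero_less_mult_iff)
  qed
  have "(\<lambda>n. box_bump a b n x) \<longlonglongrightarrow>
      (\<Prod>i\<in>UNIV. (if x $ i - a $ i > 0 then 1 else 0) * (if b $ i - x $ i > 0 then 1 else 0))"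
    unfolding box_bump_def by (intro tendsto_intros l)
  also have "(\<Prod>i\<in>UNIV. (if x $ i - a $ i > 0 then 1 else 0) * (if b $ i - x $ i > 0 then 1 else 0))
      = (indicator (box a b) x :: real)"
    by (auto simp: indicator_def mem_box_cart)
  finally show ?thesis .
qed

text \<open>Passing to the limit in bumps shows that the integral over every closed box inside the
  domain is zero; Lebesgue differentiation over shrinking cubes then recovers the function almost
  everywhere.\<close>

lemma fundamental_lemma_calculus_of_variations:
  fixes g :: "real^'n \<Rightarrow> real"
  assumes \<Omega>: "open \<Omega>" and g: "integrable (lebesgue_on \<Omega>) g"
    and 0: "\<And>\<psi>. \<psi> \<in> test_functions \<Omega> \<Longrightarrow> (LINT x|lebesgue_on \<Omega>. g x * \<psi> x) = 0"
  shows "AE x in lebesgue_on \<Omega>. g x = 0"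
proof -
  \<comment> \<open>The extension by zero makes the differentiation theorem on the whole space
    applicable.\<close>
  define f where "f x = indicator \<Omega> x *\<^sub>R g x" for x
  have \<Omega>m: "\<Omega> \<in> sets lebesgue" using \<Omega> by (auto intro: borel_open)
  have f: "integrable lebesgue f"
    using g \<Omega>m by (simp add: integrable_restrict_space f_def[abs_def])
  have fint: "f integrable_on cbox a b" for a b
    using f integrable_on_lebesgue integrable_on_subcbox by blast
  have box0: "integral (cbox a b) f = 0" if "cbox a b \<subseteq> \<Omega>" for a b
  proof -
    have "(\<lambda>n. LINT x|lebesgue. f x * box_bump a b n x) \<longlonglongrightarrow> (LINT x|lebesgue. f x * indicator (box a b) x)"
    proof (rule integral_dominated_convergence[where w="\<lambda>x. norm (f x)"])
      show "(\<lambda>x. f x * indicator (box a b) x) \<in> borel_measurable lebesgue"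
        using f by (intro borel_measurable_times borel_measurable_indicator) auto
      show "(\<lambda>x. f x * box_bump a b n x) \<in> borel_measurable lebesgue" for n
      proof -
        have "box_bump a b n \<in> borel_measurable borel"
          by (rule borel_measurable_continuous_onI[OF test_functions_continuous[OF box_bump_test_function[OF that]]])
        hence "box_bump a b n \<in> borel_measurable lebesgue"
          by (simp add: measurable_completion)
        thus ?thesis using f by (auto intro!: borel_measurable_times)
      qed
      show "AE x in lebesgue. (\<lambda>n. f x * box_bump a b n x) \<longlonglongrightarrow> f x * indicator (box a b) x"
        by (intro AE_I2 tendsto_intros box_bump_tendsto)
      show "AE x in lebesgue. norm (f x * box_bump a b n x) \<le> norm (f x)" for n
        using box_bump_bounds[of a b n] by (intro AE_I2) (simp add: abs_mult mult_left_le)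
    qed (use f in auto)
    moreover have "(LINT x|lebesgue. f x * box_bump a b n x) = 0" for n
    proof -
      have "(LINT x|lebesgue. f x * box_bump a b n x) = (LINT x|lebesgue_on \<Omega>. g x * box_bump a b n x)"
        using \<Omega>m by (subst integral_restrict_space) (auto simp: f_def mult.assoc)
      thus ?thesis using 0[OF box_bump_test_function[OF that]] by simp
    qed
    ultimately have "(LINT x|lebesgue. f x * indicator (box a b) x) = 0"
      using LIMSEQ_unique[OF _ tendsto_const] by auto
    moreover have "set_integrable lebesgue (box a b) f"
      unfolding set_integrable_def by (rule integrable_mult_indicator[OF _ f]) auto
    hence "(LINT x:box a b|lebesgue. f x) = integral (box a b) f"
      by (rule set_lebesgue_integral_eq_integral)
    ultimately show ?thesis
      by (simp add: set_lebesgue_integral_def integral_open_interval mult.commute)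
  qed
  obtain N where N: "negligible N"
    "\<And>x e. x \<notin> N \<Longrightarrow> 0 < e \<Longrightarrow>
      \<exists>d>0. \<forall>h. 0 < h \<and> h < d \<longrightarrow> norm (integral (cbox x (x + h *\<^sub>R One)) f /\<^sub>R h ^ DIM(real^'n) - f x) < e"
    using integrable_ccontinuous_explicit[OF fint] by metis
  have "f x = 0" if "x \<in> \<Omega>" "x \<notin> N" for x
  proof -
    have "norm (f x) \<le> 0 + e" if e: "e > 0" for e
    proof -
      obtain d where d: "d > 0" "\<And>h. 0 < h \<Longrightarrow> h < d \<Longrightarrow>
          norm (integral (cbox x (x + h *\<^sub>R One)) f /\<^sub>R h ^ DIM(real^'n) - f x) < e"
        using N(2)[OF \<open>x \<notin> N\<close> e] by blast
      obtain r where r: "r > 0" "cball x r \<subseteq> \<Omega>"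
        using \<Omega> \<open>x \<in> \<Omega>\<close> open_contains_cball by blast
      \<comment> \<open>A cube with corner \<open>x\<close> and side \<open>h\<close> lies within
        distance \<open>h * norm One\<close> of \<open>x\<close>; the added 1 makes positivity
        immediate.\<close>
      define M where "M = norm (One :: real^'n) + 1"
      have M: "M > 0" by (simp add: M_def add_nonneg_pos)
      define h where "h = min (d / 2) (r / M)"
      have h: "0 < h" "h < d" "h * M \<le> r"
        using d(1) r(1) M by (auto simp: h_def min_def field_simps)
      have "cbox x (x + h *\<^sub>R One) \<subseteq> cball x r"
      proof
        fix y assume y: "y \<in> cbox x (x + h *\<^sub>R One)"
        have "norm (y - x) \<le> norm (h *\<^sub>R (One :: real^'n))"
          using y h by (intro norm_le_componentwise) (auto simp: mem_box inner_diff_left inner_add_left algebra_simps)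
        also have "\<dots> \<le> h * M" using h by (simp add: M_def)
        finally show "y \<in> cball x r" using h by (simp add: dist_norm norm_minus_commute)
      qed
      with r have "integral (cbox x (x + h *\<^sub>R One)) f = 0" by (intro box0) auto
      thus ?thesis using d(2)[OF h(1,2)] by simp
    qed
    hence "norm (f x) \<le> 0" by (rule field_le_epsilon)
    thus ?thesis by simp
  qed
  moreover have "AE x in lebesgue. x \<notin> N"
    using N(1) by (auto simp: negligible_iff_null_sets intro: AE_not_in)
  ultimately have "AE x in lebesgue. x \<in> \<Omega> \<longrightarrow> g x = 0"
    by (auto elim!: eventually_mono simp: f_def)
  thus ?thesis using \<Omega>m by (simp add: AE_restrict_space_iff)
qed

section \<open>Sobolev spaces and the bilinear form\<close>

lemma borel_measurable_component:
  fixes f :: "'a \<Rightarrow> 'b::euclidean_space ^ 'n"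
  assumes "f \<in> borel_measurable M"
  shows "(\<lambda>x. f x $ i) \<in> borel_measurable M"
  using measurable_compose[OF assms borel_measurable_continuous_onI[of "\<lambda>x. x $ i"]]
  by (simp add: continuous_on_component continuous_on_id)

text \<open>On matrices \<open>norm\<close> is the Frobenius norm, so Cauchy-Schwarz in each row is
  enough.\<close>

lemma norm_matrix_vector_mult_le: "norm (A *v x) \<le> norm A * norm x" for A :: "real^'n^'m"
proof -
  have "norm (A *v x) = L2_set (\<lambda>i. norm ((A *v x) $ i)) UNIV" by (rule norm_vec_def)
  also have "\<dots> \<le> L2_set (\<lambda>i. norm (A $ i) * norm x) UNIV"
    by (intro L2_set_mono) (auto simp: matrix_vector_mul_component Cauchy_Schwarz_ineq2)
  also have "\<dots> = norm A * norm x"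
    by (simp add: L2_set_left_distrib norm_vec_def[of A])
  finally show ?thesis .
qed

text \<open>A bound without mixed terms: it can be integrated term by term and stands in for
  Minkowski's inequality.\<close>

lemma norm_lincomb_power2_le:
  "(norm (a *\<^sub>R x + b *\<^sub>R y))\<^sup>2 \<le> 2 * a\<^sup>2 * (norm x)\<^sup>2 + 2 * b\<^sup>2 * (norm y)\<^sup>2"
  for x y :: "'b::real_normed_vector"
proof -
  have "(norm (a *\<^sub>R x + b *\<^sub>R y))\<^sup>2 \<le> (norm (a *\<^sub>R x) + norm (b *\<^sub>R y))\<^sup>2"
    by (intro power_mono norm_triangle_ineq) auto
  also have "\<dots> \<le> 2 * (norm (a *\<^sub>R x))\<^sup>2 + 2 * (norm (b *\<^sub>R y))\<^sup>2"
    using sum_squares_bound[of "norm (a *\<^sub>R x)" "norm (b *\<^sub>R y)"]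
    by (simp add: power2_sum)
  finally show ?thesis by (simp add: power_mult_distrib)
qed

section \<open>Square-integrable functions on a bounded open set\<close>

locale bounded_open =
  fixes \<Omega> :: "(real^'n) set"
  assumes open_domain: "open \<Omega>" and bounded_domain: "bounded \<Omega>"
begin

lemma domain_lmeasurable: "\<Omega> \<in> lmeasurable"
  using open_domain bounded_domain by (rule lmeasurable_open[rotated])

lemma domain_sets: "\<Omega> \<in> sets lebesgue"
  using domain_lmeasurable by (rule fmeasurableD)

lemma finite_measure_domain: "finite_measure (lebesgue_on \<Omega>)"
  using domain_lmeasurable by (rule finite_measure_lebesgue_on)

lemma continuous_imp_measurable_on_domain:
  "continuous_on UNIV f \<Longrightarrow> f \<in> borel_measurable (lebesgue_on \<Omega>)"
  using domain_sets
  by (intro continuous_imp_measurable_on_sets_lebesgue) (auto intro: continuous_on_subset)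

lemma in_L2_bounded:
  fixes f :: "real^'n \<Rightarrow> 'b::euclidean_space"
  assumes "f \<in> borel_measurable (lebesgue_on \<Omega>)" "\<And>x. x \<in> \<Omega> \<Longrightarrow> norm (f x) \<le> B"
  shows "in_L2 \<Omega> f"
proof -
  interpret finite_measure "lebesgue_on \<Omega>" by (rule finite_measure_domain)
  have "integrable (lebesgue_on \<Omega>) (\<lambda>x. (norm (f x))\<^sup>2)"
  proof (rule integrable_const_bound[where B="B\<^sup>2"])
    show "AE x in lebesgue_on \<Omega>. norm ((norm (f x))\<^sup>2) \<le> B\<^sup>2"
      using assms(2) by (intro AE_I2) (auto intro: power_mono)
  qed (use assms(1) in auto)
  thus ?thesis using assms(1) by (simp add: in_L2_def)
qed

lemma in_L2_comparison:
  fixes f :: "real^'n \<Rightarrow> 'b::euclidean_space" and F :: "real^'n \<Rightarrow> real"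
  assumes f: "f \<in> borel_measurable (lebesgue_on \<Omega>)" and F: "integrable (lebesgue_on \<Omega>) F"
    and le: "\<And>x. (norm (f x))\<^sup>2 \<le> F x"
  shows "in_L2 \<Omega> f"
proof -
  have "integrable (lebesgue_on \<Omega>) (\<lambda>x. (norm (f x))\<^sup>2)"
  proof (rule Bochner_Integration.integrable_bound[OF F])
    show "(\<lambda>x. (norm (f x))\<^sup>2) \<in> borel_measurable (lebesgue_on \<Omega>)"
      using f by measurable
    show "AE x in lebesgue_on \<Omega>. norm ((norm (f x))\<^sup>2) \<le> norm (F x)"
      proof (rule AE_I2)
      show "norm ((norm (f x))\<^sup>2) \<le> norm (F x)" for x
        using order_trans[OF le[of x] abs_ge_self] by simp
    qed
  qed
  thus ?thesis using f by (simp add: in_L2_def)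
qed

lemma in_L2_lincomb:
  fixes f g :: "real^'n \<Rightarrow> 'b::euclidean_space"
  assumes "in_L2 \<Omega> f" "in_L2 \<Omega> g"
  shows "in_L2 \<Omega> (\<lambda>x. a *\<^sub>R f x + b *\<^sub>R g x)"
proof (rule in_L2_comparison[OF _ _ norm_lincomb_power2_le])
  show "(\<lambda>x. a *\<^sub>R f x + b *\<^sub>R g x) \<in> borel_measurable (lebesgue_on \<Omega>)"
    using assms by (auto simp: in_L2_def)
  show "integrable (lebesgue_on \<Omega>) (\<lambda>x. 2 * a\<^sup>2 * (norm (f x))\<^sup>2 + 2 * b\<^sup>2 * (norm (g x))\<^sup>2)"
    using assms by (auto simp: in_L2_def)
qed

lemma in_L2_component:
  fixes g :: "real^'n \<Rightarrow> real^'m"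
  assumes "in_L2 \<Omega> g"
  shows "in_L2 \<Omega> (\<lambda>x. g x $ i)"
proof (rule in_L2_comparison)
  show "(\<lambda>x. g x $ i) \<in> borel_measurable (lebesgue_on \<Omega>)"
    using assms by (auto simp: in_L2_def intro: borel_measurable_component)
  show "integrable (lebesgue_on \<Omega>) (\<lambda>x. (norm (g x))\<^sup>2)"
    using assms by (simp add: in_L2_def)
  show "(norm (g x $ i))\<^sup>2 \<le> (norm (g x))\<^sup>2" for x
    using component_le_norm_cart[of "g x" i] by (intro power_mono) auto
qed

text \<open>Young's inequality dominates the product by a sum of squares. Both the diffusion and the
  reaction term of \<open>a_form\<close> are instances; the absolute value of \<open>C\<close> is
  taken because \<open>in_Linf\<close> gives no sign for its bound.\<close>

lemma in_L2_integrable_bilinear: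
  fixes f :: "real^'n \<Rightarrow> 'b::euclidean_space" and g :: "real^'n \<Rightarrow> 'c::euclidean_space"
    and h :: "real^'n \<Rightarrow> real"
  assumes "in_L2 \<Omega> f" "in_L2 \<Omega> g" "h \<in> borel_measurable (lebesgue_on \<Omega>)"
    "AE x in lebesgue_on \<Omega>. \<bar>h x\<bar> \<le> C * (norm (f x) * norm (g x))"
  shows "integrable (lebesgue_on \<Omega>) h"
proof (rule Bochner_Integration.integrable_bound)
  show "integrable (lebesgue_on \<Omega>) (\<lambda>x. \<bar>C\<bar> * ((norm (f x))\<^sup>2 + (norm (g x))\<^sup>2))"
    using assms by (auto simp: in_L2_def)
  show "AE x in lebesgue_on \<Omega>. norm (h x) \<le> norm (\<bar>C\<bar> * ((norm (f x))\<^sup>2 + (norm (g x))\<^sup>2))"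
    using assms(4)
  proof eventually_elim
    case (elim x)
    have "0 \<le> norm (f x) * norm (g x)" by simp
    moreover have "2 * (norm (f x) * norm (g x)) \<le> (norm (f x))\<^sup>2 + (norm (g x))\<^sup>2"
      using sum_squares_bound[of "norm (f x)" "norm (g x)"] by (simp add: mult.assoc)
    ultimately have fg: "norm (f x) * norm (g x) \<le> (norm (f x))\<^sup>2 + (norm (g x))\<^sup>2" by linarith
    have "C * (norm (f x) * norm (g x)) \<le> \<bar>C\<bar> * ((norm (f x))\<^sup>2 + (norm (g x))\<^sup>2)"
      by (rule mult_mono) (use fg in auto)
    thus ?case using elim by (simp add: abs_mult)
  qed
qed (rule assms)

lemma in_L2_integrable_mult:
  "in_L2 \<Omega> f \<Longrightarrow> in_L2 \<Omega> g \<Longrightarrow> integrable (lebesgue_on \<Omega>) (\<lambda>x. f x * g x :: real)"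
  by (rule in_L2_integrable_bilinear[where C=1 and f=f and g=g])
    (auto simp: in_L2_def abs_mult)

text \<open>The boundedness of the domain enters here: the constant 1 is square integrable.\<close>

lemma in_L2_integrable:
  assumes "in_L2 \<Omega> f"
  shows "integrable (lebesgue_on \<Omega>) (f :: _ \<Rightarrow> real)"
  using in_L2_integrable_mult[OF assms in_L2_bounded[of "\<lambda>_. 1" 1]] by simp

lemma in_L2_test_function:
  assumes "\<psi> \<in> test_functions \<Omega>"
  shows "in_L2 \<Omega> \<psi>"
proof -
  obtain B where "\<And>x. \<bar>\<psi> x\<bar> \<le> B" using test_functions_bounded[OF assms] by metis
  thus ?thesis using test_functions_continuous[OF assms]
    by (intro in_L2_bounded continuous_imp_measurable_on_domain) auto
qed

section \<open>Weak gradients and H1\<close>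

text \<open>The square integrability is what splits the integrals: the Bochner integral of a
  nonintegrable function is 0 by default and not additive.\<close>

lemma weak_gradient_lincomb:
  assumes v: "in_L2 \<Omega> v" "in_L2 \<Omega> g" "weak_gradient \<Omega> v g"
    and w: "in_L2 \<Omega> w" "in_L2 \<Omega> h" "weak_gradient \<Omega> w h"
  shows "weak_gradient \<Omega> (\<lambda>x. a * v x + b * w x) (\<lambda>x. a *\<^sub>R g x + b *\<^sub>R h x)"
  unfolding weak_gradient_def
proof (intro ballI allI)
  fix \<psi> i assume \<psi>: "\<psi> \<in> test_functions \<Omega>"
  note L2 = in_L2_test_function[OF \<psi>] in_L2_test_function[OF test_functions_partial_deriv[OF \<psi>]]
  have i: "integrable (lebesgue_on \<Omega>) (\<lambda>x. v x * partial_deriv i \<psi> x)"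
    "integrable (lebesgue_on \<Omega>) (\<lambda>x. w x * partial_deriv i \<psi> x)"
    "integrable (lebesgue_on \<Omega>) (\<lambda>x. g x $ i * \<psi> x)"
    "integrable (lebesgue_on \<Omega>) (\<lambda>x. h x $ i * \<psi> x)"
    using v w L2 by (auto intro!: in_L2_integrable_mult in_L2_component)
  have "(LINT x|lebesgue_on \<Omega>. (a * v x + b * w x) * partial_deriv i \<psi> x)
      = a * (LINT x|lebesgue_on \<Omega>. v x * partial_deriv i \<psi> x)
        + b * (LINT x|lebesgue_on \<Omega>. w x * partial_deriv i \<psi> x)"
    using i by (simp add: distrib_right mult.assoc)
  also have "\<dots> = - (LINT x|lebesgue_on \<Omega>. (a *\<^sub>R g x + b *\<^sub>R h x) $ i * \<psi> x)"
    using i v(3) w(3) \<psi> by (simp add: distrib_right mult.assoc weak_gradient_def)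
  finally show "(LINT x|lebesgue_on \<Omega>. (a * v x + b * w x) * partial_deriv i \<psi> x)
      = - (LINT x|lebesgue_on \<Omega>. (a *\<^sub>R g x + b *\<^sub>R h x) $ i * \<psi> x)" .
qed

text \<open>Each component of the difference is orthogonal to all test functions. This turns the
  arbitrary choice in \<open>wgrad\<close> into an operation that is linear almost
  everywhere.\<close>

lemma weak_gradient_unique:
  assumes g: "in_L2 \<Omega> g" "weak_gradient \<Omega> v g" and h: "in_L2 \<Omega> h" "weak_gradient \<Omega> v h"
  shows "AE x in lebesgue_on \<Omega>. g x = h x"
proof -
  have "AE x in lebesgue_on \<Omega>. g x $ i - h x $ i = 0" for i
  proof (rule fundamental_lemma_calculus_of_variations[OF open_domain])
    have L2: "in_L2 \<Omega> (\<lambda>x. g x $ i)" "in_L2 \<Omega> (\<lambda>x. h x $ i)" using g h by (auto intro: in_L2_component)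
    show "integrable (lebesgue_on \<Omega>) (\<lambda>x. g x $ i - h x $ i)"
      by (intro Bochner_Integration.integrable_diff in_L2_integrable L2)
    fix \<psi> assume \<psi>: "\<psi> \<in> test_functions \<Omega>"
    have "(LINT x|lebesgue_on \<Omega>. g x $ i * \<psi> x) = (LINT x|lebesgue_on \<Omega>. h x $ i * \<psi> x)"
      using g(2) h(2) \<psi> unfolding weak_gradient_def by force
    thus "(LINT x|lebesgue_on \<Omega>. (g x $ i - h x $ i) * \<psi> x) = 0"
      using in_L2_integrable_mult[OF L2(1) in_L2_test_function[OF \<psi>]]
        in_L2_integrable_mult[OF L2(2) in_L2_test_function[OF \<psi>]]
      by (simp add: left_diff_distrib)
  qed
  hence "AE x in lebesgue_on \<Omega>. \<forall>i. g x $ i - h x $ i = 0"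
    unfolding AE_all_countable by blast
  thus ?thesis by eventually_elim (simp add: vec_eq_iff)
qed

lemma wgrad_H1:
  assumes "v \<in> H1 \<Omega>"
  shows "in_L2 \<Omega> (wgrad \<Omega> v)" "weak_gradient \<Omega> v (wgrad \<Omega> v)"
  using someI_ex[of "\<lambda>g. in_L2 \<Omega> g \<and> weak_gradient \<Omega> v g"] assms
  by (auto simp: H1_def wgrad_def)

lemma H1_in_L2: "v \<in> H1 \<Omega> \<Longrightarrow> in_L2 \<Omega> v"
  by (simp add: H1_def)

lemma H1_intro: "in_L2 \<Omega> v \<Longrightarrow> in_L2 \<Omega> g \<Longrightarrow> weak_gradient \<Omega> v g \<Longrightarrow> v \<in> H1 \<Omega>"
  by (auto simp: H1_def)

lemma wgrad_eqI:
  assumes "in_L2 \<Omega> v" "in_L2 \<Omega> g" "weak_gradient \<Omega> v g"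
  shows "AE x in lebesgue_on \<Omega>. wgrad \<Omega> v x = g x"
  using weak_gradient_unique wgrad_H1[OF H1_intro[OF assms]] assms by blast

lemma
  assumes "v \<in> H1 \<Omega>" "w \<in> H1 \<Omega>"
  shows H1_lincomb: "(\<lambda>x. a * v x + b * w x) \<in> H1 \<Omega>"
    and wgrad_lincomb: "AE x in lebesgue_on \<Omega>.
      wgrad \<Omega> (\<lambda>x. a * v x + b * w x) x = a *\<^sub>R wgrad \<Omega> v x + b *\<^sub>R wgrad \<Omega> w x"
proof -
  note g = wgrad_H1[OF assms(1)] wgrad_H1[OF assms(2)]
  note L2 = H1_in_L2[OF assms(1)] H1_in_L2[OF assms(2)]
  have *: "in_L2 \<Omega> (\<lambda>x. a * v x + b * w x)"
    "in_L2 \<Omega> (\<lambda>x. a *\<^sub>R wgrad \<Omega> v x + b *\<^sub>R wgrad \<Omega> w x)"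
    "weak_gradient \<Omega> (\<lambda>x. a * v x + b * w x) (\<lambda>x. a *\<^sub>R wgrad \<Omega> v x + b *\<^sub>R wgrad \<Omega> w x)"
    using in_L2_lincomb[OF L2, of a b] in_L2_lincomb[OF g(1,3)]
      weak_gradient_lincomb[OF L2(1) g(1,2) L2(2) g(3,4)] by simp_all
  show "(\<lambda>x. a * v x + b * w x) \<in> H1 \<Omega>" by (rule H1_intro[OF *])
  show "AE x in lebesgue_on \<Omega>.
      wgrad \<Omega> (\<lambda>x. a * v x + b * w x) x = a *\<^sub>R wgrad \<Omega> v x + b *\<^sub>R wgrad \<Omega> w x"
    by (rule wgrad_eqI[OF *])
qed

text \<open>Integration by parts: the product of two test functions is a test function, its partial
  derivatives have integral 0, and the product rule splits that integral.\<close>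

lemma
  assumes "\<psi> \<in> test_functions \<Omega>"
  shows test_function_H1: "\<psi> \<in> H1 \<Omega>"
    and wgrad_test_function: "AE x in lebesgue_on \<Omega>. wgrad \<Omega> \<psi> x = (\<chi> i. partial_deriv i \<psi> x)"
proof -
  define g where "g x = (\<chi> i. partial_deriv i \<psi> x)" for x
  note d = test_functions_partial_deriv[OF assms]
  have "continuous_on UNIV g" unfolding g_def
    by (intro continuous_on_vec_lambda test_functions_continuous[OF d])
  moreover have "\<exists>B. \<forall>x. norm (g x) \<le> B"
  proof -
    have "\<exists>B. \<forall>x. \<bar>partial_deriv i \<psi> x\<bar> \<le> B" for i using test_functions_bounded[OF d] by metis
    then obtain B where B: "\<And>i x. \<bar>partial_deriv i \<psi> x\<bar> \<le> B i" by metis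
    have "norm (g x) \<le> (\<Sum>i\<in>UNIV. B i)" for x
      by (rule order_trans[OF norm_le_l1_cart]) (auto simp: g_def intro!: sum_mono B)
    thus ?thesis by blast
  qed
  ultimately have g: "in_L2 \<Omega> g"
    by (auto intro: in_L2_bounded continuous_imp_measurable_on_domain)
  have wg: "weak_gradient \<Omega> \<psi> g"
    unfolding weak_gradient_def
  proof (intro ballI allI)
    fix \<eta> i assume \<eta>: "\<eta> \<in> test_functions \<Omega>"
    have smooth: "C_k m \<psi>" for m using assms by (simp add: test_functions_def)
    have t: "(\<lambda>x. \<psi> x * \<eta> x) \<in> test_functions \<Omega>" by (rule test_functions_mult[OF \<eta> smooth])
    note d\<eta> = test_functions_partial_deriv[OF \<eta>]
    have eq: "partial_deriv i (\<lambda>x. \<psi> x * \<eta> x) x = \<psi> x * partial_deriv i \<eta> x + partial_deriv i \<psi> x * \<eta> x" for x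
      by (rule partial_deriv_mult) (use assms \<eta> test_functions_differentiable in blast)+
    have "(LINT x|lebesgue_on \<Omega>. partial_deriv i (\<lambda>x. \<psi> x * \<eta> x) x) = 0"
      using integral_partial_deriv_eq_0[OF t]
      by (subst integral_lebesgue_on_eq[OF open_domain])
        (auto intro: borel_measurable_continuous_onI test_functions_continuous
          test_functions_zero_outside test_functions_partial_deriv[OF t])
    moreover have "(LINT x|lebesgue_on \<Omega>. partial_deriv i (\<lambda>x. \<psi> x * \<eta> x) x)
        = (LINT x|lebesgue_on \<Omega>. \<psi> x * partial_deriv i \<eta> x) + (LINT x|lebesgue_on \<Omega>. partial_deriv i \<psi> x * \<eta> x)"
      unfolding eq
      by (intro Bochner_Integration.integral_add in_L2_integrable_mult in_L2_test_function assms \<eta> d d\<eta>)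
    ultimately show "(LINT x|lebesgue_on \<Omega>. \<psi> x * partial_deriv i \<eta> x)
        = - (LINT x|lebesgue_on \<Omega>. g x $ i * \<eta> x)"
      by (simp add: g_def)
  qed
  show "\<psi> \<in> H1 \<Omega>" by (rule H1_intro[OF in_L2_test_function[OF assms] g wg])
  show "AE x in lebesgue_on \<Omega>. wgrad \<Omega> \<psi> x = (\<chi> i. partial_deriv i \<psi> x)"
    using wgrad_eqI[OF in_L2_test_function[OF assms] g wg] by (simp add: g_def)
qed

lemma H1_norm_nonneg: "0 \<le> H1_norm \<Omega> v"
  by (simp add: H1_norm_def)

lemma H1_norm_power2: "(H1_norm \<Omega> v)\<^sup>2
    = (LINT x|lebesgue_on \<Omega>. (v x)\<^sup>2) + (LINT x|lebesgue_on \<Omega>. (norm (wgrad \<Omega> v x))\<^sup>2)"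
  by (simp add: H1_norm_def)

text \<open>This squared substitute for the triangle inequality suffices, since it is applied to
  null sequences and to the zero function.\<close>

lemma H1_norm_lincomb_le:
  assumes "v \<in> H1 \<Omega>" "w \<in> H1 \<Omega>"
  shows "(H1_norm \<Omega> (\<lambda>x. a * v x + b * w x))\<^sup>2 \<le> 2 * a\<^sup>2 * (H1_norm \<Omega> v)\<^sup>2 + 2 * b\<^sup>2 * (H1_norm \<Omega> w)\<^sup>2"
proof -
  let ?u = "\<lambda>x. a * v x + b * w x"
  note L2 = H1_in_L2[OF assms(1)] H1_in_L2[OF assms(2)] wgrad_H1(1)[OF assms(1)] wgrad_H1(1)[OF assms(2)]
  have i: "integrable (lebesgue_on \<Omega>) (\<lambda>x. (v x)\<^sup>2)" "integrable (lebesgue_on \<Omega>) (\<lambda>x. (w x)\<^sup>2)"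
    "integrable (lebesgue_on \<Omega>) (\<lambda>x. (norm (wgrad \<Omega> v x))\<^sup>2)"
    "integrable (lebesgue_on \<Omega>) (\<lambda>x. (norm (wgrad \<Omega> w x))\<^sup>2)"
    "integrable (lebesgue_on \<Omega>) (\<lambda>x. (norm (?u x))\<^sup>2)"
    "integrable (lebesgue_on \<Omega>) (\<lambda>x. (norm (wgrad \<Omega> ?u x))\<^sup>2)"
    using L2 H1_in_L2[OF H1_lincomb[OF assms]] wgrad_H1(1)[OF H1_lincomb[OF assms]]
    by (auto simp: in_L2_def)
  have "(LINT x|lebesgue_on \<Omega>. (?u x)\<^sup>2)
      \<le> (LINT x|lebesgue_on \<Omega>. 2 * a\<^sup>2 * (v x)\<^sup>2 + 2 * b\<^sup>2 * (w x)\<^sup>2)"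
  proof (rule integral_mono)
    show "(?u x)\<^sup>2 \<le> 2 * a\<^sup>2 * (v x)\<^sup>2 + 2 * b\<^sup>2 * (w x)\<^sup>2" for x
      using norm_lincomb_power2_le[of a "v x" b "w x"] by simp
  qed (intro Bochner_Integration.integrable_add integrable_mult_right i i(5)[unfolded real_norm_def power2_abs])+
  moreover have "(LINT x|lebesgue_on \<Omega>. (norm (wgrad \<Omega> ?u x))\<^sup>2)
      \<le> (LINT x|lebesgue_on \<Omega>. 2 * a\<^sup>2 * (norm (wgrad \<Omega> v x))\<^sup>2 + 2 * b\<^sup>2 * (norm (wgrad \<Omega> w x))\<^sup>2)"
  proof (rule integral_mono_AE)
    show "AE x in lebesgue_on \<Omega>. (norm (wgrad \<Omega> ?u x))\<^sup>2
        \<le> 2 * a\<^sup>2 * (norm (wgrad \<Omega> v x))\<^sup>2 + 2 * b\<^sup>2 * (norm (wgrad \<Omega> w x))\<^sup>2"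
      using wgrad_lincomb[OF assms, of a b] by eventually_elim (simp only: norm_lincomb_power2_le)
  qed (intro Bochner_Integration.integrable_add integrable_mult_right i)+
  moreover have "(LINT x|lebesgue_on \<Omega>. 2 * a\<^sup>2 * (v x)\<^sup>2 + 2 * b\<^sup>2 * (w x)\<^sup>2)
      = 2 * a\<^sup>2 * (LINT x|lebesgue_on \<Omega>. (v x)\<^sup>2) + 2 * b\<^sup>2 * (LINT x|lebesgue_on \<Omega>. (w x)\<^sup>2)"
    using i by simp
  moreover have "(LINT x|lebesgue_on \<Omega>. 2 * a\<^sup>2 * (norm (wgrad \<Omega> v x))\<^sup>2 + 2 * b\<^sup>2 * (norm (wgrad \<Omega> w x))\<^sup>2)
      = 2 * a\<^sup>2 * (LINT x|lebesgue_on \<Omega>. (norm (wgrad \<Omega> v x))\<^sup>2)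
        + 2 * b\<^sup>2 * (LINT x|lebesgue_on \<Omega>. (norm (wgrad \<Omega> w x))\<^sup>2)"
    using i by simp
  ultimately show ?thesis unfolding H1_norm_power2 distrib_left by linarith
qed

section \<open>Functions with zero boundary values\<close>

lemma H10_imp_H1: "v \<in> H10 \<Omega> \<Longrightarrow> v \<in> H1 \<Omega>"
  by (simp add: H10_def)

lemma H10_lincomb:
  assumes "v \<in> H10 \<Omega>" "w \<in> H10 \<Omega>"
  shows "(\<lambda>x. a * v x + b * w x) \<in> H10 \<Omega>"
proof -
  obtain \<psi> where \<psi>: "\<And>m::nat. \<psi> m \<in> test_functions \<Omega>"
    "(\<lambda>m. H1_norm \<Omega> (\<lambda>x. v x - \<psi> m x)) \<longlonglongrightarrow> 0" using assms(1) by (auto simp: H10_def)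
  obtain \<eta> where \<eta>: "\<And>m::nat. \<eta> m \<in> test_functions \<Omega>"
    "(\<lambda>m. H1_norm \<Omega> (\<lambda>x. w x - \<eta> m x)) \<longlonglongrightarrow> 0" using assms(2) by (auto simp: H10_def)
  let ?\<theta> = "\<lambda>m x. a * \<psi> m x + b * \<eta> m x"
  have t: "?\<theta> m \<in> test_functions \<Omega>" for m
    using \<psi> \<eta> by (intro test_functions_add test_functions_mult C_k_const) auto
  let ?e = "\<lambda>m. H1_norm \<Omega> (\<lambda>x. a * v x + b * w x - ?\<theta> m x)"
  have "(?e m)\<^sup>2 \<le> 2 * a\<^sup>2 * (H1_norm \<Omega> (\<lambda>x. v x - \<psi> m x))\<^sup>2 + 2 * b\<^sup>2 * (H1_norm \<Omega> (\<lambda>x. w x - \<eta> m x))\<^sup>2" for m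
  proof -
    have "(\<lambda>x. v x - \<psi> m x) \<in> H1 \<Omega>" "(\<lambda>x. w x - \<eta> m x) \<in> H1 \<Omega>"
      using H1_lincomb[OF H10_imp_H1[OF assms(1)] test_function_H1[OF \<psi>(1)], of 1 "-1"]
        H1_lincomb[OF H10_imp_H1[OF assms(2)] test_function_H1[OF \<eta>(1)], of 1 "-1"] by simp_all
    from H1_norm_lincomb_le[OF this, of a b] show ?thesis by (simp add: algebra_simps)
  qed
  moreover have "(\<lambda>m. 2 * a\<^sup>2 * (H1_norm \<Omega> (\<lambda>x. v x - \<psi> m x))\<^sup>2
      + 2 * b\<^sup>2 * (H1_norm \<Omega> (\<lambda>x. w x - \<eta> m x))\<^sup>2) \<longlonglongrightarrow> 2 * a\<^sup>2 * 0\<^sup>2 + 2 * b\<^sup>2 * 0\<^sup>2"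
    by (intro tendsto_intros \<psi> \<eta>)
  ultimately have "(\<lambda>m. (?e m)\<^sup>2) \<longlonglongrightarrow> 0"
    by (intro Lim_null_comparison[of "\<lambda>m. (?e m)\<^sup>2"]) auto
  hence "?e \<longlonglongrightarrow> 0"
    using tendsto_real_sqrt[of "\<lambda>m. (?e m)\<^sup>2" 0] by (simp add: H1_norm_nonneg)
  moreover have "(\<lambda>x. a * v x + b * w x) \<in> H1 \<Omega>"
    using assms by (intro H1_lincomb H10_imp_H1)
  ultimately show ?thesis using t unfolding H10_def by (auto intro!: exI[of _ ?\<theta>])
qed

text \<open>Testing the weak gradient of \<open>v\<close> with \<open>x\<^sub>i \<psi>\<^sub>m\<close>, where the test functions \<open>\<psi>\<^sub>m\<close> converge to
  \<open>v\<close>, replaces the Poincare inequality.\<close>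

lemma H10_zero_gradient:
  assumes v: "v \<in> H10 \<Omega>" and 0: "AE x in lebesgue_on \<Omega>. wgrad \<Omega> v x = 0"
  shows "AE x in lebesgue_on \<Omega>. v x = 0"
proof -
  obtain \<psi> where \<psi>: "\<And>m::nat. \<psi> m \<in> test_functions \<Omega>"
    "(\<lambda>m. H1_norm \<Omega> (\<lambda>x. v x - \<psi> m x)) \<longlonglongrightarrow> 0" using v by (auto simp: H10_def)
  obtain R where R: "R > 0" "\<And>x. x \<in> \<Omega> \<Longrightarrow> norm x \<le> R" using bounded_domain by (auto simp: bounded_pos)
  \<comment> \<open>One coordinate direction is enough, and it may be any.\<close>
  fix i :: 'n
  have vL: "in_L2 \<Omega> v" and wv: "weak_gradient \<Omega> v (wgrad \<Omega> v)"
    using H1_in_L2 wgrad_H1 H10_imp_H1[OF v] by auto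
  have int_v2: "integrable (lebesgue_on \<Omega>) (\<lambda>x. (v x)\<^sup>2)" using vL by (simp add: in_L2_def)
  have key: "(LINT x|lebesgue_on \<Omega>. (v x)\<^sup>2) \<le> 2 * (1 + R\<^sup>2) * (H1_norm \<Omega> (\<lambda>x. v x - \<psi> m x))\<^sup>2" for m
  proof -
    let ?p = "\<psi> m" and ?u = "\<lambda>x. v x - \<psi> m x" and ?d = "partial_deriv i (\<psi> m)"
    note dp = test_functions_partial_deriv[OF \<psi>(1)[of m], of i]
    note pL = in_L2_test_function[OF \<psi>(1)[of m]]
    have u: "?u \<in> H1 \<Omega>"
      using H1_lincomb[OF H10_imp_H1[OF v] test_function_H1[OF \<psi>(1)], of 1 "-1"] by simp
    have gu: "AE x in lebesgue_on \<Omega>. wgrad \<Omega> ?u x = - (\<chi> i. partial_deriv i ?p x)"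
      using wgrad_lincomb[OF H10_imp_H1[OF v] test_function_H1[OF \<psi>(1)[of m]], of 1 "-1"] 0
        wgrad_test_function[OF \<psi>(1)[of m]]
      by eventually_elim simp
    have t: "(\<lambda>x. x $ i * ?p x) \<in> test_functions \<Omega>"
      by (intro test_functions_mult \<psi> C_k_component)
    have "partial_deriv i (\<lambda>x. x $ i) x = 1" for x :: "real^'n"
      by (subst partial_deriv_eq[OF bounded_linear_imp_has_derivative[OF bounded_linear_vec_nth]]) simp
    moreover have "(\<lambda>x::real^'n. x $ i) differentiable at x" for x
      using bounded_linear_imp_has_derivative[OF bounded_linear_vec_nth] by (auto simp: differentiable_def)
    ultimately have pd: "partial_deriv i (\<lambda>x. x $ i * ?p x) x = x $ i * ?d x + ?p x" for x
      using test_functions_differentiable[OF \<psi>(1)] by (subst partial_deriv_mult) auto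
    have xd: "in_L2 \<Omega> (\<lambda>x. x $ i * ?d x)"
      by (intro in_L2_test_function test_functions_mult[OF dp] C_k_component)
    \<comment> \<open>As the weak gradient of \<open>v\<close> vanishes, \<open>v\<close> is
      orthogonal to the derivative of \<open>x $ i * ?p x\<close>; subtracting this zero integral
      below costs nothing.\<close>
    have "(LINT x|lebesgue_on \<Omega>. v x * (x $ i * ?d x + ?p x)) = - (LINT x|lebesgue_on \<Omega>. wgrad \<Omega> v x $ i * (x $ i * ?p x))"
      using wv t unfolding weak_gradient_def pd[symmetric] by blast
    also have "(LINT x|lebesgue_on \<Omega>. wgrad \<Omega> v x $ i * (x $ i * ?p x)) = 0"
      by (rule integral_eq_zero_AE) (use 0 in eventually_elim, simp)
    finally have z: "(LINT x|lebesgue_on \<Omega>. v x * (x $ i * ?d x + ?p x)) = 0" by simp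
    have i1: "integrable (lebesgue_on \<Omega>) (\<lambda>x. v x * (x $ i * ?d x + ?p x))"
      using in_L2_integrable_mult[OF vL in_L2_lincomb[OF xd pL, of 1 1]] by simp
    have iu: "integrable (lebesgue_on \<Omega>) (\<lambda>x. (?u x)\<^sup>2)"
      "integrable (lebesgue_on \<Omega>) (\<lambda>x. (norm (wgrad \<Omega> ?u x))\<^sup>2)"
      using H1_in_L2[OF u] wgrad_H1(1)[OF u] by (auto simp: in_L2_def)
    have "(LINT x|lebesgue_on \<Omega>. (v x)\<^sup>2) = (LINT x|lebesgue_on \<Omega>. (v x)\<^sup>2 - v x * (x $ i * ?d x + ?p x))"
      using z int_v2 i1 by simp
    \<comment> \<open>The integrand equals \<open>v x * ?u x - v x * (x $ i * ?d x)\<close>, and up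
      to sign \<open>?d\<close> is a component of the gradient of \<open>?u\<close>. Young's
      inequality spends a quarter of \<open>(v x)\<^sup>2\<close> on each product; moving the
      resulting half to the left yields the factor 2 of the claim.\<close>
    also have "\<dots> \<le> (LINT x|lebesgue_on \<Omega>. (v x)\<^sup>2 / 2 + (?u x)\<^sup>2 + R\<^sup>2 * (norm (wgrad \<Omega> ?u x))\<^sup>2)"
    proof (rule integral_mono_AE)
      have "AE x in lebesgue_on \<Omega>. x \<in> \<Omega>" by (rule AE_I2) auto
      thus "AE x in lebesgue_on \<Omega>. (v x)\<^sup>2 - v x * (x $ i * ?d x + ?p x)
          \<le> (v x)\<^sup>2 / 2 + (?u x)\<^sup>2 + R\<^sup>2 * (norm (wgrad \<Omega> ?u x))\<^sup>2"
        using gu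
      proof eventually_elim
        case (elim x)
        have "(v x)\<^sup>2 - v x * (x $ i * ?d x + ?p x) = v x * ?u x - v x * (x $ i * ?d x)"
          by (simp add: power2_eq_square algebra_simps)
        moreover have "v x * ?u x \<le> (v x)\<^sup>2 / 4 + (?u x)\<^sup>2"
          using zero_le_power2[of "v x / 2 - ?u x"] by (simp add: power2_eq_square field_simps)
        moreover have "- (v x * (x $ i * ?d x)) \<le> (v x)\<^sup>2 / 4 + (x $ i * ?d x)\<^sup>2"
          using zero_le_power2[of "v x / 2 + x $ i * ?d x"] by (simp add: power2_sum power_divide)
        moreover have "(x $ i * ?d x)\<^sup>2 \<le> R\<^sup>2 * (norm (wgrad \<Omega> ?u x))\<^sup>2"
        proof -
          have "\<bar>x $ i\<bar> \<le> R" using R(2)[OF elim(1)] component_le_norm_cart[of x i] by linarith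
          moreover have "\<bar>?d x\<bar> \<le> norm (wgrad \<Omega> ?u x)"
            using component_le_norm_cart[of "wgrad \<Omega> ?u x" i] by (simp add: elim(2))
          ultimately show ?thesis unfolding power_mult_distrib
            by (intro mult_mono) (use R in \<open>auto simp: abs_le_square_iff[symmetric]\<close>)
        qed
        ultimately show ?case by linarith
      qed
    qed (use int_v2 i1 iu in auto)
    also have "\<dots> = (LINT x|lebesgue_on \<Omega>. (v x)\<^sup>2) / 2 + (LINT x|lebesgue_on \<Omega>. (?u x)\<^sup>2)
        + R\<^sup>2 * (LINT x|lebesgue_on \<Omega>. (norm (wgrad \<Omega> ?u x))\<^sup>2)"
      using int_v2 iu by simp
    also have "\<dots> \<le> (LINT x|lebesgue_on \<Omega>. (v x)\<^sup>2) / 2 + (1 + R\<^sup>2) * (H1_norm \<Omega> ?u)\<^sup>2"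
    proof -
      have "0 \<le> R\<^sup>2 * (LINT x|lebesgue_on \<Omega>. (?u x)\<^sup>2)" "0 \<le> (LINT x|lebesgue_on \<Omega>. (norm (wgrad \<Omega> ?u x))\<^sup>2)"
        by auto
      thus ?thesis by (simp add: H1_norm_power2 algebra_simps)
    qed
    finally show ?thesis by (simp add: algebra_simps)
  qed
  have "(\<lambda>m. 2 * (1 + R\<^sup>2) * (H1_norm \<Omega> (\<lambda>x. v x - \<psi> m x))\<^sup>2) \<longlonglongrightarrow> 2 * (1 + R\<^sup>2) * 0\<^sup>2"
    by (intro tendsto_intros \<psi>)
  hence "(LINT x|lebesgue_on \<Omega>. (v x)\<^sup>2) \<le> 2 * (1 + R\<^sup>2) * 0\<^sup>2"
    by (rule LIMSEQ_le_const) (use key in auto)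
  hence "(LINT x|lebesgue_on \<Omega>. (v x)\<^sup>2) = 0"
    by (intro antisym) simp_all
  hence "AE x in lebesgue_on \<Omega>. (v x)\<^sup>2 = 0"
    using int_v2 by (subst (asm) integral_nonneg_eq_0_iff_AE) auto
  thus ?thesis by simp
qed

text \<open>The set where the function is nonzero is open, and a nonempty open set is not
  negligible.\<close>

lemma continuous_on_AE_zero:
  fixes v :: "real^'n \<Rightarrow> real"
  assumes "continuous_on \<Omega> v" "AE x in lebesgue_on \<Omega>. v x = 0" "x \<in> \<Omega>"
  shows "v x = 0"
proof (rule ccontr)
  assume "v x \<noteq> 0"
  define U where "U = \<Omega> \<inter> v -` (- {0})"
  have "open U" unfolding U_def
    using continuous_open_preimage[OF assms(1) open_domain, of "- {0}"] by auto
  moreover have "AE x in lebesgue. x \<notin> U"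
    using assms(2) domain_sets by (auto simp: AE_restrict_space_iff U_def elim!: eventually_mono)
  hence "U \<in> null_sets lebesgue"
    using \<open>open U\<close> by (subst AE_iff_null_sets) (auto intro: borel_open)
  hence "negligible U" by (simp add: negligible_iff_null_sets)
  ultimately have "U = {}" using open_not_negligible by blast
  thus False using assms(3) \<open>v x \<noteq> 0\<close> by (auto simp: U_def)
qed

end

section \<open>The energy form of diffusion and reaction\<close>

locale elliptic_form = bounded_open \<Omega> for \<Omega> :: "(real^'n) set" +
  fixes \<D> :: "real^'n \<Rightarrow> real^'n^'n" and \<mu> :: "real^'n \<Rightarrow> real" and d\<^sub>0 :: real
  assumes D_Linf: "in_Linf \<Omega> \<D>" and D_symmetric: "AE x in lebesgue_on \<Omega>. transpose (\<D> x) = \<D> x"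
    and d0_pos: "d\<^sub>0 > 0" and D_coercive: "AE x in lebesgue_on \<Omega>. \<forall>y. y \<bullet> (\<D> x *v y) \<ge> d\<^sub>0 * (norm y)\<^sup>2"
    and mu_Linf: "in_Linf \<Omega> \<mu>" and mu_ge_0: "AE x in lebesgue_on \<Omega>. \<mu> x \<ge> 0"
begin

lemma integrable_diffusion:
  assumes g: "in_L2 \<Omega> g" and h: "in_L2 \<Omega> h"
  shows "integrable (lebesgue_on \<Omega>) (\<lambda>x. (\<D> x *v g x) \<bullet> h x)"
proof -
  obtain C where C: "AE x in lebesgue_on \<Omega>. norm (\<D> x) \<le> C" using D_Linf by (auto simp: in_Linf_def)
  show ?thesis
  proof (rule in_L2_integrable_bilinear[OF g h])
    have "(\<lambda>x. \<D> x $ i $ j) \<in> borel_measurable (lebesgue_on \<Omega>)" for i j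
      using D_Linf by (auto simp: in_Linf_def intro!: borel_measurable_component)
    moreover have "(\<lambda>x. g x $ i) \<in> borel_measurable (lebesgue_on \<Omega>)"
      "(\<lambda>x. h x $ i) \<in> borel_measurable (lebesgue_on \<Omega>)" for i
      using g h by (auto simp: in_L2_def intro!: borel_measurable_component)
    ultimately show "(\<lambda>x. (\<D> x *v g x) \<bullet> h x) \<in> borel_measurable (lebesgue_on \<Omega>)"
      by (simp add: inner_vec_def matrix_vector_mult_def)
    show "AE x in lebesgue_on \<Omega>. \<bar>(\<D> x *v g x) \<bullet> h x\<bar> \<le> C * (norm (g x) * norm (h x))"
      using C
    proof eventually_elim
      case (elim x)
      have "\<bar>(\<D> x *v g x) \<bullet> h x\<bar> \<le> norm (\<D> x *v g x) * norm (h x)"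
        by (rule Cauchy_Schwarz_ineq2)
      also have "\<dots> \<le> (C * norm (g x)) * norm (h x)"
        using elim norm_matrix_vector_mult_le[of "\<D> x" "g x"]
        by (intro mult_right_mono order_trans[OF norm_matrix_vector_mult_le]) auto
      finally show ?case by (simp add: mult.assoc)
    qed
  qed
qed

lemma integrable_reaction:
  assumes g: "in_L2 \<Omega> g" and h: "in_L2 \<Omega> h"
  shows "integrable (lebesgue_on \<Omega>) (\<lambda>x. \<mu> x * g x * h x)"
proof -
  obtain C where C: "AE x in lebesgue_on \<Omega>. norm (\<mu> x) \<le> C" using mu_Linf by (auto simp: in_Linf_def)
  show ?thesis
  proof (rule in_L2_integrable_bilinear[OF g h])
    show "(\<lambda>x. \<mu> x * g x * h x) \<in> borel_measurable (lebesgue_on \<Omega>)"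
      using mu_Linf g h by (auto simp: in_Linf_def in_L2_def)
    show "AE x in lebesgue_on \<Omega>. \<bar>\<mu> x * g x * h x\<bar> \<le> C * (norm (g x) * norm (h x))"
      using C by eventually_elim (auto simp: abs_mult mult.assoc intro: mult_right_mono)
  qed
qed

lemma a_form_commute:
  assumes "v \<in> H1 \<Omega>" "w \<in> H1 \<Omega>"
  shows "a_form \<Omega> \<D> \<mu> v w = a_form \<Omega> \<D> \<mu> w v"
proof -
  have "(LINT x|lebesgue_on \<Omega>. (\<D> x *v wgrad \<Omega> v x) \<bullet> wgrad \<Omega> w x)
      = (LINT x|lebesgue_on \<Omega>. (\<D> x *v wgrad \<Omega> w x) \<bullet> wgrad \<Omega> v x)"
  proof (rule integral_cong_AE)
    show "AE x in lebesgue_on \<Omega>. (\<D> x *v wgrad \<Omega> v x) \<bullet> wgrad \<Omega> w x = (\<D> x *v wgrad \<Omega> w x) \<bullet> wgrad \<Omega> v x"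
      using D_symmetric
    proof eventually_elim
      case (elim x)
      thus ?case
        by (metis dot_lmul_matrix inner_commute vector_transpose_matrix)
    qed
  qed (use integrable_diffusion wgrad_H1(1) assms in \<open>auto intro!: borel_measurable_integrable\<close>)
  thus ?thesis by (simp add: a_form_def mult_ac)
qed

lemma a_form_lincomb_left:
  assumes u: "u \<in> H1 \<Omega>" and v: "v \<in> H1 \<Omega>" and w: "w \<in> H1 \<Omega>"
  shows "a_form \<Omega> \<D> \<mu> (\<lambda>x. a * u x + b * v x) w = a * a_form \<Omega> \<D> \<mu> u w + b * a_form \<Omega> \<D> \<mu> v w"
proof -
  note g = wgrad_H1(1)[OF u] wgrad_H1(1)[OF v] wgrad_H1(1)[OF w]
  note L2 = H1_in_L2[OF u] H1_in_L2[OF v] H1_in_L2[OF w]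
  note uv = H1_lincomb[OF u v, of a b]
  note id = integrable_diffusion[OF g(1,3)] integrable_diffusion[OF g(2,3)]
    integrable_diffusion[OF wgrad_H1(1)[OF uv] g(3)]
  note ir = integrable_reaction[OF L2(1,3)] integrable_reaction[OF L2(2,3)]
  have "(LINT x|lebesgue_on \<Omega>. (\<D> x *v wgrad \<Omega> (\<lambda>x. a * u x + b * v x) x) \<bullet> wgrad \<Omega> w x)
      = (LINT x|lebesgue_on \<Omega>. a * ((\<D> x *v wgrad \<Omega> u x) \<bullet> wgrad \<Omega> w x) + b * ((\<D> x *v wgrad \<Omega> v x) \<bullet> wgrad \<Omega> w x))"
  proof (rule integral_cong_AE)
    show "AE x in lebesgue_on \<Omega>. (\<D> x *v wgrad \<Omega> (\<lambda>x. a * u x + b * v x) x) \<bullet> wgrad \<Omega> w x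
        = a * ((\<D> x *v wgrad \<Omega> u x) \<bullet> wgrad \<Omega> w x) + b * ((\<D> x *v wgrad \<Omega> v x) \<bullet> wgrad \<Omega> w x)"
      using wgrad_lincomb[OF u v, of a b]
      by eventually_elim
        (simp add: matrix_vector_right_distrib vector_scaleR_matrix_ac matrix_vector_mult_scaleR inner_add_left)
  qed (use id in \<open>auto intro!: borel_measurable_integrable\<close>)
  also have "\<dots> = a * (LINT x|lebesgue_on \<Omega>. (\<D> x *v wgrad \<Omega> u x) \<bullet> wgrad \<Omega> w x)
      + b * (LINT x|lebesgue_on \<Omega>. (\<D> x *v wgrad \<Omega> v x) \<bullet> wgrad \<Omega> w x)"
    using id by simp
  finally have 1: "(LINT x|lebesgue_on \<Omega>. (\<D> x *v wgrad \<Omega> (\<lambda>x. a * u x + b * v x) x) \<bullet> wgrad \<Omega> w x) = \<dots>" .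
  have "(LINT x|lebesgue_on \<Omega>. \<mu> x * (a * u x + b * v x) * w x)
      = (LINT x|lebesgue_on \<Omega>. a * (\<mu> x * u x * w x) + b * (\<mu> x * v x * w x))"
    by (intro Bochner_Integration.integral_cong) (auto simp: algebra_simps)
  also have "\<dots> = a * (LINT x|lebesgue_on \<Omega>. \<mu> x * u x * w x) + b * (LINT x|lebesgue_on \<Omega>. \<mu> x * v x * w x)"
    using ir by simp
  finally show ?thesis using 1 by (simp add: a_form_def algebra_simps)
qed

text \<open>The reaction term is nonnegative and dropped; the ellipticity of the diffusion tensor
  does the rest.\<close>

lemma a_form_self_ge:
  assumes "v \<in> H1 \<Omega>"
  shows "d\<^sub>0 * (LINT x|lebesgue_on \<Omega>. (norm (wgrad \<Omega> v x))\<^sup>2) \<le> a_form \<Omega> \<D> \<mu> v v"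
proof -
  note g = wgrad_H1(1)[OF assms]
  have i: "integrable (lebesgue_on \<Omega>) (\<lambda>x. (norm (wgrad \<Omega> v x))\<^sup>2)" using g by (simp add: in_L2_def)
  have "(LINT x|lebesgue_on \<Omega>. d\<^sub>0 * (norm (wgrad \<Omega> v x))\<^sup>2)
      \<le> (LINT x|lebesgue_on \<Omega>. (\<D> x *v wgrad \<Omega> v x) \<bullet> wgrad \<Omega> v x)"
  proof (rule integral_mono_AE)
    show "AE x in lebesgue_on \<Omega>. d\<^sub>0 * (norm (wgrad \<Omega> v x))\<^sup>2 \<le> (\<D> x *v wgrad \<Omega> v x) \<bullet> wgrad \<Omega> v x"
      using D_coercive by eventually_elim (simp add: inner_commute)
  qed (use i integrable_diffusion[OF g g] in auto)
  moreover have "0 \<le> (LINT x|lebesgue_on \<Omega>. \<mu> x * v x * v x)"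
    by (rule integral_nonneg_AE) (use mu_ge_0 in eventually_elim, simp add: mult.assoc)
  ultimately show ?thesis using i by (simp add: a_form_def)
qed

lemma a_form_self_nonneg:
  assumes "v \<in> H1 \<Omega>"
  shows "0 \<le> a_form \<Omega> \<D> \<mu> v v"
proof -
  have "0 \<le> d\<^sub>0 * (LINT x|lebesgue_on \<Omega>. (norm (wgrad \<Omega> v x))\<^sup>2)" using d0_pos by simp
  thus ?thesis using a_form_self_ge[OF assms] by linarith
qed

text \<open>Zero energy forces a zero gradient, hence the value zero almost everywhere; continuity
  extends this to every point, which is needed because nodal values are point values.\<close>

lemma a_form_definite:
  assumes "v \<in> H10 \<Omega>" "continuous_on \<Omega> v" "a_form \<Omega> \<D> \<mu> v v = 0" "x \<in> \<Omega>"
  shows "v x = 0"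
proof (rule continuous_on_AE_zero[OF assms(2) _ assms(4)], rule H10_zero_gradient[OF assms(1)])
  note H1 = H10_imp_H1[OF assms(1)]
  have i: "integrable (lebesgue_on \<Omega>) (\<lambda>x. (norm (wgrad \<Omega> v x))\<^sup>2)" using wgrad_H1(1)[OF H1] by (simp add: in_L2_def)
  have "(LINT x|lebesgue_on \<Omega>. (norm (wgrad \<Omega> v x))\<^sup>2) \<le> 0"
    using a_form_self_ge[OF H1] d0_pos assms(3) by (simp add: mult_le_0_iff)
  hence "(LINT x|lebesgue_on \<Omega>. (norm (wgrad \<Omega> v x))\<^sup>2) = 0"
    by (intro antisym) simp_all
  hence "AE x in lebesgue_on \<Omega>. (norm (wgrad \<Omega> v x))\<^sup>2 = 0"
    using i by (subst (asm) integral_nonneg_eq_0_iff_AE) auto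
  thus "AE x in lebesgue_on \<Omega>. wgrad \<Omega> v x = 0" by simp
qed

end

text \<open>The H1 inner product is itself an energy form, so the coercivity in nodal values is
  proved once and used for both norms.\<close>

lemma (in bounded_open) elliptic_form_H1: "elliptic_form \<Omega> (\<lambda>_. mat 1) (\<lambda>_. 1) 1"
proof
  show "in_Linf \<Omega> (\<lambda>_. mat 1 :: real^'n^'n)" "in_Linf \<Omega> (\<lambda>_. 1 :: real)"
    by (auto simp: in_Linf_def)
qed (auto simp: transpose_mat power2_norm_eq_inner)

lemma H1_norm_eq_a_form: "(H1_norm \<Omega> v)\<^sup>2 = a_form \<Omega> (\<lambda>_. mat 1) (\<lambda>_. 1) v v"
  by (simp add: H1_norm_def a_form_def flip: power2_norm_eq_inner power2_eq_square)

section \<open>Elements and the mesh function\<close>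

lemma polynomials_lincomb:
  assumes "p \<in> polynomials M" "q \<in> polynomials M"
  shows "(\<lambda>x. a * p x + b * q x) \<in> polynomials M"
proof -
  obtain c d where "p = (\<lambda>x. \<Sum>m\<in>M. c m * (\<Prod>i\<in>UNIV. (x $ i) ^ m i))"
    "q = (\<lambda>x. \<Sum>m\<in>M. d m * (\<Prod>i\<in>UNIV. (x $ i) ^ m i))"
    using assms by (auto simp: polynomials_def)
  hence "(\<lambda>x. a * p x + b * q x) = (\<lambda>x. \<Sum>m\<in>M. (a * c m + b * d m) * (\<Prod>i\<in>UNIV. (x $ i) ^ m i))"
    by (auto simp: sum_distrib_left sum.distrib distrib_right mult.assoc)
  thus ?thesis unfolding polynomials_def by (auto intro!: exI[of _ "\<lambda>m. a * c m + b * d m"])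
qed

lemma polynomials_zero: "(\<lambda>_. 0) \<in> polynomials M"
  unfolding polynomials_def by (auto intro!: exI[of _ "\<lambda>_. 0"])

lemma polynomials_sum:
  assumes "finite I" "\<And>i. i \<in> I \<Longrightarrow> p i \<in> polynomials M"
  shows "(\<lambda>x. \<Sum>i\<in>I. c i * p i x) \<in> polynomials M"
  using assms
proof (induction I rule: finite_induct)
  case (insert j I)
  thus ?case using polynomials_lincomb[of "p j" M "\<lambda>x. \<Sum>i\<in>I. c i * p i x" "c j" 1] by simp
qed (simp add: polynomials_zero)

section \<open>Symmetries of the unit cube and tensor-product polynomials\<close>

abbreviation unit_cube :: "(real^'n) set" where
  "unit_cube \<equiv> cbox 0 (\<chi> i. 1)"

lemma affine_paramE:
  fixes F :: "real^'n \<Rightarrow> real^'n"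
  assumes "affine_param K F"
  obtains A b where "invertible A" "F = (\<lambda>x. b + A *v x)" "K = F ` unit_cube"
  using assms unfolding affine_param_def by (elim exE conjE) (rule that)

lemma mem_unit_cube: "y \<in> unit_cube \<longleftrightarrow> (\<forall>i. 0 \<le> y $ i \<and> y $ i \<le> 1)"
  by (simp add: mem_box_cart)

lemma extreme_point_of_unit_cube:
  "y extreme_point_of unit_cube \<longleftrightarrow> (\<forall>i. y $ i = 0 \<or> y $ i = 1)"
proof
  assume ext: "y extreme_point_of unit_cube"
  hence y: "y \<in> unit_cube" by (simp add: extreme_point_of_def)
  show "\<forall>i. y $ i = 0 \<or> y $ i = 1"
  proof (rule ccontr)
    assume "\<not> ?thesis"
    then obtain i where i: "0 < y $ i" "y $ i < 1" using y by (force simp: mem_unit_cube less_le)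
    \<comment> \<open>The distance to the nearer of the two faces: the point can be moved by
      \<open>e\<close> in either direction without leaving the cube.\<close>
    define e where "e = min (y $ i) (1 - y $ i)"
    have e: "e > 0" "e \<le> y $ i" "e \<le> 1 - y $ i" using i by (auto simp: e_def)
    let ?p = "y + e *\<^sub>R axis i 1" and ?q = "y - e *\<^sub>R axis i 1"
    have "?p \<in> unit_cube" "?q \<in> unit_cube"
      using y e by (auto simp: mem_unit_cube axis_def)
    moreover have "y = midpoint ?p ?q" by (simp add: midpoint_def scaleR_2[symmetric])
    moreover have "?p \<noteq> ?q"
    proof
      assume "?p = ?q"
      hence "?p $ i = ?q $ i" by (rule arg_cong)
      thus False using e by (simp add: axis_def)
    qed
    ultimately have "y \<in> open_segment ?p ?q" by (metis midpoint_in_open_segment)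
    thus False using ext \<open>?p \<in> unit_cube\<close> \<open>?q \<in> unit_cube\<close> by (auto simp: extreme_point_of_def)
  qed
next
  assume v: "\<forall>i. y $ i = 0 \<or> y $ i = 1"
  show "y extreme_point_of unit_cube"
    unfolding extreme_point_of_def
  proof (intro conjI ballI notI)
    show "y \<in> unit_cube" using v by (simp add: mem_unit_cube) (metis zero_le_one order_refl)
    fix a b assume ab: "a \<in> unit_cube" "b \<in> unit_cube" and "y \<in> open_segment a b"
    then obtain u where u: "a \<noteq> b" "0 < u" "u < 1" "y = (1 - u) *\<^sub>R a + u *\<^sub>R b"
      by (auto simp: in_segment)
    have "a $ i = b $ i" for i
    proof -
      have ab_i: "0 \<le> a $ i" "a $ i \<le> 1" "0 \<le> b $ i" "b $ i \<le> 1" using ab by (auto simp: mem_unit_cube)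
      have y_i: "y $ i = (1 - u) * a $ i + u * b $ i" by (simp add: u(4))
      consider "y $ i = 0" | "y $ i = 1" using v by blast
      thus ?thesis
      proof cases
        case 1
        have "0 \<le> (1 - u) * a $ i" "0 \<le> u * b $ i" using ab_i u by auto
        hence "(1 - u) * a $ i = 0" "u * b $ i = 0" using y_i 1 by linarith+
        thus ?thesis using u by simp
      next
        case 2
        have "0 \<le> (1 - u) * (1 - a $ i)" "0 \<le> u * (1 - b $ i)" using ab_i u by auto
        moreover have "(1 - u) * (1 - a $ i) + u * (1 - b $ i) = 0"
          using y_i 2 by (simp add: algebra_simps)
        ultimately have "(1 - u) * (1 - a $ i) = 0" "u * (1 - b $ i) = 0" by linarith+
        thus ?thesis using u by simp
      qed
    qed
    thus False using u(1) by (simp add: vec_eq_iff)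
  qed
qed

text \<open>Extreme points are treated as singleton faces, since injective linear maps carry faces
  to faces.\<close>

lemma extreme_point_of_affine_image:
  fixes A :: "real^'n^'n"
  assumes "invertible A"
  shows "(b + A *v y) extreme_point_of ((\<lambda>x. b + A *v x) ` S) \<longleftrightarrow> y extreme_point_of S"
proof -
  have lin: "linear ((*v) A)" by (rule matrix_vector_mul_linear)
  have inj: "inj ((*v) A)" using assms by (simp add: inj_matrix_vector_mult)
  have "(b + A *v y) extreme_point_of ((+) b ` ((*v) A ` S)) \<longleftrightarrow> A *v y extreme_point_of ((*v) A ` S)"
    by (rule extreme_point_of_translation_eq)
  also have "\<dots> \<longleftrightarrow> ((*v) A ` {y}) face_of ((*v) A ` S)" by (simp add: face_of_singleton)
  also have "\<dots> \<longleftrightarrow> y extreme_point_of S"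
    using face_of_linear_image[OF lin inj, of "{y}" S] by (simp add: face_of_singleton)
  finally show ?thesis by (simp add: image_image)
qed

text \<open>Vertices go to vertices: the images of \<open>0\<close>, \<open>e\<^sub>i\<close> and \<open>e\<^sub>i + e\<^sub>i'\<close> force exactly one nonzero entry,
  \<open>1\<close> or \<open>-1\<close>, in each row of the matrix.\<close>

lemma unit_cube_symmetry:
  fixes G :: "real^'n \<Rightarrow> real^'n"
  assumes "affine_param unit_cube G"
  obtains b s \<pi> where "bij \<pi>" "\<And>x j. G x $ j = b j + s j * x $ \<pi> j"
proof -
  obtain A b where A: "invertible A" and G: "G = (\<lambda>x. b + A *v x)" and im: "unit_cube = G ` unit_cube"
    by (rule affine_paramE[OF assms])
  obtain B where B: "A ** B = mat 1" using A by (auto simp: invertible_def)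
  have AB: "(\<Sum>i\<in>UNIV. A $ j $ i * B $ i $ j') = (if j = j' then 1 else 0)" for j j'
    using B by (simp add: vec_eq_iff matrix_matrix_mult_def mat_def)
  have vert: "G y $ j = 0 \<or> G y $ j = 1" if "\<And>i. y $ i = 0 \<or> y $ i = 1" for y j
  proof -
    have "y extreme_point_of unit_cube" using that by (simp add: extreme_point_of_unit_cube)
    hence "G y extreme_point_of G ` unit_cube"
      unfolding G using extreme_point_of_affine_image[OF A] by blast
    thus ?thesis using im by (simp add: extreme_point_of_unit_cube)
  qed
  have G_nth: "G x $ j = b $ j + (\<Sum>i\<in>UNIV. A $ j $ i * x $ i)" for x j
    by (simp add: G matrix_vector_mult_def)
  have b: "b $ j = 0 \<or> b $ j = 1" for j using vert[of 0 j] by (simp add: G_nth)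
  have Gi: "G (axis i 1) $ j = b $ j + A $ j $ i" for i j
    by (simp add: G_nth axis_def if_distrib cong: if_cong)
  have bA: "b $ j + A $ j $ i = 0 \<or> b $ j + A $ j $ i = 1" for i j
    using vert[of "axis i 1" j] unfolding Gi by (auto simp: axis_def)
  have bAA: "b $ j + A $ j $ i + A $ j $ i' = 0 \<or> b $ j + A $ j $ i + A $ j $ i' = 1" if "i \<noteq> i'" for i i' j
  proof -
    have "G (axis i 1 + axis i' 1) $ j = G (axis i 1) $ j + G (axis i' 1) $ j - b $ j"
      by (simp add: G matrix_vector_right_distrib)
    hence "G (axis i 1 + axis i' 1) $ j = b $ j + A $ j $ i + A $ j $ i'" by (simp add: Gi)
    thus ?thesis using vert[of "axis i 1 + axis i' 1" j] that by (auto simp: axis_def)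
  qed
  have "\<exists>!i. A $ j $ i \<noteq> 0" for j
  proof -
    have "\<exists>i. A $ j $ i \<noteq> 0"
    proof (rule ccontr)
      assume "\<not> ?thesis"
      thus False using AB[of j j] by simp
    qed
    moreover have "i = i'" if "A $ j $ i \<noteq> 0" "A $ j $ i' \<noteq> 0" for i i'
    proof (rule ccontr)
      assume "i \<noteq> i'"
      \<comment> \<open>Two nonzero entries in a row would both equal \<open>1 - 2 * b $ j\<close>;
        the image of the sum of the two unit vectors would then have coordinate
        \<open>2 - 3 * b $ j\<close>, which is 2 or -1.\<close>
      from bAA[OF this, of j] show False using that b[of j] bA[of j i] bA[of j i'] by auto
    qed
    ultimately show ?thesis by blast
  qed
  then obtain \<pi> where \<pi>: "\<And>j. A $ j $ \<pi> j \<noteq> 0" "\<And>j i. i \<noteq> \<pi> j \<Longrightarrow> A $ j $ i = 0" by metis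
  have row: "(\<Sum>i\<in>UNIV. A $ j $ i * x i) = A $ j $ \<pi> j * x (\<pi> j)" for j and x :: "'n \<Rightarrow> real"
    by (subst sum.remove[of _ "\<pi> j"]) (auto simp: \<pi>(2) intro!: sum.neutral)
  \<comment> \<open>If two rows had their nonzero entry in the same column, the product with the
    inverse \<open>B\<close> could not be 0 off the diagonal and 1 on it.\<close>
  have "inj \<pi>"
  proof (rule injI, rule ccontr)
    fix j j' assume eq: "\<pi> j = \<pi> j'" and ne: "j \<noteq> j'"
    have "A $ j $ \<pi> j * B $ \<pi> j $ j' = 0" using AB[of j j'] ne by (simp add: row)
    hence "B $ \<pi> j $ j' = 0" using \<pi>(1) by simp
    moreover have "A $ j' $ \<pi> j' * B $ \<pi> j' $ j' = 1" using AB[of j' j'] by (simp add: row)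
    ultimately show False using eq by simp
  qed
  hence "bij \<pi>" by (simp add: bij_def finite_UNIV_inj_surj)
  moreover have "G x $ j = b $ j + A $ j $ \<pi> j * x $ \<pi> j" for x j
    unfolding G_nth row ..
  ultimately show ?thesis using that[of \<pi> "\<lambda>j. b $ j" "\<lambda>j. A $ j $ \<pi> j"] by blast
qed

lemma finite_monomials_Q: "finite (monomials_Q k :: ('n::finite \<Rightarrow> nat) set)"
proof -
  have "monomials_Q k = PiE (UNIV :: 'n set) (\<lambda>_. {..k})" by (auto simp: monomials_Q_def)
  thus ?thesis by (simp add: finite_PiE)
qed

text \<open>Each factor becomes a univariate polynomial in a different coordinate, so the degree in
  each variable stays at most \<open>k\<close>. A general affine substitution would mix the
  variables and destroy this bound.\<close>

lemma monomials_Q_comp_symmetry: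
  fixes G :: "real^'n \<Rightarrow> real^'n"
  assumes \<pi>: "bij \<pi>" and G: "\<And>x j. G x $ j = b j + s j * x $ \<pi> j" and m: "m \<in> monomials_Q k"
  shows "(\<lambda>x. \<Prod>j\<in>UNIV. (G x $ j) ^ m j) \<in> polynomials (monomials_Q k)"
proof -
  \<comment> \<open>The expansion is padded up to degree \<open>k\<close>, which gives all factors
    the same index set and lets the product of sums be expanded over
    \<open>monomials_Q k\<close>.\<close>
  have "\<exists>c. \<forall>t::real. (\<beta> + \<gamma> * t) ^ l = (\<Sum>r\<le>k. c r * t ^ r)" if "l \<le> k" for \<beta> \<gamma> l
  proof (intro exI allI)
    fix t :: real
    let ?p = "[:\<beta>, \<gamma>:] ^ l"
    have "degree ?p \<le> degree [:\<beta>, \<gamma>:] * l" by (rule degree_power_le)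
    also have "\<dots> \<le> 1 * k" using that by (intro mult_mono) auto
    finally have deg: "degree ?p \<le> k" by simp
    have "(\<beta> + \<gamma> * t) ^ l = poly ?p t" by (simp add: mult.commute)
    also have "\<dots> = (\<Sum>r\<le>degree ?p. coeff ?p r * t ^ r)" by (rule poly_altdef)
    also have "\<dots> = (\<Sum>r\<le>k. coeff ?p r * t ^ r)"
      using deg by (intro sum.mono_neutral_left) (auto simp: coeff_eq_0)
    finally show "(\<beta> + \<gamma> * t) ^ l = (\<Sum>r\<le>k. coeff ?p r * t ^ r)" .
  qed
  hence "\<forall>j. \<exists>c. \<forall>t::real. (b j + s j * t) ^ m j = (\<Sum>r\<le>k. c r * t ^ r)"
    using m by (simp add: monomials_Q_def)
  then obtain c where c: "\<And>j t. (b j + s j * t) ^ m j = (\<Sum>r\<le>k. c j r * t ^ r)" by metis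
  have PiE: "PiE UNIV (\<lambda>_. {..k}) = (monomials_Q k :: ('n \<Rightarrow> nat) set)" by (auto simp: monomials_Q_def)
  have "(\<Prod>j\<in>UNIV. (G x $ j) ^ m j)
      = (\<Sum>g\<in>monomials_Q k. (\<Prod>i\<in>UNIV. c (inv \<pi> i) (g i)) * (\<Prod>i\<in>UNIV. (x $ i) ^ g i))" for x
  proof -
    have "(\<Prod>j\<in>UNIV. (G x $ j) ^ m j) = (\<Prod>j\<in>UNIV. \<Sum>r\<le>k. c j r * (x $ \<pi> j) ^ r)"
      by (simp add: G c)
    also have "\<dots> = (\<Prod>i\<in>UNIV. \<Sum>r\<le>k. c (inv \<pi> i) r * (x $ i) ^ r)"
      using \<pi> by (intro prod.reindex_bij_witness[of _ "inv \<pi>" \<pi>])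
        (auto simp: bij_is_inj inv_f_f surj_f_inv_f bij_is_surj)
    also have "\<dots> = (\<Sum>g\<in>PiE UNIV (\<lambda>_. {..k}). \<Prod>i\<in>UNIV. c (inv \<pi> i) (g i) * (x $ i) ^ g i)"
      by (rule prod_sum_PiE) auto
    finally show ?thesis by (simp add: PiE prod.distrib)
  qed
  thus ?thesis unfolding polynomials_def by (auto intro!: exI[of _ "\<lambda>g. \<Prod>i\<in>UNIV. c (inv \<pi> i) (g i)"])
qed

lemma polynomials_comp_symmetry:
  assumes "affine_param unit_cube G" "p \<in> polynomials (monomials_Q k)"
  shows "p \<circ> G \<in> polynomials (monomials_Q k)"
proof -
  obtain b s \<pi> where G: "bij \<pi>" "\<And>x j. G x $ j = b j + s j * x $ \<pi> j"
    using unit_cube_symmetry[OF assms(1)] by metis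
  obtain c where "p = (\<lambda>x. \<Sum>m\<in>monomials_Q k. c m * (\<Prod>i\<in>UNIV. (x $ i) ^ m i))"
    using assms(2) by (auto simp: polynomials_def)
  hence "p \<circ> G = (\<lambda>x. \<Sum>m\<in>monomials_Q k. c m * (\<Prod>i\<in>UNIV. (G x $ i) ^ m i))" by auto
  also have "\<dots> \<in> polynomials (monomials_Q k)"
    by (rule polynomials_sum[OF finite_monomials_Q monomials_Q_comp_symmetry[OF G]])
  finally show ?thesis .
qed

text \<open>Membership is defined through some parametrisation, which two members need not share.
  Any two parametrisations differ by a symmetry of the cube, so a fixed one can be used for all
  members, and linearity follows.\<close>

lemma local_space_Tensorial_iff:
  assumes F: "affine_param K F"
  shows "p \<in> local_space Tensorial k K \<longleftrightarrow> p \<circ> F \<in> polynomials (monomials_Q k)"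
proof
  assume "p \<in> local_space Tensorial k K"
  then obtain F' where F': "affine_param K F'" "p \<circ> F' \<in> polynomials (monomials_Q k)" by auto
  obtain A b where A: "invertible A" "F = (\<lambda>x. b + A *v x)" "K = F ` unit_cube"
    by (rule affine_paramE[OF F])
  obtain A' b' where A': "invertible A'" "F' = (\<lambda>x. b' + A' *v x)" "K = F' ` unit_cube"
    by (rule affine_paramE[OF F'(1)])
  obtain B where B: "A' ** B = mat 1" "B ** A' = mat 1" using A'(1) by (auto simp: invertible_def)
  \<comment> \<open>The transition map from \<open>F\<close> to \<open>F'\<close>, that is
    \<open>F'\<close> inverted after \<open>F\<close>, written out as an affine map.\<close>
  define G where "G = (\<lambda>x. B *v (b - b') + (B ** A) *v x)"
  have FG: "F' (G x) = F x" for x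
  proof -
    have AB: "A' *v (B *v y) = y" for y using B(1) by (simp add: matrix_vector_mul_assoc)
    have "F' (G x) = b' + A' *v (B *v (b - b') + B *v (A *v x))"
      unfolding A'(2) G_def by (simp only: matrix_vector_mul_assoc)
    also have "\<dots> = b + A *v x" unfolding matrix_vector_right_distrib AB by simp
    finally show ?thesis by (simp only: A(2))
  qed
  have inv_left: "B *v (A' *v y) = y" for y using B(2) by (simp add: matrix_vector_mul_assoc)
  have inj: "x = y" if "F' x = F' y" for x y
  proof -
    have "A' *v x = A' *v y" using that by (simp only: A'(2) add_left_cancel)
    thus ?thesis by (metis inv_left)
  qed
  have "invertible B" using B by (auto simp: invertible_def)
  hence "invertible (B ** A)" using A(1) by (rule invertible_mult)
  moreover have "unit_cube = G ` unit_cube"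
  proof
    show "unit_cube \<subseteq> G ` unit_cube"
    proof
      fix y :: "real^'a" assume "y \<in> unit_cube"
      hence "F' y \<in> F ` unit_cube" using A(3) A'(3) by blast
      then obtain x where "x \<in> unit_cube" "F' y = F x" by blast
      thus "y \<in> G ` unit_cube" using inj FG by (metis image_eqI)
    qed
    show "G ` unit_cube \<subseteq> unit_cube"
    proof
      fix y assume "y \<in> G ` unit_cube"
      then obtain x where x: "x \<in> unit_cube" "y = G x" by blast
      hence "F' y \<in> F' ` unit_cube" using FG A(3) A'(3) by (metis image_eqI)
      thus "y \<in> unit_cube" using inj by blast
    qed
  qed
  ultimately have "affine_param unit_cube G" unfolding affine_param_def G_def by blast
  hence "(p \<circ> F') \<circ> G \<in> polynomials (monomials_Q k)" using F'(2) by (rule polynomials_comp_symmetry)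
  moreover have "(p \<circ> F') \<circ> G = p \<circ> F" by (simp add: fun_eq_iff FG)
  ultimately show "p \<circ> F \<in> polynomials (monomials_Q k)" by simp
qed (use F in \<open>simp only: local_space.simps, blast\<close>)

lemma local_space_lincomb:
  assumes "p \<in> local_space kd k K" "q \<in> local_space kd k K"
  shows "(\<lambda>x. a * p x + b * q x) \<in> local_space kd k K"
proof (cases kd)
  case Simplicial
  thus ?thesis using assms polynomials_lincomb by simp
next
  case Tensorial
  obtain F where F: "affine_param K F" using assms(1) Tensorial by auto
  note iff = local_space_Tensorial_iff[OF F]
  have "p \<circ> F \<in> polynomials (monomials_Q k)" "q \<circ> F \<in> polynomials (monomials_Q k)"
    using assms unfolding Tensorial iff .
  from polynomials_lincomb[OF this, of a b]
  have "(\<lambda>x. a * p x + b * q x) \<circ> F \<in> polynomials (monomials_Q k)" by (simp add: comp_def)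
  thus ?thesis unfolding Tensorial iff .
qed

section \<open>Lowest-order polynomials and the sign of the mesh function\<close>

text \<open>A multi-index of total at most 1 has at most one nonzero entry, so each monomial is 1 or
  a coordinate.\<close>

lemma polynomials_P1_affine:
  assumes "p \<in> polynomials (monomials_P 1)"
  obtains a c where "\<And>x. p x = a \<bullet> x + c"
proof -
  have mono: "\<exists>a c. \<forall>x::real^'a. (\<Prod>i\<in>UNIV. (x $ i) ^ m i) = a \<bullet> x + c" if m: "m \<in> monomials_P 1" for m
  proof (cases "\<forall>i. m i = 0")
    case True
    thus ?thesis by (intro exI[of _ 0] exI[of _ 1]) simp
  next
    case False
    then obtain j where j: "m j \<noteq> 0" by blast
    have "m j + (\<Sum>i\<in>UNIV - {j}. m i) \<le> 1"
      using m by (simp add: monomials_P_def sum.remove[of UNIV j m])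
    moreover have "1 \<le> m j" using j by simp
    ultimately have "m j = 1" "(\<Sum>i\<in>UNIV - {j}. m i) = 0" by linarith+
    hence "m j = 1" "\<forall>i. i \<noteq> j \<longrightarrow> m i = 0" by (simp_all only: sum_eq_0_iff finite_Diff finite) auto
    hence "(\<Prod>i\<in>UNIV. (x $ i) ^ m i) = axis j 1 \<bullet> x" for x :: "real^'a"
    proof -
      have "(\<Prod>i\<in>UNIV. (x $ i) ^ m i) = (x $ j) ^ m j * (\<Prod>i\<in>UNIV - {j}. (x $ i) ^ m i)"
        by (rule prod.remove) auto
      also have "(\<Prod>i\<in>UNIV - {j}. (x $ i) ^ m i) = 1"
        using \<open>\<forall>i. i \<noteq> j \<longrightarrow> m i = 0\<close> by (intro prod.neutral) auto
      finally show ?thesis using \<open>m j = 1\<close> by (simp add: inner_axis')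
    qed
    thus ?thesis by (intro exI[of _ "axis j 1"] exI[of _ 0]) simp
  qed
  have "\<forall>m\<in>monomials_P 1. \<exists>f. \<forall>x::real^'a. (\<Prod>i\<in>UNIV. (x $ i) ^ m i) = fst f \<bullet> x + snd f"
    using mono by simp
  then obtain f where f: "\<forall>m\<in>monomials_P 1. \<forall>x::real^'a. (\<Prod>i\<in>UNIV. (x $ i) ^ m i) = fst (f m) \<bullet> x + snd (f m)"
    by (rule bchoice[THEN exE])
  define a c where "a m = fst (f m)" and "c m = snd (f m)" for m
  have ac: "(\<Prod>i\<in>UNIV. (x $ i) ^ m i) = a m \<bullet> x + c m" if "m \<in> monomials_P 1" for m x
    using f that by (simp add: a_def c_def)
  obtain r where "p = (\<lambda>x. \<Sum>m\<in>monomials_P 1. r m * (\<Prod>i\<in>UNIV. (x $ i) ^ m i))"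
    using assms by (auto simp: polynomials_def)
  hence "p x = (\<Sum>m\<in>monomials_P 1. r m *\<^sub>R a m) \<bullet> x + (\<Sum>m\<in>monomials_P 1. r m * c m)" for x
    by (simp only: inner_sum_left sum.distrib[symmetric]) (simp add: ac distrib_left cong: sum.cong)
  thus ?thesis by (rule that)
qed

text \<open>A multi-affine function is affine along each coordinate, so its sign on the cube is
  determined at the vertices by fixing one coordinate after the other.\<close>

lemma polynomials_Q1_nonneg_on_cube:
  fixes q :: "real^'n \<Rightarrow> real"
  assumes q: "q \<in> polynomials (monomials_Q 1)"
    and vert: "\<And>y. (\<And>i. y $ i = 0 \<or> y $ i = 1) \<Longrightarrow> 0 \<le> q y"
    and y: "y \<in> unit_cube"
  shows "0 \<le> q y"
proof -
  define upd where "upd y i t = (\<chi> j. if j = i then t else y $ j)" for y :: "real^'n" and i t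
  obtain r where r: "q = (\<lambda>x. \<Sum>m\<in>monomials_Q 1. r m * (\<Prod>i\<in>UNIV. (x $ i) ^ m i))"
    using q by (auto simp: polynomials_def)
  have aff: "q y = (1 - y $ i) * q (upd y i 0) + y $ i * q (upd y i 1)" for y i
  proof -
    have *: "(\<Prod>j\<in>UNIV. (y $ j) ^ m j)
        = (1 - y $ i) * (\<Prod>j\<in>UNIV. (upd y i 0 $ j) ^ m j) + y $ i * (\<Prod>j\<in>UNIV. (upd y i 1 $ j) ^ m j)"
      if "m \<in> monomials_Q 1" for m
    proof -
      have "(\<Prod>j\<in>UNIV. (upd y i t $ j) ^ m j) = t ^ m i * (\<Prod>j\<in>UNIV - {i}. (y $ j) ^ m j)" for t
        by (subst prod.remove[of _ i]) (auto simp: upd_def intro!: prod.cong)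
      moreover have "(\<Prod>j\<in>UNIV. (y $ j) ^ m j) = (y $ i) ^ m i * (\<Prod>j\<in>UNIV - {i}. (y $ j) ^ m j)"
        by (rule prod.remove) auto
      moreover have "m i = 0 \<or> m i = 1" using that by (auto simp: monomials_Q_def le_Suc_eq)
      ultimately show ?thesis by (auto simp: algebra_simps)
    qed
    have "q y = (\<Sum>m\<in>monomials_Q 1. (1 - y $ i) * (r m * (\<Prod>j\<in>UNIV. (upd y i 0 $ j) ^ m j))
        + y $ i * (r m * (\<Prod>j\<in>UNIV. (upd y i 1 $ j) ^ m j)))"
      unfolding r by (intro sum.cong refl) (simp only: * distrib_left mult.left_commute)
    thus ?thesis by (simp only: r sum.distrib sum_distrib_left)
  qed
  \<comment> \<open>\<open>S\<close> collects the coordinates that are still free; removing one of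
    them replaces the point by two points with that coordinate 0 or 1.\<close>
  have "0 \<le> q y" if "finite S" "y \<in> unit_cube" "\<And>i. i \<notin> S \<Longrightarrow> y $ i = 0 \<or> y $ i = 1" for S y
    using that
  proof (induction S arbitrary: y rule: finite_induct)
    case empty
    thus ?case by (intro vert) auto
  next
    case (insert i S)
    have "0 \<le> q (upd y i t)" if "t = 0 \<or> t = 1" for t
      using insert.prems that by (intro insert.IH) (auto simp: upd_def mem_unit_cube)
    moreover have "0 \<le> y $ i" "y $ i \<le> 1" using insert.prems(1) by (auto simp: mem_unit_cube)
    ultimately show ?case by (subst aff[of y i]) auto
  qed
  from this[of UNIV y] y show ?thesis by simp
qed

text \<open>On a simplex the function is affine, and a half-space containing the vertices contains
  their convex hull. On a parallelepiped it is only multi-affine after pull-back, hence the separate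
  argument on the cube.\<close>

lemma local_space_1_nonneg:
  assumes K: "is_element kd K" and p: "p \<in> local_space kd 1 K"
    and vert: "\<And>x. x \<in> element_vertices K \<Longrightarrow> 0 \<le> p x" and x: "x \<in> K"
  shows "0 \<le> p x"
proof (cases kd)
  case Simplicial
  hence "polytope K" using K simplex_imp_polytope by auto
  hence "K = convex hull (element_vertices K)"
    unfolding element_vertices_def
    by (intro Krein_Milman_Minkowski polytope_imp_compact polytope_imp_convex)
  moreover have "p \<in> polynomials (monomials_P 1)" using p Simplicial by simp
  then obtain a c where ac: "\<And>x. p x = a \<bullet> x + c" using polynomials_P1_affine by metis
  have "{x. 0 \<le> p x} = {x. a \<bullet> x \<ge> - c}" by (auto simp: ac)
  hence "convex {x. 0 \<le> p x}" by (simp add: convex_halfspace_ge)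
  hence "convex hull (element_vertices K) \<subseteq> {x. 0 \<le> p x}"
    using vert by (intro hull_minimal) auto
  ultimately show ?thesis using x by auto
next
  case Tensorial
  then obtain F where F: "affine_param K F" using K by auto
  obtain A b where A: "invertible A" "F = (\<lambda>x. b + A *v x)" "K = F ` unit_cube"
    by (rule affine_paramE[OF F])
  have "p \<circ> F \<in> polynomials (monomials_Q 1)"
    using p unfolding Tensorial local_space_Tensorial_iff[OF F] .
  moreover have "0 \<le> (p \<circ> F) y" if "\<And>i. y $ i = 0 \<or> y $ i = 1" for y
  proof -
    have "y extreme_point_of unit_cube" using that by (simp add: extreme_point_of_unit_cube)
    hence "F y extreme_point_of K"
      unfolding A(3) unfolding A(2) using extreme_point_of_affine_image[OF A(1)] by blast
    thus ?thesis using vert by (simp add: element_vertices_def)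
  qed
  moreover obtain y where "y \<in> unit_cube" "x = F y" using x A(3) by blast
  ultimately show ?thesis using polynomials_Q1_nonneg_on_cube[of "p \<circ> F" y] by simp
qed

text \<open>The weights of s use the mesh function at Lagrange nodes, which for \<open>k > 1\<close>
  need not be vertices; averages of diameters are nonnegative at the vertices, and this sign spreads
  over each element.\<close>

lemma mesh_function_nonneg:
  assumes \<Omega>: "bounded \<Omega>" and P: "conforming_mesh kd \<Omega> P" and hf: "mesh_function kd P hf"
    and x: "x \<in> \<Omega>"
  shows "0 \<le> hf x"
proof -
  have UP: "\<Union>P = closure \<Omega>" using P by (simp add: conforming_mesh_def)
  obtain K where K: "K \<in> P" "x \<in> K" using x UP closure_subset by blast
  have bdd: "bounded K'" if "K' \<in> P" for K'
    using that UP bounded_closure[OF \<Omega>] by (metis Union_upper bounded_subset)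
  obtain p where p: "p \<in> local_space kd 1 K" "\<And>x. x \<in> K \<Longrightarrow> hf x = p x"
    using hf K by (auto simp: mesh_function_def)
  have "0 \<le> p y" if y: "y \<in> element_vertices K" for y
  proof -
    have "y \<in> K" using y by (simp add: element_vertices_def extreme_point_of_def)
    moreover have "hf y = (\<Sum>K\<in>elements_at P y. diameter K) / real (card (elements_at P y))"
      using hf K y by (auto simp: mesh_function_def)
    moreover have "0 \<le> (\<Sum>K\<in>elements_at P y. diameter K)"
      by (intro sum_nonneg diameter_ge_0 bdd) (auto simp: elements_at_def)
    ultimately show ?thesis using p(2)[of y] by simp
  qed
  hence "0 \<le> p x"
    using local_space_1_nonneg[of kd K p x] P K p by (simp add: conforming_mesh_def)
  thus ?thesis using p(2) K by simp
qed

text \<open>The degenerate cases are harmless: the essential supremum is minus infinity on a null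
  space and plus infinity for a nonmeasurable function, and \<open>real_of_ereal\<close> sends both
  to 0.\<close>

lemma Linf_norm_nonneg:
  assumes "\<And>x. 0 \<le> g x"
  shows "0 \<le> Linf_norm A g"
proof (cases "emeasure (lebesgue_on A) (space (lebesgue_on A)) = 0")
  case True
  show ?thesis
  proof (cases "(\<lambda>x. ereal (g x)) \<in> borel_measurable (lebesgue_on A)")
    case m: True
    have "esssup (lebesgue_on A) (\<lambda>x. ereal (g x)) = - \<infinity>"
      by (rule esssup_zero_space[OF True m])
    thus ?thesis by (simp add: Linf_norm_def)
  next
    case False
    thus ?thesis by (simp add: Linf_norm_def esssup_non_measurable top_ereal_def)
  qed
next
  case False
  have "0 = esssup (lebesgue_on A) (\<lambda>x. 0 :: ereal)" using esssup_const[OF False] by simp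
  also have "\<dots> \<le> esssup (lebesgue_on A) (\<lambda>x. ereal (g x))"
    using assms by (intro esssup_mono) auto
  finally show ?thesis unfolding Linf_norm_def by (rule real_of_ereal_pos)
qed

section \<open>The scheme\<close>

context bounded_open
begin

lemma zero_in_test_functions: "(\<lambda>_. 0) \<in> test_functions \<Omega>"
  by (simp add: test_functions_def C_k_const)

lemma zero_in_H10: "(\<lambda>_. 0) \<in> H10 \<Omega>"
proof -
  have "partial_deriv i (\<lambda>_::real^'n. 0) x = 0" for i x
    by (rule partial_deriv_eq) simp
  hence "AE x in lebesgue_on \<Omega>. wgrad \<Omega> (\<lambda>_. 0) x = 0"
    using wgrad_test_function[OF zero_in_test_functions] by (simp add: vec_eq_iff)
  hence "(LINT x|lebesgue_on \<Omega>. (norm (wgrad \<Omega> (\<lambda>_. 0) x))\<^sup>2) = 0"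
    by (intro integral_eq_zero_AE) (auto elim!: eventually_mono)
  hence "H1_norm \<Omega> (\<lambda>_. 0) = 0" by (simp add: H1_norm_def)
  thus ?thesis unfolding H10_def
    using zero_in_test_functions test_function_H1[OF zero_in_test_functions]
    by (auto intro!: exI[of _ "\<lambda>_ _. 0"])
qed

lemma fe_space_lincomb:
  assumes "v \<in> fe_space kd k \<Omega> P" "w \<in> fe_space kd k \<Omega> P"
  shows "(\<lambda>x. a * v x + b * w x) \<in> fe_space kd k \<Omega> P"
proof -
  have "\<exists>p\<in>local_space kd k K. \<forall>x\<in>K \<inter> \<Omega>. a * v x + b * w x = p x" if "K \<in> P" for K
  proof -
    have loc: "\<exists>p\<in>local_space kd k K. \<forall>x\<in>K \<inter> \<Omega>. u x = p x" if "u \<in> fe_space kd k \<Omega> P" for u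
      using that \<open>K \<in> P\<close> by (simp add: fe_space_def)
    obtain p where p: "p \<in> local_space kd k K" "\<forall>x\<in>K \<inter> \<Omega>. v x = p x"
      using loc[OF assms(1)] by (elim bexE)
    obtain q where q: "q \<in> local_space kd k K" "\<forall>x\<in>K \<inter> \<Omega>. w x = q x"
      using loc[OF assms(2)] by (elim bexE)
    show ?thesis
      by (rule bexI[OF _ local_space_lincomb[OF p(1) q(1), of a b]]) (use p(2) q(2) in simp)
  qed
  moreover have "continuous_on \<Omega> (\<lambda>x. a * v x + b * w x)"
    using assms by (intro continuous_intros) (simp_all add: fe_space_def)
  moreover have "(\<lambda>x. a * v x + b * w x) \<in> H10 \<Omega>"
    using assms by (intro H10_lincomb) (simp_all add: fe_space_def)
  moreover have "a * v x + b * w x = 0" if "x \<notin> \<Omega>" for x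
    using assms that by (simp add: fe_space_def)
  ultimately show ?thesis by (simp add: fe_space_def)
qed

lemma zero_in_fe_space:
  assumes "conforming_mesh kd \<Omega> P"
  shows "(\<lambda>_. 0) \<in> fe_space kd k \<Omega> P"
proof -
  have "(\<lambda>_. 0) \<in> local_space kd k K" if "K \<in> P" for K
  proof (cases kd)
    case Simplicial
    thus ?thesis by (simp add: polynomials_zero)
  next
    case Tensorial
    have "is_element kd K" using assms that by (simp add: conforming_mesh_def)
    then obtain F where "affine_param K F" using Tensorial by auto
    moreover have "(\<lambda>_. 0) \<circ> F \<in> polynomials (monomials_Q k)" by (simp add: comp_def polynomials_zero)
    ultimately show ?thesis using Tensorial by auto
  qed
  thus ?thesis by (auto simp: fe_space_def zero_in_H10 intro!: bexI[of _ "\<lambda>_. 0"])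
qed

end

context elliptic_form
begin

lemma H1_sum:
  "finite I \<Longrightarrow> (\<And>i. i \<in> I \<Longrightarrow> \<phi> i \<in> H1 \<Omega>) \<Longrightarrow> (\<lambda>x. \<Sum>i\<in>I. c i * \<phi> i x) \<in> H1 \<Omega>"
proof (induction I rule: finite_induct)
  case empty
  thus ?case using H10_imp_H1[OF zero_in_H10] by simp
next
  case (insert j I)
  thus ?case using H1_lincomb[of "\<phi> j" "\<lambda>x. \<Sum>i\<in>I. c i * \<phi> i x" "c j" 1] by simp
qed

lemma a_form_sum_left:
  assumes "finite I" "\<And>i. i \<in> I \<Longrightarrow> \<phi> i \<in> H1 \<Omega>" "w \<in> H1 \<Omega>"
  shows "a_form \<Omega> \<D> \<mu> (\<lambda>x. \<Sum>i\<in>I. c i * \<phi> i x) w = (\<Sum>i\<in>I. c i * a_form \<Omega> \<D> \<mu> (\<phi> i) w)"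
  using assms(1,2)
proof (induction I rule: finite_induct)
  case empty
  show ?case using a_form_lincomb_left[OF assms(3,3,3), of 0 0] by simp
next
  case (insert j I)
  have "(\<lambda>x. \<Sum>i\<in>I. c i * \<phi> i x) \<in> H1 \<Omega>" using insert by (intro H1_sum) auto
  from a_form_lincomb_left[OF _ this assms(3), of "\<phi> j" "c j" 1] show ?case
    using insert by simp
qed

lemma a_form_sum_sum:
  assumes I: "finite I" and \<phi>: "\<And>i. i \<in> I \<Longrightarrow> \<phi> i \<in> H1 \<Omega>"
  shows "a_form \<Omega> \<D> \<mu> (\<lambda>x. \<Sum>i\<in>I. c i * \<phi> i x) (\<lambda>x. \<Sum>i\<in>I. d i * \<phi> i x)
    = (\<Sum>i\<in>I. \<Sum>j\<in>I. c i * d j * a_form \<Omega> \<D> \<mu> (\<phi> i) (\<phi> j))"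
proof -
  have s: "(\<lambda>x. \<Sum>i\<in>I. d i * \<phi> i x) \<in> H1 \<Omega>" by (rule H1_sum[OF I \<phi>])
  have "a_form \<Omega> \<D> \<mu> (\<phi> i) (\<lambda>x. \<Sum>j\<in>I. d j * \<phi> j x) = (\<Sum>j\<in>I. d j * a_form \<Omega> \<D> \<mu> (\<phi> i) (\<phi> j))"
    if i: "i \<in> I" for i
  proof -
    have "a_form \<Omega> \<D> \<mu> (\<phi> i) (\<lambda>x. \<Sum>j\<in>I. d j * \<phi> j x) = a_form \<Omega> \<D> \<mu> (\<lambda>x. \<Sum>j\<in>I. d j * \<phi> j x) (\<phi> i)"
      by (rule a_form_commute[OF \<phi>[OF i] s])
    also have "\<dots> = (\<Sum>j\<in>I. d j * a_form \<Omega> \<D> \<mu> (\<phi> j) (\<phi> i))"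
      by (rule a_form_sum_left[OF I \<phi> \<phi>[OF i]])
    also have "\<dots> = (\<Sum>j\<in>I. d j * a_form \<Omega> \<D> \<mu> (\<phi> i) (\<phi> j))"
    proof (rule sum.cong[OF refl])
      fix j assume "j \<in> I"
      from a_form_commute[OF \<phi>[OF this] \<phi>[OF i]]
      show "d j * a_form \<Omega> \<D> \<mu> (\<phi> j) (\<phi> i) = d j * a_form \<Omega> \<D> \<mu> (\<phi> i) (\<phi> j)"
        by (rule arg_cong)
    qed
    finally show ?thesis .
  qed
  note * = this
  have "a_form \<Omega> \<D> \<mu> (\<lambda>x. \<Sum>i\<in>I. c i * \<phi> i x) (\<lambda>x. \<Sum>i\<in>I. d i * \<phi> i x)
      = (\<Sum>i\<in>I. c i * a_form \<Omega> \<D> \<mu> (\<phi> i) (\<lambda>x. \<Sum>i\<in>I. d i * \<phi> i x))"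
    by (rule a_form_sum_left[OF I \<phi> s])
  also have "\<dots> = (\<Sum>i\<in>I. c i * (\<Sum>j\<in>I. d j * a_form \<Omega> \<D> \<mu> (\<phi> i) (\<phi> j)))"
    by (intro sum.cong refl) (simp only: *)
  finally show ?thesis by (simp only: sum_distrib_left mult.assoc)
qed

end

text \<open>Finiteness follows from the Lagrange property instead of geometry: a sum over an
  infinite set is 0 by default, so a basis function would vanish at its own node, where it equals
  1.\<close>

lemma finite_internal_nodes:
  assumes "lagrange_basis kd k \<Omega> P \<phi>"
  shows "finite (internal_nodes kd k \<Omega> P)"
proof (rule ccontr)
  let ?X = "internal_nodes kd k \<Omega> P"
  assume inf: "infinite ?X"
  then obtain y where y: "y \<in> ?X" by (metis finite.emptyI ex_in_conv)
  then obtain c where "\<phi> y = (\<lambda>x. \<Sum>z\<in>?X. c z * \<phi> z x)"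
    using assms unfolding lagrange_basis_def by blast
  hence "\<phi> y y = 0" using inf by (metis sum.infinite)
  moreover have "\<phi> y y = 1" using assms y unfolding lagrange_basis_def by simp
  ultimately show False by simp
qed

section \<open>The finite element space in nodal coordinates\<close>

locale fe_form = elliptic_form \<Omega> \<D> \<mu> d\<^sub>0
  for \<Omega> :: "(real^'n) set" and \<D> \<mu> d\<^sub>0 +
  fixes kd k P \<phi> X V
  assumes mesh: "conforming_mesh kd \<Omega> P" and lagrange: "lagrange_basis kd k \<Omega> P \<phi>"
    and X_eq: "X = internal_nodes kd k \<Omega> P" and V_eq: "V = fe_space kd k \<Omega> P"
begin

abbreviation comb :: "(real^'n \<Rightarrow> real) \<Rightarrow> real^'n \<Rightarrow> real" where
  "comb c \<equiv> (\<lambda>x. \<Sum>y\<in>X. c y * \<phi> y x)"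

lemma finite_nodes: "finite X"
  unfolding X_eq by (rule finite_internal_nodes[OF lagrange])

lemma nodes_subset: "X \<subseteq> \<Omega>"
  by (auto simp: X_eq internal_nodes_def)

lemma basis_in_V: "y \<in> X \<Longrightarrow> \<phi> y \<in> V"
  using lagrange by (simp add: lagrange_basis_def X_eq V_eq)

lemma V_lincomb: "v \<in> V \<Longrightarrow> w \<in> V \<Longrightarrow> (\<lambda>x. a * v x + b * w x) \<in> V"
  unfolding V_eq by (rule fe_space_lincomb)

lemma V_diff: "v \<in> V \<Longrightarrow> w \<in> V \<Longrightarrow> (\<lambda>x. v x - w x) \<in> V"
  using V_lincomb[of v w 1 "-1"] by simp

lemma V_H10: "v \<in> V \<Longrightarrow> v \<in> H10 \<Omega>"
  by (simp add: V_eq fe_space_def)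

lemma V_H1: "v \<in> V \<Longrightarrow> v \<in> H1 \<Omega>"
  by (rule H10_imp_H1[OF V_H10])

lemma comb_in_V: "comb c \<in> V"
proof -
  have "(\<lambda>x. \<Sum>y\<in>Y. c y * \<phi> y x) \<in> V" if "finite Y" "Y \<subseteq> X" for Y
    using that
  proof (induction Y rule: finite_induct)
    case empty
    thus ?case using zero_in_fe_space[OF mesh] by (simp add: V_eq)
  next
    case (insert j Y)
    thus ?case using V_lincomb[OF basis_in_V, of j "\<lambda>x. \<Sum>y\<in>Y. c y * \<phi> y x" "c j" 1] by simp
  qed
  thus ?thesis using finite_nodes by blast
qed

lemma comb_node:
  assumes "z \<in> X"
  shows "comb c z = c z"
proof -
  have "comb c z = (\<Sum>y\<in>X. if y = z then c z else 0)"
    using lagrange assms by (intro sum.cong) (auto simp: lagrange_basis_def X_eq)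
  thus ?thesis using assms finite_nodes by simp
qed

lemma V_eq_comb:
  assumes "v \<in> V"
  shows "v = comb v"
proof -
  obtain c where c: "v = comb c" using lagrange assms unfolding lagrange_basis_def X_eq V_eq by blast
  hence "v y = c y" if "y \<in> X" for y using comb_node[OF that] by simp
  hence "comb v = comb c" by (intro ext sum.cong) auto
  thus ?thesis using c by simp
qed

abbreviation gram :: "real^'n \<Rightarrow> real^'n \<Rightarrow> real" where
  "gram i j \<equiv> a_form \<Omega> \<D> \<mu> (\<phi> i) (\<phi> j)"

lemma a_form_comb: "a_form \<Omega> \<D> \<mu> (comb c) (comb d) = (\<Sum>i\<in>X. \<Sum>j\<in>X. c i * d j * gram i j)"
  by (rule a_form_sum_sum[OF finite_nodes V_H1[OF basis_in_V]])

text \<open>Definiteness at the nodes and compactness of the sphere. The constant depends on the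
  mesh; it serves continuity and solvability and does not enter the monotonicity constant.\<close>

lemma a_form_coercive_nodal:
  "\<exists>l>0. \<forall>v\<in>V. l * (\<Sum>y\<in>X. (v y)\<^sup>2) \<le> a_form \<Omega> \<D> \<mu> v v"
proof -
  have "\<exists>l>0. \<forall>c. l * (\<Sum>i\<in>X. (c i)\<^sup>2) \<le> (\<Sum>i\<in>X. \<Sum>j\<in>X. c i * c j * gram i j)"
  proof (rule posdef_form_coercive[OF finite_nodes])
    fix c :: "real^'n \<Rightarrow> real" assume "\<exists>i\<in>X. c i \<noteq> 0"
    then obtain i where i: "i \<in> X" "c i \<noteq> 0" by blast
    have "a_form \<Omega> \<D> \<mu> (comb c) (comb c) \<noteq> 0"
    proof
      assume "a_form \<Omega> \<D> \<mu> (comb c) (comb c) = 0"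
      moreover have "continuous_on \<Omega> (comb c)" using comb_in_V[of c] by (simp add: V_eq fe_space_def)
      moreover have "i \<in> \<Omega>" using i nodes_subset by blast
      ultimately have "comb c i = 0" by (intro a_form_definite[OF V_H10[OF comb_in_V]])
      thus False using i comb_node by simp
    qed
    thus "0 < (\<Sum>i\<in>X. \<Sum>j\<in>X. c i * c j * gram i j)"
      using a_form_self_nonneg[OF V_H1[OF comb_in_V[of c]]] unfolding a_form_comb by linarith
  qed
  then obtain l where l: "l > 0" "\<And>c. l * (\<Sum>i\<in>X. (c i)\<^sup>2) \<le> (\<Sum>i\<in>X. \<Sum>j\<in>X. c i * c j * gram i j)"
    by blast
  have "l * (\<Sum>y\<in>X. (v y)\<^sup>2) \<le> a_form \<Omega> \<D> \<mu> v v" if "v \<in> V" for v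
    using l(2)[of v] unfolding a_form_comb[symmetric] using V_eq_comb[OF that] by simp
  thus ?thesis using l(1) by blast
qed

lemma H1_norm_coercive_nodal:
  "\<exists>l>0. \<forall>v\<in>V. l * (\<Sum>y\<in>X. (v y)\<^sup>2) \<le> (H1_norm \<Omega> v)\<^sup>2"
proof -
  interpret H1: elliptic_form \<Omega> "\<lambda>_. mat 1" "\<lambda>_. 1" 1 by (rule elliptic_form_H1)
  interpret H1: fe_form \<Omega> "\<lambda>_. mat 1" "\<lambda>_. 1" 1 kd k P \<phi> X V
    by unfold_locales (rule mesh lagrange X_eq V_eq)+
  show ?thesis unfolding H1_norm_eq_a_form by (rule H1.a_form_coercive_nodal)
qed

end

text \<open>Truncation and its complement are both nondecreasing, so their increments have the same
  sign and add up to that of the identity; the three claims follow.\<close>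

lemma clamp_facts:
  fixes \<aa> s t :: real
  assumes "\<aa> > 0"
  defines "\<kappa> \<equiv> \<lambda>t. max 0 (min t \<aa>)"
  shows "\<bar>\<kappa> s - \<kappa> t\<bar> \<le> \<bar>s - t\<bar>" "\<bar>(s - \<kappa> s) - (t - \<kappa> t)\<bar> \<le> \<bar>s - t\<bar>"
    "0 \<le> (\<kappa> s - \<kappa> t) * ((s - \<kappa> s) - (t - \<kappa> t))"
proof -
  have "s \<le> t \<Longrightarrow> \<kappa> s \<le> \<kappa> t \<and> s - \<kappa> s \<le> t - \<kappa> t" for s t
    using assms(1) unfolding \<kappa>_def max_def min_def by (simp split: if_split)
  hence "s \<le> t \<and> \<kappa> s \<le> \<kappa> t \<and> s - \<kappa> s \<le> t - \<kappa> t \<or> t \<le> s \<and> \<kappa> t \<le> \<kappa> s \<and> t - \<kappa> t \<le> s - \<kappa> s"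
    by (metis linear)
  thus "\<bar>\<kappa> s - \<kappa> t\<bar> \<le> \<bar>s - t\<bar>" "\<bar>(s - \<kappa> s) - (t - \<kappa> t)\<bar> \<le> \<bar>s - t\<bar>"
    "0 \<le> (\<kappa> s - \<kappa> t) * ((s - \<kappa> s) - (t - \<kappa> t))"
    by (linarith, linarith, metis diff_ge_0_iff_ge diff_le_0_iff_le mult_nonneg_nonneg mult_nonpos_nonpos)
qed

section \<open>The nonlinear operator in nodal coordinates\<close>

text \<open>Of the weights of s only the sign matters, and later the domination of a by s, so they
  are kept abstract as \<open>W\<close>.\<close>

locale nodal_scheme = fe_form \<Omega> \<D> \<mu> d\<^sub>0 kd k P \<phi> X V
  for \<Omega> :: "(real^'n) set" and \<D> \<mu> d\<^sub>0 kd k P \<phi> X V +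
  fixes W :: "real^'n \<Rightarrow> real" and \<alpha> \<aa> :: real and T
  assumes W_nonneg: "x \<in> X \<Longrightarrow> 0 \<le> W x" and alpha_pos: "\<alpha> > 0" and a_pos: "\<aa> > 0"
    and T_eq: "T v w = a_form \<Omega> \<D> \<mu> (plus_part \<aa> X \<phi> v) w
      + \<alpha> * (\<Sum>x\<in>X. W x * minus_part \<aa> X \<phi> v x * w x)"
begin

definition clamp :: "real \<Rightarrow> real" where "clamp t = max 0 (min t \<aa>)"

lemmas clamp_lipschitz = clamp_facts(1,2)[OF a_pos, folded clamp_def]
  and clamp_compl_nonneg = clamp_facts(3)[OF a_pos, folded clamp_def]

text \<open>For a node \<open>i\<close> this is the component of the operator at
  \<open>comb c\<close> tested with the basis function \<open>\<phi> i\<close>, so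
  \<open>\<tau> c\<close> is the left-hand side of the algebraic system.\<close>

definition \<tau> :: "(real^'n \<Rightarrow> real) \<Rightarrow> real^'n \<Rightarrow> real" where
  "\<tau> c i = (\<Sum>j\<in>X. clamp (c j) * gram j i) + \<alpha> * W i * (c i - clamp (c i))"

lemma plus_part_eq: "plus_part \<aa> X \<phi> v = comb (\<lambda>y. clamp (v y))"
  by (simp add: plus_part_def clamp_def)

lemma T_nodal:
  assumes "w \<in> V"
  shows "T v w = (\<Sum>i\<in>X. w i * \<tau> v i)"
proof -
  have "a_form \<Omega> \<D> \<mu> (plus_part \<aa> X \<phi> v) w = (\<Sum>i\<in>X. \<Sum>j\<in>X. clamp (v i) * w j * gram i j)"
    unfolding plus_part_eq using a_form_comb[of "\<lambda>y. clamp (v y)" w] V_eq_comb[OF assms] by simp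
  also have "\<dots> = (\<Sum>j\<in>X. w j * (\<Sum>i\<in>X. clamp (v i) * gram i j))"
    by (subst sum.swap) (simp add: sum_distrib_left mult_ac)
  finally have 1: "a_form \<Omega> \<D> \<mu> (plus_part \<aa> X \<phi> v) w = \<dots>" .
  have "(\<Sum>x\<in>X. W x * minus_part \<aa> X \<phi> v x * w x) = (\<Sum>x\<in>X. W x * (v x - clamp (v x)) * w x)"
    by (intro sum.cong refl) (simp add: minus_part_def plus_part_eq comb_node)
  thus ?thesis unfolding T_eq 1
    by (simp add: \<tau>_def distrib_left sum.distrib sum_distrib_left mult_ac)
qed

lemma \<tau>_lipschitz:
  "\<exists>L>0. \<forall>c d. (\<Sum>i\<in>X. (\<tau> c i - \<tau> d i)\<^sup>2) \<le> L * (\<Sum>i\<in>X. (c i - d i)\<^sup>2)"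
proof -
  \<comment> \<open>\<open>M\<close> bounds the dependence of component \<open>i\<close> on node
    \<open>j\<close> entrywise: truncation and complement are nonexpansive, and the stabilisation
    adds only to the diagonal. \<open>L\<close> is its squared Frobenius norm, plus 1 for strict
    positivity.\<close>
  define M where "M i j = \<bar>gram j i\<bar> + (if j = i then \<alpha> * W i else 0)" for i j
  define L where "L = (\<Sum>i\<in>X. \<Sum>j\<in>X. (M i j)\<^sup>2) + 1"
  have "L > 0" unfolding L_def by (intro add_nonneg_pos sum_nonneg) auto
  moreover have "(\<Sum>i\<in>X. (\<tau> c i - \<tau> d i)\<^sup>2) \<le> L * (\<Sum>i\<in>X. (c i - d i)\<^sup>2)" for c d
  proof -
    let ?n = "\<Sum>i\<in>X. (c i - d i)\<^sup>2"
    have "(\<tau> c i - \<tau> d i)\<^sup>2 \<le> (\<Sum>j\<in>X. (M i j)\<^sup>2) * ?n" if i: "i \<in> X" for i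
    proof -
      have "\<tau> c i - \<tau> d i = (\<Sum>j\<in>X. (clamp (c j) - clamp (d j)) * gram j i)
          + \<alpha> * W i * ((c i - clamp (c i)) - (d i - clamp (d i)))"
        by (simp add: \<tau>_def sum_subtractf algebra_simps)
      also have "\<bar>\<dots>\<bar> \<le> (\<Sum>j\<in>X. \<bar>(clamp (c j) - clamp (d j)) * gram j i\<bar>)
          + \<bar>\<alpha> * W i * ((c i - clamp (c i)) - (d i - clamp (d i)))\<bar>"
        by (intro order_trans[OF abs_triangle_ineq] add_mono sum_abs) auto
      also have "\<dots> \<le> (\<Sum>j\<in>X. \<bar>gram j i\<bar> * \<bar>c j - d j\<bar>) + \<alpha> * W i * \<bar>c i - d i\<bar>"
        using alpha_pos W_nonneg[OF i]
        by (intro add_mono sum_mono)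
          (auto simp: abs_mult mult.commute[of _ "\<bar>gram _ _\<bar>"] intro!: mult_left_mono clamp_lipschitz)
      also have "\<alpha> * W i * \<bar>c i - d i\<bar> = (\<Sum>j\<in>X. (if j = i then \<alpha> * W i else 0) * \<bar>c j - d j\<bar>)"
        using i finite_nodes by (simp add: if_distrib[of "\<lambda>z. z * _"] sum.delta cong: if_cong)
      also have "(\<Sum>j\<in>X. \<bar>gram j i\<bar> * \<bar>c j - d j\<bar>) + \<dots> = (\<Sum>j\<in>X. M i j * \<bar>c j - d j\<bar>)"
        by (simp add: M_def sum.distrib[symmetric] distrib_right)
      finally have "(\<tau> c i - \<tau> d i)\<^sup>2 \<le> (\<Sum>j\<in>X. M i j * \<bar>c j - d j\<bar>)\<^sup>2"
        by (simp add: abs_le_square_iff[symmetric])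
      also have "\<dots> \<le> (\<Sum>j\<in>X. (M i j)\<^sup>2) * (\<Sum>j\<in>X. \<bar>c j - d j\<bar>\<^sup>2)" by (rule Cauchy_Schwarz_ineq_sum)
      finally show ?thesis by simp
    qed
    hence "(\<Sum>i\<in>X. (\<tau> c i - \<tau> d i)\<^sup>2) \<le> (\<Sum>i\<in>X. (\<Sum>j\<in>X. (M i j)\<^sup>2) * ?n)" by (rule sum_mono)
    also have "\<dots> \<le> L * ?n" by (simp add: L_def sum_distrib_right[symmetric] distrib_right sum_nonneg)
    finally show ?thesis .
  qed
  ultimately show ?thesis by blast
qed

lemma T_continuous: "continuous_into_dual \<Omega> V T"
proof -
  obtain l where l: "l > 0" "\<And>v. v \<in> V \<Longrightarrow> l * (\<Sum>y\<in>X. (v y)\<^sup>2) \<le> (H1_norm \<Omega> v)\<^sup>2"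
    using H1_norm_coercive_nodal by blast
  obtain L where L: "L > 0" "\<And>c d. (\<Sum>i\<in>X. (\<tau> c i - \<tau> d i)\<^sup>2) \<le> L * (\<Sum>i\<in>X. (c i - d i)\<^sup>2)"
    using \<tau>_lipschitz by blast
  have sq: "(\<Sum>y\<in>X. (v y)\<^sup>2) \<le> (H1_norm \<Omega> v)\<^sup>2 / l" if "v \<in> V" for v
    using l(1) l(2)[OF that] by (simp add: field_simps)
  \<comment> \<open>Cauchy-Schwarz over the nodes, with nodal values of the test function controlled
    by its H1-norm. The same control is applied once more to the increment, which is why the final
    Lipschitz constant contains \<open>1 / l\<close>.\<close>
  have bd: "\<bar>\<Sum>i\<in>X. z i * t i\<bar> \<le> sqrt (S / l) * H1_norm \<Omega> z"
    if z: "z \<in> V" and S: "(\<Sum>i\<in>X. (t i)\<^sup>2) \<le> S" for z t S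
  proof -
    have S0: "0 \<le> S" using S sum_nonneg[of X "\<lambda>i. (t i)\<^sup>2"] by simp
    have "(\<Sum>i\<in>X. z i * t i)\<^sup>2 \<le> (\<Sum>i\<in>X. (z i)\<^sup>2) * (\<Sum>i\<in>X. (t i)\<^sup>2)" by (rule Cauchy_Schwarz_ineq_sum)
    also have "\<dots> \<le> (H1_norm \<Omega> z)\<^sup>2 / l * S"
      using l(1) by (intro mult_mono sq z S sum_nonneg) auto
    also have "\<dots> = (sqrt (S / l) * H1_norm \<Omega> z)\<^sup>2"
      using l(1) S0 by (simp add: power_mult_distrib)
    finally have "\<bar>\<Sum>i\<in>X. z i * t i\<bar> \<le> \<bar>sqrt (S / l) * H1_norm \<Omega> z\<bar>" by (simp only: abs_le_square_iff)
    thus ?thesis using S0 l(1) by (simp add: abs_mult H1_norm_nonneg)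
  qed
  have dual: "T v \<in> dual_space \<Omega> V" for v
  proof -
    have "T v (\<lambda>x. z x + w x) = T v z + T v w" if "z \<in> V" "w \<in> V" for z w
      using V_lincomb[OF that, of 1 1] that by (simp add: T_nodal distrib_right sum.distrib)
    moreover have "T v (\<lambda>x. c * z x) = c * T v z" if "z \<in> V" for c z
      using V_lincomb[OF that that, of c 0] that by (simp add: T_nodal sum_distrib_left mult.assoc)
    moreover have "\<bar>T v z\<bar> \<le> sqrt ((\<Sum>i\<in>X. (\<tau> v i)\<^sup>2) / l) * H1_norm \<Omega> z" if "z \<in> V" for z
      unfolding T_nodal[OF that] by (rule bd[OF that order_refl])
    ultimately show ?thesis unfolding dual_space_def by blast
  qed
  have lip: "dual_norm \<Omega> V (\<lambda>z. T w z - T v z) \<le> sqrt L / l * H1_norm \<Omega> (\<lambda>x. w x - v x)"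
    if v: "v \<in> V" and w: "w \<in> V" for v w
    unfolding dual_norm_def
  proof (rule cSUP_least)
    \<comment> \<open>The supremum is over a nonempty set because the zero function lies in the unit
      ball. Its \<open>wgrad\<close> is a choice, so its norm is computed from the estimate with
      both coefficients 0.\<close>
    have "H1_norm \<Omega> (\<lambda>_. 0) = 0"
      using bd[of "\<lambda>_. 0"] H1_norm_lincomb_le[OF V_H1[OF v] V_H1[OF v], of 0 0] by simp
    moreover have "(\<lambda>_. 0) \<in> V" using V_lincomb[OF v v, of 0 0] by simp
    ultimately show "{w \<in> V. H1_norm \<Omega> w \<le> 1} \<noteq> {}" by force
    fix z assume "z \<in> {w \<in> V. H1_norm \<Omega> w \<le> 1}"
    hence z: "z \<in> V" "H1_norm \<Omega> z \<le> 1" by auto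
    let ?H = "H1_norm \<Omega> (\<lambda>x. w x - v x)"
    have "(\<Sum>i\<in>X. (\<tau> w i - \<tau> v i)\<^sup>2) \<le> L * (\<Sum>i\<in>X. (w i - v i)\<^sup>2)" by (rule L(2))
    also have "\<dots> \<le> L * (?H\<^sup>2 / l)" using L(1) by (intro mult_left_mono sq[OF V_diff[OF w v]]) auto
    finally have "\<bar>\<Sum>i\<in>X. z i * (\<tau> w i - \<tau> v i)\<bar> \<le> sqrt (L * (?H\<^sup>2 / l) / l) * H1_norm \<Omega> z"
      by (rule bd[OF z(1)])
    also have "\<dots> \<le> sqrt (L * (?H\<^sup>2 / l) / l) * 1"
      using z L(1) l(1) by (intro mult_left_mono) auto
    also have "L * (?H\<^sup>2 / l) / l = L * (?H / l)\<^sup>2" by (simp add: power2_eq_square)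
    also have "sqrt (L * (?H / l)\<^sup>2) * 1 = sqrt L / l * ?H"
      using l(1) by (simp add: real_sqrt_mult H1_norm_nonneg)
    finally show "\<bar>T w z - T v z\<bar> \<le> sqrt L / l * ?H"
      using z(1) by (simp add: T_nodal right_diff_distrib sum_subtractf)
  qed
  have "\<exists>\<delta>>0. \<forall>w\<in>V. H1_norm \<Omega> (\<lambda>x. w x - v x) < \<delta> \<longrightarrow> dual_norm \<Omega> V (\<lambda>z. T w z - T v z) < \<epsilon>"
    if v: "v \<in> V" and \<epsilon>: "\<epsilon> > 0" for v \<epsilon>
  proof -
    define K where "K = sqrt L / l"
    have K: "K > 0" using L(1) l(1) by (simp add: K_def)
    have "dual_norm \<Omega> V (\<lambda>z. T w z - T v z) < \<epsilon>"
      if w: "w \<in> V" and d: "H1_norm \<Omega> (\<lambda>x. w x - v x) < \<epsilon> / K" for w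
    proof -
      have "K * H1_norm \<Omega> (\<lambda>x. w x - v x) < \<epsilon>" using d K by (simp add: field_simps)
      thus ?thesis using lip[OF v w] unfolding K_def by linarith
    qed
    moreover have "\<epsilon> / K > 0" using \<epsilon> K by simp
    ultimately show ?thesis by blast
  qed
  thus ?thesis unfolding continuous_into_dual_def using dual by blast
qed

section \<open>Strong monotonicity and unique solvability when s dominates a\<close>

context
  assumes dominated: "\<And>v. v \<in> V \<Longrightarrow> a_form \<Omega> \<D> \<mu> v v \<le> \<alpha> * (\<Sum>x\<in>X. W x * v x * v x)"
begin

text \<open>Stated for arbitrary coefficient vectors, because the fixed-point lemma quantifies over
  all of them and not only over members of \<open>V\<close>.\<close>

lemma \<tau>_strongly_monotone:
  "1/4 * a_form \<Omega> \<D> \<mu> (comb (\<lambda>y. c y - d y)) (comb (\<lambda>y. c y - d y))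
    \<le> (\<Sum>i\<in>X. (\<tau> c i - \<tau> d i) * (c i - d i))"
proof -
  define A where "A y = clamp (c y) - clamp (d y)" for y
  define B where "B y = (c y - clamp (c y)) - (d y - clamp (d y))" for y
  define q where "q u v = a_form \<Omega> \<D> \<mu> (comb u) (comb v)" for u v
  have AB: "c y - d y = 1 * A y + 1 * B y" for y by (simp add: A_def B_def)
  have H1: "comb u \<in> H1 \<Omega>" for u by (rule V_H1[OF comb_in_V])
  have lin: "q (\<lambda>y. a * u y + b * v y) w = a * q u w + b * q v w" for a b u v w
  proof -
    have "comb (\<lambda>y. a * u y + b * v y) = (\<lambda>x. a * comb u x + b * comb v x)"
      by (simp add: distrib_right sum.distrib sum_distrib_left mult.assoc)
    thus ?thesis unfolding q_def using a_form_lincomb_left[OF H1 H1 H1] by simp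
  qed
  have comm: "q u v = q v u" for u v unfolding q_def by (rule a_form_commute[OF H1 H1])
  have psd: "0 \<le> q u u" for u unfolding q_def by (rule a_form_self_nonneg[OF H1])
  have e: "(\<lambda>y. c y - d y) = (\<lambda>y. 1 * A y + 1 * B y)" using AB by blast
  have q_right: "q u (\<lambda>y. c y - d y) = q u A + q u B" for u
    unfolding e comm[of u] lin by simp
  note qA = q_right[of A]
  have "q (\<lambda>y. c y - d y) (\<lambda>y. c y - d y) = q (\<lambda>y. c y - d y) A + q (\<lambda>y. c y - d y) B"
    by (rule q_right)
  also have "\<dots> = q A A + 2 * q A B + q B B"
    unfolding comm[of "\<lambda>y. c y - d y"] q_right by (simp add: comm[of B A])
  finally have qe: "q (\<lambda>y. c y - d y) (\<lambda>y. c y - d y) = \<dots>" .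
  have "(\<Sum>i\<in>X. (\<tau> c i - \<tau> d i) * (c i - d i))
      = (\<Sum>i\<in>X. (\<Sum>j\<in>X. A j * gram j i) * (c i - d i)) + \<alpha> * (\<Sum>i\<in>X. W i * B i * (c i - d i))"
  proof -
    have "\<tau> c i - \<tau> d i = (\<Sum>j\<in>X. A j * gram j i) + \<alpha> * (W i * B i)" for i
      by (simp add: \<tau>_def A_def B_def sum_subtractf left_diff_distrib right_diff_distrib mult.assoc)
    thus ?thesis by (simp add: distrib_right sum.distrib sum_distrib_left mult.assoc)
  qed
  also have "(\<Sum>i\<in>X. (\<Sum>j\<in>X. A j * gram j i) * (c i - d i)) = q A (\<lambda>y. c y - d y)"
    unfolding q_def a_form_comb by (subst sum.swap) (simp add: sum_distrib_left mult_ac)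
  finally have lhs: "(\<Sum>i\<in>X. (\<tau> c i - \<tau> d i) * (c i - d i))
      = q A A + q A B + \<alpha> * (\<Sum>i\<in>X. W i * B i * (c i - d i))" by (simp only: qA)
  have "q B B \<le> \<alpha> * (\<Sum>i\<in>X. W i * comb B i * comb B i)"
    unfolding q_def by (rule dominated[OF comb_in_V])
  also have "(\<Sum>i\<in>X. W i * comb B i * comb B i) = (\<Sum>i\<in>X. W i * B i * B i)"
    by (intro sum.cong refl) (simp only: comb_node)
  also have "\<alpha> * (\<Sum>i\<in>X. W i * B i * B i) \<le> \<alpha> * (\<Sum>i\<in>X. W i * B i * (c i - d i))"
  proof (rule mult_left_mono[OF sum_mono])
    fix i assume "i \<in> X"
    have "0 \<le> A i * B i" unfolding A_def B_def by (rule clamp_compl_nonneg)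
    hence "0 \<le> W i * (A i * B i)" using W_nonneg[OF \<open>i \<in> X\<close>] by simp
    thus "W i * B i * B i \<le> W i * B i * (c i - d i)" by (simp add: AB algebra_simps)
  qed (use alpha_pos in simp)
  finally have BB: "q B B \<le> \<alpha> * (\<Sum>i\<in>X. W i * B i * (c i - d i))" .
  \<comment> \<open>The right side minus the left is
    \<open>1/4 * (x + 2 * y + z) + x / 2 + z / 2 + (s - z)\<close>. Here x, y, z stand for a(A, A),
    a(A, B), a(B, B), so the middle term is handled without knowing its sign.\<close>
  have arith: "1/4 * (x + 2 * y + z) \<le> x + y + s" if "z \<le> s" "0 \<le> x + 2 * y + z" "0 \<le> x" "0 \<le> z"
    for x y z s :: real using that by simp
  have "1/4 * q (\<lambda>y. c y - d y) (\<lambda>y. c y - d y) \<le> (\<Sum>i\<in>X. (\<tau> c i - \<tau> d i) * (c i - d i))"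
    unfolding lhs qe by (rule arith[OF BB psd[of "\<lambda>y. c y - d y", unfolded qe] psd psd])
  thus ?thesis unfolding q_def .
qed

lemma T_strongly_monotone:
  assumes v: "v \<in> V" and w: "w \<in> V"
  shows "1/4 * a_form \<Omega> \<D> \<mu> (\<lambda>x. v x - w x) (\<lambda>x. v x - w x)
    \<le> T v (\<lambda>x. v x - w x) - T w (\<lambda>x. v x - w x)"
proof -
  have "T v (\<lambda>x. v x - w x) - T w (\<lambda>x. v x - w x) = (\<Sum>i\<in>X. (\<tau> v i - \<tau> w i) * (v i - w i))"
    unfolding T_nodal[OF V_diff[OF v w]] sum_subtractf[symmetric]
    by (intro sum.cong refl) (simp add: algebra_simps)
  moreover have "comb (\<lambda>y. v y - w y) = (\<lambda>x. v x - w x)"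
    by (rule V_eq_comb[OF V_diff[OF v w], symmetric])
  ultimately show ?thesis using \<tau>_strongly_monotone[of v w] by (simp only:)
qed

text \<open>The problem is equivalent to the system \<open>\<tau> c i = f (\<phi> i)\<close> over
  the nodes. Existence is surjectivity of \<open>\<tau>\<close>; for uniqueness the difference of
  two solutions is tested with itself.\<close>

lemma T_unique_solution:
  assumes f: "f \<in> dual_space \<Omega> (H10 \<Omega>)"
  shows "\<exists>!u. u \<in> V \<and> (\<forall>v\<in>V. T u v = f v)"
proof -
  obtain l where l: "l > 0" "\<And>v. v \<in> V \<Longrightarrow> l * (\<Sum>y\<in>X. (v y)\<^sup>2) \<le> a_form \<Omega> \<D> \<mu> v v"
    using a_form_coercive_nodal by blast
  obtain L where L: "L > 0" "\<And>c d. (\<Sum>i\<in>X. (\<tau> c i - \<tau> d i)\<^sup>2) \<le> L * (\<Sum>i\<in>X. (c i - d i)\<^sup>2)"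
    using \<tau>_lipschitz by blast
  have f_add: "f (\<lambda>x. v x + w x) = f v + f w" if "v \<in> H10 \<Omega>" "w \<in> H10 \<Omega>" for v w
    using f that by (simp add: dual_space_def)
  have f_scale: "f (\<lambda>x. c * v x) = c * f v" if "v \<in> H10 \<Omega>" for c v
    using f that by (simp add: dual_space_def)
  have f_comb: "f (comb c) = (\<Sum>y\<in>X. c y * f (\<phi> y))" for c
  proof -
    \<comment> \<open>A functional is additive only on \<open>H10 \<Omega>\<close>, so membership of
      the partial sums is carried along in the induction.\<close>
    have "(\<lambda>x. \<Sum>y\<in>Y. c y * \<phi> y x) \<in> H10 \<Omega> \<and> f (\<lambda>x. \<Sum>y\<in>Y. c y * \<phi> y x) = (\<Sum>y\<in>Y. c y * f (\<phi> y))"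
      if "finite Y" "Y \<subseteq> X" for Y
      using that
    proof (induction Y rule: finite_induct)
      case empty
      thus ?case using f_scale[OF zero_in_H10, of 0] zero_in_H10 by simp
    next
      case (insert j Y)
      have j: "\<phi> j \<in> H10 \<Omega>" using insert by (intro V_H10 basis_in_V) auto
      have cj: "(\<lambda>x. c j * \<phi> j x) \<in> H10 \<Omega>" using H10_lincomb[OF j j, of "c j" 0] by simp
      have s: "(\<lambda>x. \<Sum>y\<in>Y. c y * \<phi> y x) \<in> H10 \<Omega>" using insert by auto
      show ?case using insert H10_lincomb[OF cj s, of 1 1] f_add[OF cj s] f_scale[OF j] by simp
    qed
    thus ?thesis using finite_nodes by blast
  qed
  have "\<exists>c. \<forall>i\<in>X. \<tau> c i = f (\<phi> i)"
  proof (rule strongly_monotone_lipschitz_surj[OF finite_nodes _ L(1) _ L(2)])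
    \<comment> \<open>The monotonicity constant 1/4 in the energy norm times the nodal coercivity
      constant \<open>l\<close>.\<close>
    show "l / 4 > 0" using l by simp
    fix c d :: "real^'n \<Rightarrow> real"
    have "(\<Sum>y\<in>X. (comb (\<lambda>y. c y - d y) y)\<^sup>2) = (\<Sum>i\<in>X. (c i - d i)\<^sup>2)"
      by (intro sum.cong refl) (simp only: comb_node)
    thus "l / 4 * (\<Sum>i\<in>X. (c i - d i)\<^sup>2) \<le> (\<Sum>i\<in>X. (\<tau> c i - \<tau> d i) * (c i - d i))"
      using \<tau>_strongly_monotone[of c d] l(2)[OF comb_in_V, of "\<lambda>y. c y - d y"] by simp
  qed
  then obtain c where c: "\<And>i. i \<in> X \<Longrightarrow> \<tau> c i = f (\<phi> i)" by blast
  \<comment> \<open>At the nodes \<open>comb c\<close> has the values of \<open>c\<close>, and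
    \<open>\<tau>\<close> sees nothing else there.\<close>
  have \<tau>_comb: "\<tau> (comb c) i = \<tau> c i" if "i \<in> X" for i
    using that by (simp add: \<tau>_def comb_node cong: sum.cong)
  show ?thesis
  proof (rule ex1I[of _ "comb c"], intro conjI ballI)
    show "comb c \<in> V" by (rule comb_in_V)
    fix v assume v: "v \<in> V"
    have "T (comb c) v = (\<Sum>i\<in>X. v i * f (\<phi> i))"
      unfolding T_nodal[OF v] by (intro sum.cong refl) (simp only: \<tau>_comb c)
    also have "\<dots> = f (comb v)" by (rule f_comb[symmetric])
    also have "comb v = v" by (rule V_eq_comb[OF v, symmetric])
    finally show "T (comb c) v = f v" .
  next
    fix u assume u: "u \<in> V \<and> (\<forall>v\<in>V. T u v = f v)"
    let ?z = "\<lambda>x. u x - comb c x"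
    have z: "?z \<in> V" using V_diff[OF _ comb_in_V] u by blast
    have "T (comb c) ?z = (\<Sum>i\<in>X. ?z i * f (\<phi> i))"
      unfolding T_nodal[OF z] by (intro sum.cong refl) (simp only: \<tau>_comb c)
    also have "\<dots> = f (comb ?z)" by (rule f_comb[symmetric])
    also have "comb ?z = ?z" by (rule V_eq_comb[OF z, symmetric])
    finally have "T u ?z - T (comb c) ?z = 0" using u z by simp
    hence "a_form \<Omega> \<D> \<mu> ?z ?z \<le> 0" using T_strongly_monotone[OF _ comb_in_V, of u c] u by simp
    hence "l * (\<Sum>y\<in>X. (?z y)\<^sup>2) \<le> 0" using l(2)[OF z] by linarith
    hence "(\<Sum>y\<in>X. (?z y)\<^sup>2) \<le> 0" using l(1) by (simp add: mult_le_0_iff)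
    hence "(\<Sum>y\<in>X. (?z y)\<^sup>2) = 0" by (intro antisym sum_nonneg) auto
    hence "\<forall>y\<in>X. ?z y = 0" using finite_nodes by (simp add: sum_nonneg_eq_0_iff)
    hence "\<And>y. y \<in> X \<Longrightarrow> u y = c y" using comb_node by simp
    hence "comb u = comb c" by (intro ext sum.cong) auto
    thus "u = comb c" using V_eq_comb u by metis
  qed
qed

end

end

section \<open>Application to the stabilised scheme on a family of meshes\<close>

theorem theorem3p2:
  fixes \<Omega> :: "(real^'n) set"
    and f :: "(real^'n \<Rightarrow> real) \<Rightarrow> real"
    and \<D> :: "real^'n \<Rightarrow> real^'n^'n" and \<mu> :: "real^'n \<Rightarrow> real"
    and d\<^sub>0 \<mu>\<^sub>0 :: real
    and N :: "real^'n^'n \<Rightarrow> real"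
    and kd :: element_kind and k :: nat
    and Meshes :: "(real^'n) set set set" and \<sigma> :: real
    and X :: "(real^'n) set set \<Rightarrow> (real^'n) set"
    and V :: "(real^'n) set set \<Rightarrow> (real^'n \<Rightarrow> real) set"
    and \<phi> :: "(real^'n) set set \<Rightarrow> real^'n \<Rightarrow> real^'n \<Rightarrow> real"
    and hf :: "(real^'n) set set \<Rightarrow> real^'n \<Rightarrow> real"
    and \<aa> \<alpha> C_equiv :: real
  defines "X \<equiv> internal_nodes kd k \<Omega>" and "V \<equiv> fe_space kd k \<Omega>"
  assumes dim: "CARD('n) \<in> {1, 2, 3}"
    and domain: "polyhedral_lipschitz_domain \<Omega>"
    and f: "f \<in> dual_space \<Omega> (H10 \<Omega>)"
    and D_bounded: "in_Linf \<Omega> \<D>"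
    and D_sym: "AE x in lebesgue_on \<Omega>. transpose (\<D> x) = \<D> x"
    and D_elliptic: "d\<^sub>0 > 0" "AE x in lebesgue_on \<Omega>. \<forall>y. y \<bullet> (\<D> x *v y) \<ge> d\<^sub>0 * (norm y)\<^sup>2"
    and mu_bounded: "in_Linf \<Omega> \<mu>"
    and mu_nonneg: "\<mu>\<^sub>0 \<ge> 0" "AE x in lebesgue_on \<Omega>. \<mu> x \<ge> \<mu>\<^sub>0"
    and matrix_norm: "is_norm N"
    and degree: "k \<ge> 1"
    and meshes: "\<And>P. P \<in> Meshes \<Longrightarrow> conforming_mesh kd \<Omega> P"
    and regular: "\<sigma> > 0" "\<And>P. P \<in> Meshes \<Longrightarrow> shape_regular \<sigma> P"
    and basis: "\<And>P. P \<in> Meshes \<Longrightarrow> lagrange_basis kd k \<Omega> P (\<phi> P)"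
    and mesh_fun: "\<And>P. P \<in> Meshes \<Longrightarrow> mesh_function kd P (hf P)"
    and bound: "\<aa> > 0"
    and alpha: "\<alpha> > 0"
    and C_equiv: "C_equiv > 0"
      "\<And>P \<alpha>' v. P \<in> Meshes \<Longrightarrow> \<alpha>' > 0 \<Longrightarrow> v \<in> V P \<Longrightarrow>
         (a_norm \<Omega> \<D> \<mu> v)\<^sup>2 \<le> C_equiv / \<alpha>' * (s_norm \<Omega> N \<D> \<mu> P (X P) (hf P) \<alpha>' v)\<^sup>2"
  shows
    "(\<forall>P \<in> Meshes. continuous_into_dual \<Omega> (V P) (T_op \<Omega> N \<D> \<mu> P (X P) (hf P) (\<phi> P) \<aa> \<alpha>)) \<and>
     (\<alpha> \<ge> C_equiv \<longrightarrow>
       (\<exists>\<beta>>0. \<forall>P \<in> Meshes. \<forall>v \<in> V P. \<forall>w \<in> V P.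
          T_op \<Omega> N \<D> \<mu> P (X P) (hf P) (\<phi> P) \<aa> \<alpha> v (\<lambda>x. v x - w x)
            - T_op \<Omega> N \<D> \<mu> P (X P) (hf P) (\<phi> P) \<aa> \<alpha> w (\<lambda>x. v x - w x)
          \<ge> \<beta> * (a_norm \<Omega> \<D> \<mu> (\<lambda>x. v x - w x))\<^sup>2) \<and>
       (\<forall>P \<in> Meshes. \<exists>!u. u \<in> V P \<and>
          (\<forall>v \<in> V P.
             a_form \<Omega> \<D> \<mu> (plus_part \<aa> (X P) (\<phi> P) u) v
               + s_form \<Omega> N \<D> \<mu> P (X P) (hf P) \<alpha> (minus_part \<aa> (X P) (\<phi> P) u) v
             = f v)))"
proof -
  define W where "W P x = Linf_norm (patch P x \<inter> \<Omega>) (\<lambda>y. N (\<D> y)) * hf P x powi (int CARD('n) - 2)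
        + Linf_norm (patch P x \<inter> \<Omega>) (\<lambda>y. \<bar>\<mu> y\<bar>) * hf P x ^ CARD('n)" for P x
  have s_eq: "s_form \<Omega> N \<D> \<mu> P (X P) (hf P) \<alpha>' v w = \<alpha>' * (\<Sum>x\<in>X P. W P x * v x * w x)" for P \<alpha>' v w
    by (simp add: s_form_def W_def)
  have dom: "open \<Omega>" "bounded \<Omega>" using domain by (auto simp: polyhedral_lipschitz_domain_def)
  have mu0: "AE x in lebesgue_on \<Omega>. \<mu> x \<ge> 0"
    using mu_nonneg(2) by eventually_elim (use mu_nonneg(1) in linarith)
  have scheme: "nodal_scheme \<Omega> \<D> \<mu> d\<^sub>0 kd k P (\<phi> P) (X P) (V P) (W P) \<alpha> \<aa>
      (T_op \<Omega> N \<D> \<mu> P (X P) (hf P) (\<phi> P) \<aa> \<alpha>)" if P: "P \<in> Meshes" for P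
  proof unfold_locales
    \<comment> \<open>In dimension one the exponent \<open>int CARD('n) - 2\<close> is -1; an
      integer power of a nonnegative base is nonnegative in that case too.\<close>
    show "0 \<le> W P x" if "x \<in> X P" for x
    proof -
      have "x \<in> \<Omega>" using that by (simp add: X_def internal_nodes_def)
      hence "0 \<le> hf P x" by (rule mesh_function_nonneg[OF dom(2) meshes[OF P] mesh_fun[OF P]])
      moreover have "0 \<le> N A" for A using matrix_norm by (simp add: is_norm_def)
      ultimately show ?thesis unfolding W_def
        by (intro add_nonneg_nonneg mult_nonneg_nonneg Linf_norm_nonneg zero_le_power_int zero_le_power) auto
    qed
    show "T_op \<Omega> N \<D> \<mu> P (X P) (hf P) (\<phi> P) \<aa> \<alpha> v w = a_form \<Omega> \<D> \<mu> (plus_part \<aa> (X P) (\<phi> P) v) w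
        + \<alpha> * (\<Sum>x\<in>X P. W P x * minus_part \<aa> (X P) (\<phi> P) v x * w x)" for v w
      by (simp add: T_op_def s_eq)
  qed (use dom D_bounded D_sym D_elliptic mu_bounded mu0 meshes[OF P] basis[OF P] alpha bound in
      \<open>simp_all add: X_def V_def\<close>)
  \<comment> \<open>Squaring undoes the square root in \<open>a_norm\<close> because the energy is
    nonnegative on \<open>V P\<close>.\<close>
  have a_norm2: "(a_norm \<Omega> \<D> \<mu> v)\<^sup>2 = a_form \<Omega> \<D> \<mu> v v" if "P \<in> Meshes" "v \<in> V P" for P v
  proof -
    interpret nodal_scheme \<Omega> \<D> \<mu> d\<^sub>0 kd k P "\<phi> P" "X P" "V P" "W P" \<alpha> \<aa>
      "T_op \<Omega> N \<D> \<mu> P (X P) (hf P) (\<phi> P) \<aa> \<alpha>" by (rule scheme[OF that(1)])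
    show ?thesis using a_form_self_nonneg[OF V_H1[OF that(2)]] by (simp add: a_norm_def)
  qed
  have dominated: "a_form \<Omega> \<D> \<mu> v v \<le> \<alpha> * (\<Sum>x\<in>X P. W P x * v x * v x)"
    if P: "P \<in> Meshes" and v: "v \<in> V P" and "\<alpha> \<ge> C_equiv" for P v
  proof -
    interpret nodal_scheme \<Omega> \<D> \<mu> d\<^sub>0 kd k P "\<phi> P" "X P" "V P" "W P" \<alpha> \<aa>
      "T_op \<Omega> N \<D> \<mu> P (X P) (hf P) (\<phi> P) \<aa> \<alpha>" by (rule scheme[OF P])
    let ?s = "\<alpha> * (\<Sum>x\<in>X P. W P x * v x * v x)"
    have "0 \<le> W P x * v x * v x" if "x \<in> X P" for x
      using W_nonneg[OF that] by (simp add: mult.assoc)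
    hence s0: "0 \<le> ?s"
      by (intro mult_nonneg_nonneg[OF less_imp_le[OF alpha]] sum_nonneg)
    have "a_form \<Omega> \<D> \<mu> v v \<le> C_equiv / \<alpha> * ?s"
      \<comment> \<open>The norm equivalence is taken at the parameter \<alpha> of the scheme
        itself; the factor \<open>C_equiv / \<alpha>\<close> is then at most 1.\<close>
      using C_equiv(2)[OF P alpha v] s0 unfolding a_norm2[OF P v] s_norm_def s_eq by simp
    also have "\<dots> \<le> 1 * ?s" using that alpha s0 by (intro mult_right_mono) auto
    finally show ?thesis by simp
  qed
  have "continuous_into_dual \<Omega> (V P) (T_op \<Omega> N \<D> \<mu> P (X P) (hf P) (\<phi> P) \<aa> \<alpha>)" if "P \<in> Meshes" for P
    by (rule nodal_scheme.T_continuous[OF scheme[OF that]])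
  moreover have "1/4 * (a_norm \<Omega> \<D> \<mu> (\<lambda>x. v x - w x))\<^sup>2
      \<le> T_op \<Omega> N \<D> \<mu> P (X P) (hf P) (\<phi> P) \<aa> \<alpha> v (\<lambda>x. v x - w x)
        - T_op \<Omega> N \<D> \<mu> P (X P) (hf P) (\<phi> P) \<aa> \<alpha> w (\<lambda>x. v x - w x)"
    if \<alpha>: "\<alpha> \<ge> C_equiv" and P: "P \<in> Meshes" and v: "v \<in> V P" and w: "w \<in> V P" for P v w
  proof -
    interpret nodal_scheme \<Omega> \<D> \<mu> d\<^sub>0 kd k P "\<phi> P" "X P" "V P" "W P" \<alpha> \<aa>
      "T_op \<Omega> N \<D> \<mu> P (X P) (hf P) (\<phi> P) \<aa> \<alpha>" by (rule scheme[OF P])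
    show ?thesis unfolding a_norm2[OF P V_diff[OF v w]]
      by (rule T_strongly_monotone[OF dominated[OF P _ \<alpha>] v w])
  qed
  moreover have "\<exists>!u. u \<in> V P \<and> (\<forall>v\<in>V P. a_form \<Omega> \<D> \<mu> (plus_part \<aa> (X P) (\<phi> P) u) v
      + s_form \<Omega> N \<D> \<mu> P (X P) (hf P) \<alpha> (minus_part \<aa> (X P) (\<phi> P) u) v = f v)"
    if \<alpha>: "\<alpha> \<ge> C_equiv" and P: "P \<in> Meshes" for P
    using nodal_scheme.T_unique_solution[OF scheme[OF P] dominated[OF P _ \<alpha>] f] unfolding T_op_def .
  \<comment> \<open>The witness 1/4 is chosen before the mesh, which expresses the independence of
    h.\<close>
  ultimately show ?thesis by (intro conjI impI exI[of _ "1/4"]) simp_all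
qed

end
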